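(* Let $\mathbb{S}^1=\mathbb{R}/\mathbb{Z}$ be equipped with the metric $d(x,y)=\min\{|x-y|,1-|x-y|\}$, and let $\mathcal{F}=\{f_0,\ldots,f_{N-1}\}$, $N\ge2$, be an iterated function system (finite family) of $C^1$-diffeomorphisms of $\mathbb{S}^1$. Assume that $(\mathcal{F},d)$ is proximal and that there does not exist a probability measure which is invariant by every map in $\mathcal{F}$. Then for every non-degenerate probability vector $\mathbf{p}=(p_0,\ldots,p_{N-1})$ there exist $\alpha\in(0,1]$, $\lambda\in(0,1)$ and $n\in\mathbb{N}$ such that $(\mathcal{F},\mathbf{p},D)$, with $D=(d^\alpha)_{n,\lambda}$, is contracting on average. Moreover, $d\le D\le C d^\alpha$ for some $C>0$, and hence $d$ and $D$ are strongly equivalent.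
   Context: $\mathbf{p}$ is non-degenerate if $p_i>0$ for all $i$ (and $\sum_i p_i=1$). Let $\Sigma_N^+=\{0,\ldots,N-1\}^{\mathbb{N}}$, $\mathbb{N}=\{1,2,\ldots\}$, and let $\mu$ be the Bernoulli measure on $\Sigma_N^+$ determined by $\mathbf{p}$; $\mathbb{E}(X)=\int X\,d\mu$. For $\xi=(\xi_1\xi_2\ldots)\in\Sigma_N^+$ put $f_\xi^n=f_{\xi_n}\circ\cdots\circ f_{\xi_1}$, $f_\xi^0=\mathrm{id}$. For a metric $\rho$ on $\mathbb{S}^1$ and $n\ge 0$ put $Z_{n,\rho}^{x,y}(\xi)=\rho(f_\xi^n(x),f_\xi^n(y))$. $(\mathcal{F},d)$ is proximal if for every $x,y\in\mathbb{S}^1$ there exist $\xi\in\Sigma_N^+$ and an increasing sequence $(n_k)_{k}$ with $\lim_{k\to\infty}Z_{n_k,d}^{x,y}(\xi)=0$. A triple $(\mathcal{F},\mathbf{p},\rho)$ is contracting on average if there is $\kappa\in(0,1)$ with $\mathbb{E}(Z_{1,\rho}^{x,y})\le\kappa\,\rho(x,y)$ for all $x,y$. $d^\alpha(x,y)=(d(x,y))^\alpha$, which is a metric for $\alpha\in(0,1]$. For a metric $\rho$, $\lambda>0$ and $n\in\mathbb{N}$, $$\rho_{n,\lambda}(x,y)=\rho(x,y)+\frac{1}{\lambda^{1/n}}\mathbb{E}(Z_{1,\rho}^{x,y})+\cdots+\frac{1}{\lambda^{(n-1)/n}}\mathbb{E}(Z_{n-1,\rho}^{x,y}).$$ Two metrics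 $\rho,\rho'$ on the same space are strongly equivalent if there are constants $a,b>0$ with $a\rho(x,y)\le\rho'(x,y)\le b\rho(x,y)$ for all $x,y$.
   Formalization: The final clause is corrected to "d^α and D are strongly equivalent": strong equivalence of d and D is impossible, since contraction on average of D would then shrink the expected total length of a fine partition of the circle, which every homeomorphism keeps equal to 1. *)

theory Defs
  imports "HOL-Probability.Probability"
begin

section \<open>The circle\<close>

quotient_type circle = real / "\<lambda>x y :: real. x - y \<in> \<int>"
proof (intro equivpI reflpI sympI transpI)
  fix x y z :: real
  show "x - x \<in> \<int>" by simp
  show "y - x \<in> \<int>" if "x - y \<in> \<int>"
    using Ints_minus[OF that] by simp
  show "x - z \<in> \<int>" if "x - y \<in> \<int>" "y - z \<in> \<int>"
    using Ints_add[OF that] by simp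
qed

lemma frac_eq_of_diff_Ints:
  fixes x y :: real
  assumes "x - y \<in> \<int>"
  shows "frac x = frac y"
proof -
  obtain k where "x - y = of_int k" using assms by (auto elim: Ints_cases)
  then have "x = y + of_int k" by simp
  then show ?thesis by (simp add: frac_def)
qed

text \<open>The formula \<open>min {|x - y|, 1 - |x - y|}\<close> is evaluated at the representatives in \<open>[0,1)\<close>.\<close>

instantiation circle :: metric_space
begin

lift_definition dist_circle :: "circle \<Rightarrow> circle \<Rightarrow> real"
  is "\<lambda>x y. min \<bar>frac x - frac y\<bar> (1 - \<bar>frac x - frac y\<bar>)"
  by (metis frac_eq_of_diff_Ints)

definition uniformity_circle :: "(circle \<times> circle) filter"
  where "uniformity_circle = (INF e\<in>{0 <..}. principal {(x, y). dist x y < e})"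

definition open_circle :: "circle set \<Rightarrow> bool"
  where "open_circle U \<longleftrightarrow> (\<forall>x\<in>U. eventually (\<lambda>(x', y). x' = x \<longrightarrow> y \<in> U) uniformity)"

instance
proof
  fix x y z :: circle
  show "dist x y = 0 \<longleftrightarrow> x = y"
  proof (transfer, goal_cases)
    case (1 x y)
    have "frac x < 1" "frac y < 1" "0 \<le> frac x" "0 \<le> frac y"
      by (simp_all add: frac_lt_1)
    then have "min \<bar>frac x - frac y\<bar> (1 - \<bar>frac x - frac y\<bar>) = 0 \<longleftrightarrow> frac x = frac y"
      by linarith
    moreover have "x - y \<in> \<int>" if "frac x = frac y"
    proof -
      have "x - y = of_int (\<lfloor>x\<rfloor> - \<lfloor>y\<rfloor>)" using that by (simp add: frac_def)
      then show ?thesis by (metis Ints_of_int)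
    qed
    ultimately show ?case using frac_eq_of_diff_Ints by blast
  qed
  show "dist x y \<le> dist x z + dist y z"
  proof (transfer, goal_cases)
    case (1 x y z)
    have "frac x < 1" "frac y < 1" "frac z < 1" "0 \<le> frac x" "0 \<le> frac y" "0 \<le> frac z"
      by (simp_all add: frac_lt_1)
    then show ?case by linarith
  qed
qed (rule uniformity_circle_def open_circle_def)+

end

text \<open>A circle map is \<open>C\<^sup>1\<close> iff it has a \<open>C\<^sup>1\<close> lift to the universal cover; the lift is
  a coordinate expression of the map around every point. Orientation-reversing maps are included.\<close>

definition C1_circle_map :: "(circle \<Rightarrow> circle) \<Rightarrow> bool"
  where "C1_circle_map g \<longleftrightarrow>
    (\<exists>G :: real \<Rightarrow> real. G C1_differentiable_on UNIV \<and> (\<forall>t. g (abs_circle t) = abs_circle (G t)))"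

definition C1_diffeo :: "(circle \<Rightarrow> circle) \<Rightarrow> bool"
  where "C1_diffeo g \<longleftrightarrow> bij g \<and> C1_circle_map g \<and> C1_circle_map (inv g)"

section \<open>Random iteration\<close>

definition nondegenerate_prob_vector :: "nat \<Rightarrow> (nat \<Rightarrow> real) \<Rightarrow> bool"
  where "nondegenerate_prob_vector N p \<longleftrightarrow> (\<forall>i<N. 0 < p i) \<and> (\<Sum>i<N. p i) = 1"

text \<open>Sequences are indexed by \<open>{1, 2, \<dots>}\<close>; as elements of an extensional function space
  they take the value \<open>undefined\<close> at \<open>0\<close>.\<close>

definition seq_space :: "nat \<Rightarrow> (nat \<Rightarrow> nat) set"
  where "seq_space N = (\<Pi>\<^sub>E j\<in>{1..}. {..<N})"

definition bernoulli_measure :: "nat \<Rightarrow> (nat \<Rightarrow> real) \<Rightarrow> (nat \<Rightarrow> nat) measure"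
  where "bernoulli_measure N p = (\<Pi>\<^sub>M j\<in>{1..}. point_measure {..<N} (\<lambda>i. ennreal (p i)))"

primrec rand_iter :: "(nat \<Rightarrow> 'a \<Rightarrow> 'a) \<Rightarrow> (nat \<Rightarrow> nat) \<Rightarrow> nat \<Rightarrow> 'a \<Rightarrow> 'a"
  where
    "rand_iter F \<xi> 0 = id"
  | "rand_iter F \<xi> (Suc n) = F (\<xi> (Suc n)) \<circ> rand_iter F \<xi> n"

definition Zdist ::
  "(nat \<Rightarrow> 'a \<Rightarrow> 'a) \<Rightarrow> ('a \<Rightarrow> 'a \<Rightarrow> real) \<Rightarrow> nat \<Rightarrow> 'a \<Rightarrow> 'a \<Rightarrow> (nat \<Rightarrow> nat) \<Rightarrow> real"
  where "Zdist F \<rho> n x y \<xi> = \<rho> (rand_iter F \<xi> n x) (rand_iter F \<xi> n y)"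

definition expect_Z ::
  "nat \<Rightarrow> (nat \<Rightarrow> 'a \<Rightarrow> 'a) \<Rightarrow> (nat \<Rightarrow> real) \<Rightarrow> ('a \<Rightarrow> 'a \<Rightarrow> real) \<Rightarrow> nat \<Rightarrow> 'a \<Rightarrow> 'a \<Rightarrow> real"
  where "expect_Z N F p \<rho> n x y = (\<integral>\<xi>. Zdist F \<rho> n x y \<xi> \<partial>bernoulli_measure N p)"

definition proximal :: "nat \<Rightarrow> (nat \<Rightarrow> 'a \<Rightarrow> 'a) \<Rightarrow> ('a \<Rightarrow> 'a \<Rightarrow> real) \<Rightarrow> bool"
  where "proximal N F \<rho> \<longleftrightarrow>
    (\<forall>x y. \<exists>\<xi>\<in>seq_space N. \<exists>r :: nat \<Rightarrow> nat. strict_mono r \<and>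
      (\<lambda>k. Zdist F \<rho> (r k) x y \<xi>) \<longlonglongrightarrow> 0)"

definition contracting_on_average ::
  "nat \<Rightarrow> (nat \<Rightarrow> 'a \<Rightarrow> 'a) \<Rightarrow> (nat \<Rightarrow> real) \<Rightarrow> ('a \<Rightarrow> 'a \<Rightarrow> real) \<Rightarrow> bool"
  where "contracting_on_average N F p \<rho> \<longleftrightarrow> Metric_space UNIV \<rho> \<and>
    (\<exists>\<kappa>\<in>{0<..<1}. \<forall>x y. expect_Z N F p \<rho> 1 x y \<le> \<kappa> * \<rho> x y)"

definition common_invariant_prob ::
  "nat \<Rightarrow> (nat \<Rightarrow> 'a \<Rightarrow> 'a) \<Rightarrow> 'a :: topological_space measure \<Rightarrow> bool"
  where "common_invariant_prob N F \<nu> \<longleftrightarrow>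
    prob_space \<nu> \<and> sets \<nu> = sets borel \<and> (\<forall>i<N. distr \<nu> borel (F i) = \<nu>)"

section \<open>Change of metric\<close>

definition power_dist :: "real \<Rightarrow> 'a :: metric_space \<Rightarrow> 'a \<Rightarrow> real"
  where "power_dist \<alpha> x y = dist x y powr \<alpha>"

definition averaged_metric ::
  "nat \<Rightarrow> (nat \<Rightarrow> 'a \<Rightarrow> 'a) \<Rightarrow> (nat \<Rightarrow> real) \<Rightarrow> ('a \<Rightarrow> 'a \<Rightarrow> real) \<Rightarrow> nat \<Rightarrow> real \<Rightarrow> 'a \<Rightarrow> 'a \<Rightarrow> real"
  where "averaged_metric N F p \<rho> n lam x y =
    \<rho> x y + (\<Sum>k=1..<n. 1 / lam powr (real k / real n) * expect_Z N F p \<rho> k x y)"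

definition strongly_equivalent :: "('a \<Rightarrow> 'a \<Rightarrow> real) \<Rightarrow> ('a \<Rightarrow> 'a \<Rightarrow> real) \<Rightarrow> bool"
  where "strongly_equivalent \<rho> \<rho>' \<longleftrightarrow> Metric_space UNIV \<rho> \<and> Metric_space UNIV \<rho>' \<and>
    (\<exists>a>0. \<exists>b>0. \<forall>x y. a * \<rho> x y \<le> \<rho>' x y \<and> \<rho>' x y \<le> b * \<rho> x y)"

end

theory Submission
  imports Defs
begin

text \<open>
  By telescoping, \<open>D\<close> contracts on average as soon as the mean of \<open>d\<^sup>\<alpha>\<close> after \<open>n\<close> steps is at most
  \<open>\<lambda> d\<^sup>\<alpha>\<close>. Near the diagonal, and for small \<open>\<alpha>\<close>, this holds if the expected logarithm of the derivative
  after \<open>n\<close> steps is negative at all points. To treat all pairs, \<open>d\<^sup>\<alpha>\<close> is truncated at the scale of the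
  local estimate: the truncation never increases on average and, by proximality and compactness,
  decreases by a definite factor after a bounded time.

  If no such \<open>n\<close> exists, there is a stationary measure \<open>\<nu>\<close> of maximal exponent \<open>c \<ge> 0\<close>. If \<open>\<nu>\<close> is not invariant
  under every map then, by strict convexity of \<open>t log t\<close>, the mean entropy at scale \<open>r\<close> of the images of \<open>\<nu>\<close>
  differs from that of \<open>\<nu>\<close> by at least some \<open>\<eta> > 0\<close> for all small \<open>r\<close>. A map with derivative \<open>a\<close> at \<open>x\<close>
  turns windows of size \<open>r / a\<close> at \<open>x\<close> into windows of size \<open>r\<close>. Hence the gains over the scales \<open>e\<^sup>-\<^sup>t\<close>,
  \<open>t \<le> \<tau>\<close>, telescope: up to small errors, \<open>\<eta> \<tau>\<close> is at most minus the integral of the drift \<open>psi\<close> against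
  \<open>D\<^sub>\<tau> \<nu>\<close>, where \<open>D\<^sub>\<tau>\<close> is minus the mean log mass of the windows of size \<open>e\<^sup>-\<^sup>\<tau>\<close> at a point. But \<open>D\<^sub>\<tau> \<nu>\<close> is
  stationary up to a bounded error, and as \<open>\<nu>\<close> is maximizing, the averages of \<open>psi\<close> over long times are
  close to \<open>c\<close> at most points; so the integral is at least \<open>- o(\<tau>)\<close>, a contradiction.
\<close>

section \<open>Averaged metrics\<close>

text \<open>The maps are only C^1 and nothing is known about \<open>\<nu>\<close> (atoms, density,
  doubling). So a derivative governs a window only up to a factor exp(eps) and at small scales, and
  log-masses at comparable scales agree only in the mean (\<open>ph_refine\<close>). Hence the gain
  \<eta> is fixed first and eps = \<eta> / 8 afterwards: the losses then add up to 3 * eps * \<tau>,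
  less than \<eta> * \<tau>. The exponent c is an infimum over n of the maxima of \<open>S n\<close>
  / n. So some n has \<open>S n\<close> <= n * (c + eps) everywhere, while the
  \<open>\<nu>\<close>-mean of \<open>S n\<close> is at least n * c: the difference is a nonnegative
  bounded weight of integral at most n * eps. It has to be integrated against the log-mass, which
  has mean up to \<tau> + 1 but may have high peaks; \<open>ph_weighted_bound\<close> says that a
  bounded weight of small integral cannot profit from these peaks. Powers of d enter because, for
  small \<alpha>, the mean of exp(\<alpha> z) is exp(\<alpha> * mean of z) up to an error of order
  \<alpha> squared in the exponent: a negative mean logarithm thus becomes a contraction of the mean
  of d^\<alpha>.\<close>

definition avg2 :: "nat \<Rightarrow> (nat \<Rightarrow> 'a \<Rightarrow> 'a) \<Rightarrow> (nat \<Rightarrow> real) \<Rightarrow> ('a \<Rightarrow> 'a \<Rightarrow> real) \<Rightarrow> 'a \<Rightarrow> 'a \<Rightarrow> real"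
  where "avg2 N F p \<rho> x y = (\<Sum>i<N. p i * \<rho> (F i x) (F i y))"

lemma rand_iter_cong:
  assumes "\<And>j. j \<in> {1..n} \<Longrightarrow> \<xi> j = \<xi>' j"
  shows "rand_iter F \<xi> n = rand_iter F \<xi>' n"
  using assms by (induction n) auto

section \<open>Expectations over the Bernoulli measure as iterates of a finite average\<close>

context
  fixes N :: nat and p :: "nat \<Rightarrow> real"
  assumes p: "nondegenerate_prob_vector N p"
begin

abbreviation coin :: "nat measure"
  where "coin \<equiv> point_measure {..<N} (\<lambda>i. ennreal (p i))"

lemma prob_space_coin: "prob_space coin"
proof
  have "(\<Sum>i<N. ennreal (p i)) = ennreal (\<Sum>i<N. p i)"
    using p by (intro sum_ennreal) (auto simp: nondegenerate_prob_vector_def less_imp_le)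
  then show "emeasure coin (space coin) = 1"
    using p by (simp add: space_point_measure emeasure_point_measure_finite nondegenerate_prob_vector_def)
qed

interpretation C: product_prob_space "\<lambda>_::nat. coin" "{1..}"
  by (simp add: product_prob_space_def product_prob_space_axioms_def product_sigma_finite_def
      prob_space_coin prob_space_imp_sigma_finite)

text \<open>Over a finite \<open>J\<close> the product sigma-algebra is the full power set of a
  finite set; this is why an arbitrary \<open>h\<close> is measurable and bounded.\<close>

lemma integrable_finite_coins:
  fixes h :: "(nat \<Rightarrow> nat) \<Rightarrow> real"
  assumes "finite J"
  shows "integrable (\<Pi>\<^sub>M j\<in>J. coin) h"
proof -
  interpret J: product_prob_space "\<lambda>_::nat. coin" J
    by (simp add: product_prob_space_def product_prob_space_axioms_def product_sigma_finite_def
        prob_space_coin prob_space_imp_sigma_finite)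
  let ?M = "\<Pi>\<^sub>M j\<in>J. coin"
  have "sets ?M = sets (\<Pi>\<^sub>M j\<in>J. count_space {..<N})"
    by (intro sets_PiM_cong) (auto simp: sets_point_measure)
  also have "\<dots> = sets (count_space (PiE J (\<lambda>_. {..<N})))"
    using assms by (subst count_space_PiM_finite) auto
  finally have s: "sets ?M = sets (count_space (PiE J (\<lambda>_. {..<N})))" .
  have m: "h \<in> borel_measurable ?M"
    by (subst measurable_cong_sets[OF s refl]) simp
  define B where "B = Max (insert 0 ((\<lambda>x. norm (h x)) ` PiE J (\<lambda>_. {..<N})))"
  have "norm (h x) \<le> B" if "x \<in> space ?M" for x
  proof -
    have "x \<in> PiE J (\<lambda>_. {..<N})" using that by (simp add: space_PiM space_point_measure)
    then show ?thesis unfolding B_def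
      using assms by (intro Max_ge) (auto intro!: finite_imageI finite_PiE)
  qed
  then show ?thesis
    using m by (intro J.integrable_const_bound[of _ B]) auto
qed

lemma integral_finite_coins:
  fixes h :: "(nat \<Rightarrow> nat) \<Rightarrow> real"
  assumes h: "\<And>\<xi> \<xi>'. (\<And>j. j \<in> {1..n} \<Longrightarrow> \<xi> j = \<xi>' j) \<Longrightarrow> h \<xi> = h \<xi>'"
  shows "(\<integral>\<xi>. h \<xi> \<partial>bernoulli_measure N p) =
    (\<integral>\<xi>. h \<xi> \<partial>(\<Pi>\<^sub>M j\<in>{1..n}. coin))"
proof -
  let ?M = "\<lambda>_::nat. coin"
  have "(\<integral>\<xi>. h \<xi> \<partial>(PiM {1..n} ?M))
      = (\<integral>\<xi>. h \<xi> \<partial>(distr (PiM {1..} ?M) (PiM {1..n} ?M) (\<lambda>x. restrict x {1..n})))"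
    by (subst C.distr_PiM_restrict_finite) auto
  also have "\<dots> = (\<integral>\<xi>. h (restrict \<xi> {1..n}) \<partial>(PiM {1..} ?M))"
    using integrable_finite_coins[of "{1..n}" h]
    by (intro integral_distr measurable_restrict_subset) (auto dest: borel_measurable_integrable)
  also have "\<dots> = (\<integral>\<xi>. h \<xi> \<partial>(PiM {1..} ?M))"
    by (intro Bochner_Integration.integral_cong refl h) auto
  finally show ?thesis by (simp add: bernoulli_measure_def)
qed

text \<open>Fubini for the coordinate \<open>Suc n\<close>: by hypothesis \<open>g \<xi>\<close>
  does not see it, so integrating it out leaves a sum with weights \<open>p\<close>.\<close>

lemma integral_last_coin:
  fixes g :: "(nat \<Rightarrow> nat) \<Rightarrow> nat \<Rightarrow> real"
  assumes g: "\<And>\<xi> \<xi>'. (\<And>j. j \<in> {1..n} \<Longrightarrow> \<xi> j = \<xi>' j) \<Longrightarrow> g \<xi> = g \<xi>'"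
  shows "(\<integral>\<xi>. g \<xi> (\<xi> (Suc n)) \<partial>bernoulli_measure N p) =
    (\<integral>\<xi>. (\<Sum>i<N. p i * g \<xi> i) \<partial>bernoulli_measure N p)"
proof -
  let ?M = "\<lambda>_::nat. coin"
  have "(\<integral>\<xi>. g \<xi> (\<xi> (Suc n)) \<partial>bernoulli_measure N p)
      = (\<integral>\<xi>. g \<xi> (\<xi> (Suc n)) \<partial>(PiM {1..Suc n} ?M))"
  proof (rule integral_finite_coins)
    fix \<xi> \<xi>' :: "nat \<Rightarrow> nat" assume *: "\<And>j. j \<in> {1..Suc n} \<Longrightarrow> \<xi> j = \<xi>' j"
    have "g \<xi> = g \<xi>'" by (rule g) (simp add: *)
    moreover have "\<xi> (Suc n) = \<xi>' (Suc n)" by (rule *) simp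
    ultimately show "g \<xi> (\<xi> (Suc n)) = g \<xi>' (\<xi>' (Suc n))" by simp
  qed
  also have "{1..Suc n} = insert (Suc n) {1..n}" by auto
  also have "(\<integral>\<xi>. g \<xi> (\<xi> (Suc n)) \<partial>(PiM (insert (Suc n) {1..n}) ?M))
      = (\<integral>x. (\<integral>y. g (x(Suc n := y)) ((x(Suc n := y)) (Suc n)) \<partial>?M (Suc n)) \<partial>PiM {1..n} ?M)"
    by (rule C.product_integral_insert) (auto intro!: integrable_finite_coins)
  also have "\<dots> = (\<integral>x. (\<Sum>i<N. p i * g x i) \<partial>PiM {1..n} ?M)"
  proof (intro Bochner_Integration.integral_cong refl)
    fix x :: "nat \<Rightarrow> nat"
    have "g (x(Suc n := y)) = g x" for y by (rule g) auto
    then have "(\<integral>y. g (x(Suc n := y)) ((x(Suc n := y)) (Suc n)) \<partial>?M (Suc n)) = (\<integral>y. g x y \<partial>?M (Suc n))"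
      by simp
    also have "\<dots> = (\<Sum>i<N. p i * g x i)"
      using p by (subst lebesgue_integral_point_measure_finite)
        (auto simp: nondegenerate_prob_vector_def less_imp_le)
    finally show "(\<integral>y. g (x(Suc n := y)) ((x(Suc n := y)) (Suc n)) \<partial>?M (Suc n)) = (\<Sum>i<N. p i * g x i)" .
  qed
  also have "\<dots> = (\<integral>\<xi>. (\<Sum>i<N. p i * g \<xi> i) \<partial>bernoulli_measure N p)"
    by (intro integral_finite_coins[symmetric] sum.cong refl) (metis g)
  finally show ?thesis .
qed

text \<open>\<open>rand_iter\<close> puts the newest map outermost, so averaging over the last coin
  replaces \<open>\<rho>\<close> by \<open>avg2 N F p \<rho>\<close>; hence the induction with
  \<open>\<rho>\<close> arbitrary. All later estimates are made on iterates of \<open>avg2\<close>,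
  the Markov operator of the two-point motion.\<close>

lemma expect_Z_eq: "expect_Z N F p \<rho> n = (avg2 N F p ^^ n) \<rho>"
proof (induction n arbitrary: \<rho>)
  case 0
  interpret prob_space "bernoulli_measure N p"
    unfolding bernoulli_measure_def by (rule C.P.prob_space_axioms)
  show ?case
    by (intro ext) (simp add: expect_Z_def Zdist_def prob_space)
next
  case (Suc n)
  have "expect_Z N F p \<rho> (Suc n) = expect_Z N F p (avg2 N F p \<rho>) n"
  proof (intro ext)
    fix x y
    have "expect_Z N F p \<rho> (Suc n) x y =
      (\<integral>\<xi>. (\<lambda>i. \<rho> (F i (rand_iter F \<xi> n x)) (F i (rand_iter F \<xi> n y))) (\<xi> (Suc n)) \<partial>bernoulli_measure N p)"
      by (simp add: expect_Z_def Zdist_def)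
    also have "\<dots> = (\<integral>\<xi>. (\<Sum>i<N. p i * \<rho> (F i (rand_iter F \<xi> n x)) (F i (rand_iter F \<xi> n y))) \<partial>bernoulli_measure N p)"
      by (rule integral_last_coin) (use rand_iter_cong in metis)
    also have "\<dots> = expect_Z N F p (avg2 N F p \<rho>) n x y"
      by (simp add: expect_Z_def Zdist_def avg2_def)
    finally show "expect_Z N F p \<rho> (Suc n) x y = expect_Z N F p (avg2 N F p \<rho>) n x y" .
  qed
  also have "\<dots> = (avg2 N F p ^^ Suc n) \<rho>"
    by (simp add: Suc.IH funpow_Suc_right del: funpow.simps)
  finally show ?case .
qed

end

section \<open>The averaging operator and the telescoping metric\<close>

lemma avg2_mono:
  assumes "nondegenerate_prob_vector N p" "\<And>x y. f x y \<le> g x y"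
  shows "avg2 N F p f x y \<le> avg2 N F p g x y"
  using assms unfolding avg2_def nondegenerate_prob_vector_def
  by (intro sum_mono mult_left_mono) (auto simp: less_imp_le)

lemma avg2_pow_mono:
  assumes "nondegenerate_prob_vector N p" "\<And>x y. f x y \<le> g x y"
  shows "(avg2 N F p ^^ k) f x y \<le> (avg2 N F p ^^ k) g x y"
  using assms by (induction k arbitrary: x y) (auto intro: avg2_mono)

lemma avg2_scale: "avg2 N F p (\<lambda>x y. c * f x y) = (\<lambda>x y. c * avg2 N F p f x y)"
  by (intro ext) (simp add: avg2_def sum_distrib_left mult.left_commute)

lemma avg2_pow_scale: "(avg2 N F p ^^ k) (\<lambda>x y. c * f x y) = (\<lambda>x y. c * (avg2 N F p ^^ k) f x y)"
  by (induction k) (simp_all add: avg2_scale)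

lemma avg2_const:
  assumes "nondegenerate_prob_vector N p"
  shows "avg2 N F p (\<lambda>x y. c) = (\<lambda>x y. c)"
  using assms by (intro ext) (simp add: avg2_def nondegenerate_prob_vector_def flip: sum_distrib_right)

lemma avg2_pow_bound:
  assumes p: "nondegenerate_prob_vector N p"
    and f: "\<And>x y. avg2 N F p f x y \<le> c * f x y" and c: "0 \<le> c"
  shows "(avg2 N F p ^^ k) f x y \<le> c ^ k * f x y"
proof (induction k arbitrary: x y)
  case (Suc k)
  have "(avg2 N F p ^^ Suc k) f x y \<le> avg2 N F p (\<lambda>x y. c ^ k * f x y) x y"
    using Suc by (auto intro: avg2_mono[OF p])
  also have "\<dots> = c ^ k * avg2 N F p f x y" by (simp add: avg2_scale)
  also have "\<dots> \<le> c ^ k * (c * f x y)" using c f by (intro mult_left_mono) auto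
  finally show ?case by (simp add: mult_ac)
qed simp

text \<open>Averaging D shifts its sum by one index, and the geometric weights satisfy
  \<open>b k = ka * b (Suc k)\<close> with \<open>ka = lam powr (1 / n)\<close>. So D shrinks by the
  factor \<open>ka\<close> up to the boundary terms \<open>b n * (Q ^^ n) \<rho> - \<rho>\<close>,
  which \<open>contr\<close> makes nonpositive. The Lipschitz constant \<open>L\<close> yields the
  upper bound of D by \<open>\<rho>\<close>.\<close>

lemma averaged_metric_equivalent:
  fixes F :: "nat \<Rightarrow> 'a \<Rightarrow> 'a"
  assumes p: "nondegenerate_prob_vector N p" and n: "n \<ge> 1" and lam: "0 < lam" "lam < 1"
    and \<rho>: "Metric_space UNIV \<rho>"
    and L: "\<And>i x y. i < N \<Longrightarrow> \<rho> (F i x) (F i y) \<le> L * \<rho> x y"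
    and contr: "\<And>x y. (avg2 N F p ^^ n) \<rho> x y \<le> lam * \<rho> x y"
  defines "D \<equiv> averaged_metric N F p \<rho> n lam"
  shows "contracting_on_average N F p D"
    and "\<And>x y. \<rho> x y \<le> D x y"
    and "\<exists>C>0. \<forall>x y. D x y \<le> C * \<rho> x y"
    and "strongly_equivalent \<rho> D"
proof -
  interpret \<rho>: Metric_space UNIV \<rho> by fact
  define Q where "Q = avg2 N F p"
  define b where "b k = 1 / lam powr (real k / real n)" for k
  have b0: "b 0 = 1" and bpos: "b k > 0" for k using lam by (auto simp: b_def)
  have bn: "b n = 1 / lam" using n lam by (simp add: b_def)
  define ka where "ka = lam powr (1 / real n)"
  have ka: "0 < ka" "ka < 1"
    using lam n powr_less_mono2[of "1 / real n" lam 1] by (auto simp: ka_def)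
  have bS: "b k = ka * b (Suc k)" for k
    using lam by (simp add: b_def ka_def add_divide_distrib powr_add)
  have Dx: "D x y = (\<Sum>k<n. b k * (Q ^^ k) \<rho> x y)" for x y
  proof -
    have "{..<n} = insert 0 {1..<n}" using n by auto
    then show ?thesis
      using lam by (simp add: D_def averaged_metric_def expect_Z_eq[OF p] Q_def b_def)
  qed
  have ppos: "i < N \<Longrightarrow> 0 < p i" and psum: "(\<Sum>i<N. p i) = 1" for i
    using p by (auto simp: nondegenerate_prob_vector_def)
  have pos: "0 \<le> (Q ^^ k) \<rho> x y" for k x y
    by (induction k arbitrary: x y)
      (auto simp: Q_def avg2_def intro!: sum_nonneg mult_nonneg_nonneg less_imp_le[OF ppos])
  have sym: "(Q ^^ k) \<rho> x y = (Q ^^ k) \<rho> y x" for k x y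
    by (induction k arbitrary: x y) (auto simp: Q_def avg2_def \<rho>.commute)
  have refl0: "(Q ^^ k) \<rho> x x = 0" for k x
    by (induction k arbitrary: x) (auto simp: Q_def avg2_def)
  have tri: "(Q ^^ k) \<rho> x z \<le> (Q ^^ k) \<rho> x y + (Q ^^ k) \<rho> y z" for k x y z
  proof (induction k arbitrary: x y z)
    case 0
    then show ?case using \<rho>.triangle by simp
  next
    case (Suc k)
    have QS: "(Q ^^ Suc k) \<rho> x y = (\<Sum>i<N. p i * (Q ^^ k) \<rho> (F i x) (F i y))" for x y
      by (simp add: Q_def avg2_def)
    have "(Q ^^ Suc k) \<rho> x z \<le> (\<Sum>i<N. p i * ((Q ^^ k) \<rho> (F i x) (F i y) + (Q ^^ k) \<rho> (F i y) (F i z)))"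
      unfolding QS by (intro sum_mono mult_left_mono Suc less_imp_le[OF ppos]) auto
    then show ?case unfolding QS by (simp add: distrib_left sum.distrib)
  qed
  show ge: "\<rho> x y \<le> D x y" for x y
  proof -
    have "b 0 * (Q ^^ 0) \<rho> x y \<le> D x y" unfolding Dx
      using n by (intro member_le_sum[of 0 _ "\<lambda>k. b k * (Q ^^ k) \<rho> x y"] mult_nonneg_nonneg
        pos less_imp_le[OF bpos]) auto
    then show ?thesis by (simp add: b0)
  qed
  have met: "Metric_space UNIV D"
  proof
    show "0 \<le> D x y" for x y using ge[of x y] \<rho>.nonneg[of x y] by linarith
    show "D x y = D y x" for x y unfolding Dx by (subst sym) simp
    show "D x y = 0 \<longleftrightarrow> x = y" for x y
    proof
      assume "D x y = 0"
      then have "\<rho> x y = 0" using ge[of x y] \<rho>.nonneg[of x y] by linarith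
      then show "x = y" by simp
    qed (simp add: Dx refl0)
    show "D x z \<le> D x y + D y z" for x y z
      unfolding Dx sum.distrib[symmetric] distrib_left[symmetric]
      using tri bpos by (intro sum_mono mult_left_mono) (auto intro: less_imp_le)
  qed
  \<comment> \<open>\<open>max L 0\<close>, because \<open>avg2_pow_bound\<close> asks for a
    nonnegative constant.\<close>
  have L1: "avg2 N F p \<rho> x y \<le> max L 0 * \<rho> x y" for x y
  proof -
    have "avg2 N F p \<rho> x y \<le> (\<Sum>i<N. p i * (max L 0 * \<rho> x y))"
      unfolding avg2_def
    proof (intro sum_mono mult_left_mono less_imp_le[OF ppos])
      fix i assume "i \<in> {..<N}"
      then have "\<rho> (F i x) (F i y) \<le> L * \<rho> x y" using L by auto
      also have "\<dots> \<le> max L 0 * \<rho> x y" by (intro mult_right_mono) auto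
      finally show "\<rho> (F i x) (F i y) \<le> max L 0 * \<rho> x y" .
    qed auto
    then show ?thesis by (simp add: psum flip: sum_distrib_right)
  qed
  show le: "\<exists>C>0. \<forall>x y. D x y \<le> C * \<rho> x y"
  proof (intro exI[of _ "1 + (\<Sum>k<n. b k * max L 0 ^ k)"] conjI allI)
    show "0 < 1 + (\<Sum>k<n. b k * max L 0 ^ k)"
      using bpos by (intro add_pos_nonneg sum_nonneg mult_nonneg_nonneg) (auto intro: less_imp_le)
    fix x y
    have "D x y \<le> (\<Sum>k<n. b k * (max L 0 ^ k * \<rho> x y))"
      unfolding Dx Q_def using avg2_pow_bound[OF p L1] bpos
      by (intro sum_mono mult_left_mono) (auto intro: less_imp_le)
    also have "\<dots> \<le> (1 + (\<Sum>k<n. b k * max L 0 ^ k)) * \<rho> x y"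
      using \<rho>.nonneg[of x y] by (simp add: distrib_right sum_distrib_right mult.assoc)
    finally show "D x y \<le> (1 + (\<Sum>k<n. b k * max L 0 ^ k)) * \<rho> x y" .
  qed
  show "contracting_on_average N F p D"
    unfolding contracting_on_average_def
  proof (intro conjI met bexI[of _ ka] allI)
    fix x y
    have "expect_Z N F p D 1 x y = (\<Sum>i<N. p i * (\<Sum>k<n. b k * (Q ^^ k) \<rho> (F i x) (F i y)))"
      by (simp add: expect_Z_eq[OF p] avg2_def Dx)
    also have "\<dots> = (\<Sum>k<n. b k * (Q ^^ Suc k) \<rho> x y)"
      by (simp add: Q_def avg2_def sum_distrib_left mult.left_commute) (rule sum.swap)
    also have "\<dots> = ka * (\<Sum>k<n. b (Suc k) * (Q ^^ Suc k) \<rho> x y)"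
      by (subst bS) (simp add: sum_distrib_left mult_ac)
    also have "(\<Sum>k<n. b (Suc k) * (Q ^^ Suc k) \<rho> x y) = (\<Sum>k<Suc n. b k * (Q ^^ k) \<rho> x y) - \<rho> x y"
      by (subst sum.lessThan_Suc_shift) (simp add: b0)
    also have "\<dots> = D x y + (Q ^^ n) \<rho> x y / lam - \<rho> x y"
      by (simp add: Dx bn)
    also have "\<dots> \<le> D x y"
      using contr[of x y] lam by (simp add: Q_def field_simps)
    finally show "expect_Z N F p D 1 x y \<le> ka * D x y" using ka by simp
  qed (use ka in auto)
  show "strongly_equivalent \<rho> D"
    unfolding strongly_equivalent_def
  proof (intro conjI \<rho> met)
    have "0 < (1::real) \<and> (\<exists>b>0. \<forall>x y. 1 * \<rho> x y \<le> D x y \<and> D x y \<le> b * \<rho> x y)"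
      using ge le by auto
    then show "\<exists>a>0. \<exists>b>0. \<forall>x y. a * \<rho> x y \<le> D x y \<and> D x y \<le> b * \<rho> x y" by blast
  qed
qed

text \<open>Subadditivity of \<open>t powr \<alpha>\<close> comes from t <= t^\<alpha> on [0,1],
  applied to the shares a / (a + b) and b / (a + b), whose sum is 1.\<close>

lemma Metric_space_power_dist:
  assumes "0 < \<alpha>" "\<alpha> \<le> 1"
  shows "Metric_space (UNIV :: 'a :: metric_space set) (power_dist \<alpha>)"
proof
  fix x y z :: 'a
  show "0 \<le> power_dist \<alpha> x y" by (simp add: power_dist_def)
  show "power_dist \<alpha> x y = power_dist \<alpha> y x" by (simp add: power_dist_def dist_commute)
  show "power_dist \<alpha> x y = 0 \<longleftrightarrow> x = y" by (simp add: power_dist_def)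
  have sub: "(a + b) powr \<alpha> \<le> a powr \<alpha> + b powr \<alpha>" if "0 \<le> a" "0 \<le> b" for a b :: real
  proof (cases "a + b = 0")
    case False
    then have s: "a + b > 0" using that by linarith
    have *: "t \<le> t powr \<alpha>" if "0 \<le> t" "t \<le> 1" for t :: real
      using powr_mono'[of \<alpha> 1 t] assms that by simp
    have "1 = a / (a + b) + b / (a + b)" using s by (simp flip: add_divide_distrib)
    also have "\<dots> \<le> (a / (a + b)) powr \<alpha> + (b / (a + b)) powr \<alpha>"
      using s that by (intro add_mono *) (auto simp: field_simps)
    also have "\<dots> = (a powr \<alpha> + b powr \<alpha>) / (a + b) powr \<alpha>"
      using s that by (simp add: powr_divide add_divide_distrib)
    finally show ?thesis using s by (simp add: field_simps)
  qed (use assms in simp)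
  have "power_dist \<alpha> x z \<le> (dist x y + dist y z) powr \<alpha>"
    unfolding power_dist_def using assms by (intro powr_mono2 dist_triangle) auto
  also have "\<dots> \<le> power_dist \<alpha> x y + power_dist \<alpha> y z"
    unfolding power_dist_def by (intro sub) auto
  finally show "power_dist \<alpha> x z \<le> power_dist \<alpha> x y + power_dist \<alpha> y z" .
qed

lemma avg2_pow_Suc: "(avg2 N F p ^^ Suc k) f x y = (\<Sum>i<N. p i * (avg2 N F p ^^ k) f (F i x) (F i y))"
  by (simp add: avg2_def[of N F p "(avg2 N F p ^^ k) f"])

text \<open>A word of length \<open>k\<close> has positive probability, so one word that takes
  \<open>h\<close> below its upper bound \<open>c\<close> takes the whole average below
  \<open>c\<close>. This turns proximality, a statement about single sequences, into one about
  means.\<close>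

lemma avg2_pow_less:
  fixes F :: "nat \<Rightarrow> 'a \<Rightarrow> 'a"
  assumes p: "nondegenerate_prob_vector N p"
    and h: "\<And>x y. h x y \<le> c" and \<xi>: "\<And>j. j \<in> {1..k} \<Longrightarrow> \<xi> j < N"
    and less: "h (rand_iter F \<xi> k x) (rand_iter F \<xi> k y) < c"
  shows "(avg2 N F p ^^ k) h x y < c"
  using h \<xi> less
proof (induction k arbitrary: h)
  case (Suc k)
  have pp: "\<And>i. i < N \<Longrightarrow> 0 < p i" "(\<Sum>i<N. p i) = 1" using p by (auto simp: nondegenerate_prob_vector_def)
  have "(avg2 N F p ^^ k) (avg2 N F p h) x y < c"
  proof (rule Suc.IH)
    show "avg2 N F p h x y \<le> c" for x y
      using avg2_mono[OF p, of h "\<lambda>_ _. c" F x y] Suc.prems(1) by (simp add: avg2_const[OF p])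
    show "\<xi> j < N" if "j \<in> {1..k}" for j using that by (intro Suc.prems) auto
    have "(\<Sum>i<N. p i * h (F i (rand_iter F \<xi> k x)) (F i (rand_iter F \<xi> k y))) < (\<Sum>i<N. p i * c)"
    proof (rule sum_strict_mono_ex1)
      have "\<xi> (Suc k) < N" by (intro Suc.prems) auto
      then show "\<exists>i\<in>{..<N}. p i * h (F i (rand_iter F \<xi> k x)) (F i (rand_iter F \<xi> k y)) < p i * c"
        using Suc.prems(3) pp by (intro bexI[of _ "\<xi> (Suc k)"]) auto
    qed (use Suc.prems(1) pp in \<open>auto intro!: mult_left_mono less_imp_le[OF pp(1)]\<close>)
    then show "avg2 N F p h (rand_iter F \<xi> k x) (rand_iter F \<xi> k y) < c"
      by (simp add: avg2_def pp flip: sum_distrib_right)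
  qed
  then show ?case by (simp add: funpow_Suc_right del: funpow.simps)
qed simp

section \<open>Lifts of circle diffeomorphisms\<close>

lemma dist_abs_circle_le: "dist (abs_circle x) (abs_circle y) \<le> \<bar>x - y + of_int k\<bar>"
proof -
  define m where "m = \<lfloor>x\<rfloor> - \<lfloor>y\<rfloor> + k"
  have e: "x - y + of_int k = frac x - frac y + of_int m"
    by (simp add: m_def frac_def)
  have b: "\<bar>frac x - frac y\<bar> < 1"
    using frac_lt_1[of x] frac_lt_1[of y] frac_ge_0[of x] frac_ge_0[of y] by linarith
  consider "m = 0" | "m \<ge> 1" | "m \<le> -1" by linarith
  then show ?thesis
  proof cases
    case 2
    then have "of_int m \<ge> (1::real)" by linarith
    then show ?thesis using b unfolding dist_circle.abs_eq e by linarith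
  next
    case 3
    then have "of_int m \<le> (-1::real)" by linarith
    then show ?thesis using b unfolding dist_circle.abs_eq e by linarith
  qed (simp add: dist_circle.abs_eq e)
qed

lemma dist_abs_circle_attained: "\<exists>k. dist (abs_circle x) (abs_circle y) = \<bar>x - y + of_int k\<bar>"
proof -
  have e: "frac x - frac y + of_int j = x - y + of_int (j - \<lfloor>x\<rfloor> + \<lfloor>y\<rfloor>)" for j
    by (simp add: frac_def)
  have b: "\<bar>frac x - frac y\<bar> < 1"
    using frac_lt_1[of x] frac_lt_1[of y] frac_ge_0[of x] frac_ge_0[of y] by linarith
  have "\<exists>j. dist (abs_circle x) (abs_circle y) = \<bar>frac x - frac y + of_int j\<bar>"
  proof -
    consider "\<bar>frac x - frac y\<bar> \<le> 1 - \<bar>frac x - frac y\<bar>"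
      | "\<bar>frac x - frac y\<bar> > 1 - \<bar>frac x - frac y\<bar>" "frac x \<ge> frac y"
      | "\<bar>frac x - frac y\<bar> > 1 - \<bar>frac x - frac y\<bar>" "frac x < frac y" by linarith
    then show ?thesis
    proof cases
      case 1 then show ?thesis by (intro exI[of _ 0]) (simp add: dist_circle.abs_eq)
    next
      case 2 then show ?thesis using b by (intro exI[of _ "-1"]) (simp add: dist_circle.abs_eq)
    next
      case 3 then show ?thesis using b by (intro exI[of _ 1]) (simp add: dist_circle.abs_eq)
    qed
  qed
  then show ?thesis unfolding e by blast
qed

lemma abs_circle_eq_iff: "abs_circle x = abs_circle y \<longleftrightarrow> x - y \<in> \<int>"
  using circle.abs_eq_iff by blast

lemma abs_circle_surj: "\<exists>t. x = abs_circle t"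
  by (metis Quotient3_circle Quotient3_abs_rep)

lemma abs_circle_surj_unit: "\<exists>t\<in>{0..1}. x = abs_circle t"
proof -
  obtain t where t: "x = abs_circle t" using abs_circle_surj by blast
  have "abs_circle t = abs_circle (frac t)" unfolding abs_circle_eq_iff by (simp add: frac_def)
  then show ?thesis using t frac_ge_0[of t] frac_lt_1[of t] by (intro bexI[of _ "frac t"]) auto
qed

lemma dist_circle_le_half: "dist (x :: circle) y \<le> 1/2"
  using abs_circle_surj[of x] abs_circle_surj[of y] by (auto simp: dist_circle.abs_eq min_def)

text \<open>Applied to \<open>G (x + 1) - G x\<close> it gives the degree of a lift, applied to
  \<open>H (G x) - x\<close> the integer by which a lift of the inverse has to be corrected.\<close>

lemma continuous_int_valued_const:
  fixes f :: "real \<Rightarrow> real"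
  assumes "continuous_on UNIV f" "\<And>x. f x \<in> \<int>"
  shows "\<exists>k::int. \<forall>x. f x = of_int k"
proof -
  have "f constant_on UNIV"
  proof (rule continuous_discrete_range_constant[OF connected_UNIV assms(1)])
    fix x :: real
    show "\<exists>e>0. \<forall>y. y \<in> UNIV \<and> f y \<noteq> f x \<longrightarrow> e \<le> norm (f y - f x)"
    proof (intro exI[of _ 1] conjI allI impI)
      fix y assume "y \<in> UNIV \<and> f y \<noteq> f x"
      moreover have "f y - f x \<in> \<int>" using assms(2) by auto
      ultimately show "1 \<le> norm (f y - f x)"
        using Ints_nonzero_abs_ge1[of "f y - f x"] by auto
    qed simp
  qed
  then obtain c where c: "\<And>x. f x = c" by (auto simp: constant_on_def)
  then show ?thesis using assms(2)[of 0] by (auto elim: Ints_cases)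
qed

text \<open>Functions on the circle are handled as 1-periodic functions on the line, where
  derivatives, Lebesgue measure and weak convergence of laws are at hand.\<close>

definition per1 :: "(real \<Rightarrow> 'a) \<Rightarrow> bool"
  where "per1 g \<longleftrightarrow> (\<forall>x. g (x + 1) = g x)"

lemma per1_add_int:
  assumes "per1 g"
  shows "g (x + of_int k) = g x"
proof -
  have n: "g (x + of_nat n) = g x" for x n
    using assms by (induction n arbitrary: x) (auto simp: per1_def add.assoc[symmetric])
  show ?thesis
  proof (cases "k \<ge> 0")
    case True
    then show ?thesis using n[of x "nat k"] by simp
  next
    case False
    then show ?thesis using n[of "x + of_int k" "nat (- k)"] by simp
  qed
qed

lemma per1_cong_Ints:
  assumes "per1 g" "x - y \<in> \<int>"
  shows "g x = g y"
proof -
  obtain k where "x - y = of_int k" using assms(2) by (auto elim: Ints_cases)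
  then have "x = y + of_int k" by simp
  then show ?thesis using per1_add_int[OF assms(1)] by simp
qed

lemma per1_frac: "per1 g \<Longrightarrow> g (frac x) = g x"
  by (rule per1_cong_Ints) (auto simp: frac_def)

lemma per1_continuous_bounded:
  fixes g :: "real \<Rightarrow> real"
  assumes "per1 g" "continuous_on UNIV g"
  obtains M where "M > 0" "\<And>x. \<bar>g x\<bar> \<le> M"
proof -
  have "bounded (g ` {0..1})"
    using assms(2) by (intro compact_imp_bounded compact_continuous_image) (auto intro: continuous_on_subset)
  then obtain M where M: "M > 0" "\<And>x. x \<in> {0..1} \<Longrightarrow> \<bar>g x\<bar> \<le> M"
    by (auto simp: bounded_pos)
  have "\<bar>g x\<bar> \<le> M" for x
    using M(2)[of "frac x"] frac_ge_0[of x] frac_lt_1[of x] per1_frac[OF assms(1), of x] by auto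
  then show ?thesis using M that by blast
qed

lemma per1_uniformly_continuous:
  fixes g :: "real \<Rightarrow> real"
  assumes "per1 g" "continuous_on UNIV g" "e > 0"
  obtains d where "d > 0" "\<And>x y. \<bar>x - y\<bar> \<le> d \<Longrightarrow> \<bar>g x - g y\<bar> < e"
proof -
  have "uniformly_continuous_on {-1..2} g"
    using assms(2) by (intro compact_uniformly_continuous) (auto intro: continuous_on_subset)
  then obtain d where d: "d > 0"
    "\<And>x y. x \<in> {-1..2} \<Longrightarrow> y \<in> {-1..2} \<Longrightarrow> dist y x < d \<Longrightarrow> dist (g y) (g x) < e"
    using \<open>e > 0\<close> unfolding uniformly_continuous_on_def by metis
  define d' where "d' = min (d / 2) 1"
  show ?thesis
  proof (rule that[of d'])
    show "d' > 0" using d by (simp add: d'_def)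
    fix x y assume *: "\<bar>x - y\<bar> \<le> d'"
    define k where "k = - \<lfloor>x\<rfloor>"
    have x: "x + of_int k \<in> {0..1}" unfolding k_def by simp linarith
    have "\<bar>x - y\<bar> \<le> 1" "\<bar>x - y\<bar> < d" using * d by (auto simp: d'_def)
    then have "dist (g (x + of_int k)) (g (y + of_int k)) < e"
      using x by (intro d(2)) (auto simp: dist_real_def)
    then show "\<bar>g x - g y\<bar> < e" by (simp add: per1_add_int[OF assms(1)] dist_real_def)
  qed
qed

definition cdist :: "real \<Rightarrow> real \<Rightarrow> real"
  where "cdist x y = dist (abs_circle x) (abs_circle y)"

lemma cdist_le: "cdist x y \<le> \<bar>x - y + of_int k\<bar>"
  unfolding cdist_def by (rule dist_abs_circle_le)

lemma cdist_le_abs: "cdist x y \<le> \<bar>x - y\<bar>"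
  using cdist_le[of x y 0] by simp

lemma cdist_attained: obtains k where "cdist x y = \<bar>x - y + of_int k\<bar>"
  using dist_abs_circle_attained unfolding cdist_def by blast

lemma cdist_triangle: "cdist x z \<le> cdist x y + cdist y z"
  by (simp add: cdist_def dist_triangle)

lemma cdist_nonneg [simp]: "0 \<le> cdist x y"
  by (simp add: cdist_def)

lemma cdist_less_iff: "cdist x y < r \<longleftrightarrow> (\<exists>k::int. \<bar>x - y + of_int k\<bar> < r)"
  by (metis cdist_attained cdist_le le_less_trans)

lemma per1_cdist: "per1 (\<lambda>x. cdist x y)" "per1 (cdist x)"
  by (auto simp: per1_def cdist_def abs_circle_eq_iff intro!: arg_cong2[of _ _ _ _ dist])

lemma continuous_on_abs_circle: "continuous_on UNIV abs_circle"
  unfolding continuous_on_iff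
  by (metis cdist_def cdist_le_abs dist_real_def le_less_trans)

lemma continuous_on_cdist [continuous_intros]:
  assumes "continuous_on A f" "continuous_on A g"
  shows "continuous_on A (\<lambda>x. cdist (f x) (g x))"
  unfolding cdist_def
  using continuous_on_compose2[OF continuous_on_abs_circle assms(1)]
    continuous_on_compose2[OF continuous_on_abs_circle assms(2)]
  by (intro continuous_on_dist) auto

lemma mean_value_between:
  fixes f f' :: "real \<Rightarrow> real"
  assumes "\<And>x. (f has_real_derivative f' x) (at x)"
  obtains \<xi> where "\<bar>\<xi> - x\<bar> \<le> \<bar>y - x\<bar>" "f y - f x = (y - x) * f' \<xi>"
proof (cases x y rule: linorder_cases)
  case less
  then obtain z where "z > x" "z < y" "f y - f x = (y - x) * f' z"
    using MVT2[OF less, of f f'] assms by blast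
  then show ?thesis using that[of z] by auto
next
  case greater
  then obtain z where "z > y" "z < x" "f x - f y = (x - y) * f' z"
    using MVT2[OF greater, of f f'] assms by blast
  then show ?thesis using that[of z] by (auto simp: algebra_simps)
qed (use that[of x] in auto)

text \<open>\<open>H i\<close> lifts the inverse map and is normalized so that \<open>HG\<close>
  holds exactly, not up to an integer. Hence \<open>G' i\<close> has no zero and its logarithm is
  continuous. The integer in \<open>G_shift\<close> is the degree of the map; its sign is left open,
  so orientation may be reversed.\<close>

locale lifted_ifs =
  fixes N :: nat and p :: "nat \<Rightarrow> real" and G G' H H' :: "nat \<Rightarrow> real \<Rightarrow> real"
  assumes p: "nondegenerate_prob_vector N p"
    and G_deriv: "\<And>i x. i < N \<Longrightarrow> (G i has_real_derivative G' i x) (at x)"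
    and G'_cont: "\<And>i. i < N \<Longrightarrow> continuous_on UNIV (G' i)"
    and G_shift: "\<And>i. i < N \<Longrightarrow> \<exists>k::int. \<forall>x. G i (x + 1) = G i x + of_int k"
    and H_deriv: "\<And>i x. i < N \<Longrightarrow> (H i has_real_derivative H' i x) (at x)"
    and H'_cont: "\<And>i. i < N \<Longrightarrow> continuous_on UNIV (H' i)"
    and H_shift: "\<And>i. i < N \<Longrightarrow> \<exists>k::int. \<forall>x. H i (x + 1) = H i x + of_int k"
    and HG: "\<And>i x. i < N \<Longrightarrow> H i (G i x) = x"
begin

lemma p_pos: "i < N \<Longrightarrow> 0 < p i" and p_sum: "(\<Sum>i<N. p i) = 1"
  using p by (auto simp: nondegenerate_prob_vector_def)

lemma N_pos: "0 < N"
  using p_sum by (cases N) auto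

lemma p_le_1: "i < N \<Longrightarrow> p i \<le> 1"
  using member_le_sum[of i "{..<N}" p] p_pos p_sum by (auto intro: less_imp_le)

lemma shift_Ints:
  fixes g :: "real \<Rightarrow> real"
  assumes "\<exists>k::int. \<forall>x. g (x + 1) = g x + of_int k"
  shows "g (x + of_int j) - g x \<in> \<int>"
proof -
  obtain k :: int where k: "\<And>x. g (x + 1) = g x + of_int k" using assms by blast
  have "per1 (\<lambda>x. g x - of_int k * x)"
    by (auto simp: per1_def k algebra_simps)
  from per1_add_int[OF this, of x j]
  have "g (x + of_int j) - g x = of_int (k * j)" by (simp add: algebra_simps)
  then show ?thesis by (metis Ints_of_int)
qed

lemma shift_deriv_per1:
  fixes g g' :: "real \<Rightarrow> real"
  assumes "\<And>x. (g has_real_derivative g' x) (at x)"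
    and "\<exists>k::int. \<forall>x. g (x + 1) = g x + of_int k"
  shows "per1 g'"
  unfolding per1_def
proof
  fix x
  obtain k :: int where k: "\<And>x. g (x + 1) = g x + of_int k" using assms(2) by blast
  have "((\<lambda>x. g (x + 1)) has_real_derivative g' (x + 1)) (at x)"
    using assms(1)[of "x + 1"] by (subst (asm) DERIV_shift) (simp add: add.commute)
  moreover have "((\<lambda>x. g (x + 1)) has_real_derivative g' x) (at x)"
    unfolding k using assms(1)[of x] by (auto intro!: derivative_eq_intros)
  ultimately show "g' (x + 1) = g' x" by (rule DERIV_unique)
qed

lemma G_int: "i < N \<Longrightarrow> x - y \<in> \<int> \<Longrightarrow> G i x - G i y \<in> \<int>"
  using shift_Ints[OF G_shift, of i y] by (elim Ints_cases) (metis add_diff_cancel_left' diff_add_cancel add.commute)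

lemma G_cont: "i < N \<Longrightarrow> continuous_on UNIV (G i)"
  using G_deriv by (meson DERIV_continuous_on has_field_derivative_at_within)

lemma G'_per1: "i < N \<Longrightarrow> per1 (G' i)" and H'_per1: "i < N \<Longrightarrow> per1 (H' i)"
  using shift_deriv_per1[of "G i" "G' i"] shift_deriv_per1[of "H i" "H' i"]
    G_deriv H_deriv G_shift H_shift by blast+

lemma H'_G: "i < N \<Longrightarrow> H' i (G i x) * G' i x = 1"
proof -
  assume i: "i < N"
  have "((\<lambda>x. H i (G i x)) has_real_derivative H' i (G i x) * G' i x) (at x)"
    using DERIV_chain2[OF H_deriv[OF i] G_deriv[OF i]] .
  moreover have "((\<lambda>x. H i (G i x)) has_real_derivative 1) (at x)"
    by (simp add: HG[OF i])
  ultimately show ?thesis by (rule DERIV_unique)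
qed

lemma G'_nz: "i < N \<Longrightarrow> G' i x \<noteq> 0"
  by (metis H'_G mult_zero_right zero_neq_one)

text \<open>The orientation of the map; as \<open>G' i\<close> has no zero, it is the sign of the
  derivative at every point (\<open>sgn_G'\<close>). It reflects the position parameter
  \<open>s\<close> of a window.\<close>

definition \<sigma> :: "nat \<Rightarrow> real" where "\<sigma> i = sgn (G' i 0)"

lemma sgn_G': "i < N \<Longrightarrow> sgn (G' i x) = \<sigma> i"
proof (rule ccontr)
  assume i: "i < N" and ne: "sgn (G' i x) \<noteq> \<sigma> i"
  have c: "connected (range (G' i))"
    by (intro connected_continuous_image G'_cont i connected_UNIV)
  have "(G' i x < 0 \<and> 0 < G' i 0) \<or> (G' i 0 < 0 \<and> 0 < G' i x)"
    using ne G'_nz[OF i, of x] G'_nz[OF i, of 0] by (auto simp: \<sigma>_def sgn_if split: if_splits)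
  then have "0 \<in> range (G' i)"
    using connectedD_interval[OF c, of "G' i x" "G' i 0" 0]
      connectedD_interval[OF c, of "G' i 0" "G' i x" 0] by auto
  then show False using G'_nz[OF i] by (metis imageE)
qed

lemma \<sigma>_cases: "i < N \<Longrightarrow> \<sigma> i = 1 \<or> \<sigma> i = -1"
  using G'_nz[of i 0] by (auto simp: \<sigma>_def sgn_if)

definition la :: "nat \<Rightarrow> real \<Rightarrow> real" where "la i x = ln \<bar>G' i x\<bar>"

lemma exp_la: "i < N \<Longrightarrow> exp (la i x) = \<bar>G' i x\<bar>"
  using G'_nz by (simp add: la_def)

lemma la_per1: "i < N \<Longrightarrow> per1 (la i)"
  using G'_per1 by (auto simp: per1_def la_def)

lemma la_cont: "i < N \<Longrightarrow> continuous_on UNIV (la i)"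
  unfolding la_def using G'_cont G'_nz by (intro continuous_intros) auto

lemma la_bounded: "\<exists>B>0. \<forall>i<N. \<forall>x. \<bar>la i x\<bar> \<le> B"
proof -
  have "\<forall>i. \<exists>M. i < N \<longrightarrow> M > 0 \<and> (\<forall>x. \<bar>la i x\<bar> \<le> M)"
    using per1_continuous_bounded[OF la_per1 la_cont] by metis
  then obtain M where M: "\<And>i. i < N \<Longrightarrow> M i > 0 \<and> (\<forall>x. \<bar>la i x\<bar> \<le> M i)" by metis
  show ?thesis
  proof (intro exI[of _ "\<Sum>i<N. M i"] conjI allI impI)
    show "0 < (\<Sum>i<N. M i)" using M N_pos by (intro sum_pos) auto
    fix i x assume i: "i < N"
    have "M i \<le> (\<Sum>i<N. M i)" using i M by (intro member_le_sum) (auto intro: less_imp_le)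
    then show "\<bar>la i x\<bar> \<le> (\<Sum>i<N. M i)" using M[OF i] by (meson order_trans)
  qed
qed

definition LB :: real where "LB = (SOME B. B > 0 \<and> (\<forall>i<N. \<forall>x. \<bar>la i x\<bar> \<le> B))"

lemma LB_pos: "LB > 0" and LB: "i < N \<Longrightarrow> \<bar>la i x\<bar> \<le> LB"
  using someI_ex[OF la_bounded] by (auto simp: LB_def)

lemma G'_bounds: "i < N \<Longrightarrow> \<bar>G' i x\<bar> \<le> exp LB" "i < N \<Longrightarrow> exp (- LB) \<le> \<bar>G' i x\<bar>"
  using LB[of i x] exp_la[of i x] by (auto simp flip: exp_la)

lemma cdist_G_le:
  assumes "i < N" "\<And>\<xi>. \<bar>\<xi> - x\<bar> \<le> cdist x y \<Longrightarrow> \<bar>G' i \<xi>\<bar> \<le> c"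
  shows "cdist (G i x) (G i y) \<le> c * cdist x y"
proof -
  obtain k where k: "cdist x y = \<bar>x - y + of_int k\<bar>" by (rule cdist_attained)
  define y' where "y' = y - of_int k"
  obtain \<xi> where \<xi>: "\<bar>\<xi> - x\<bar> \<le> \<bar>y' - x\<bar>" "G i y' - G i x = (y' - x) * G' i \<xi>"
    using mean_value_between[of "G i" "G' i" x y'] G_deriv[OF assms(1)] by blast
  have c: "\<bar>y' - x\<bar> = cdist x y" unfolding k y'_def by linarith
  have "G i y' - G i y \<in> \<int>" by (rule G_int[OF assms(1)]) (simp add: y'_def)
  then obtain j where j: "G i y' - G i y = of_int j" by (auto elim: Ints_cases)
  have "cdist (G i x) (G i y) \<le> \<bar>G i x - G i y + of_int (- j)\<bar>" by (rule cdist_le)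
  also have "\<dots> = \<bar>G i y' - G i x\<bar>" using j by simp
  also have "\<dots> = \<bar>G' i \<xi>\<bar> * cdist x y" using c by (simp add: \<xi> abs_mult)
  also have "\<dots> \<le> c * cdist x y"
    using \<xi> c assms(2) by (intro mult_right_mono) auto
  finally show ?thesis .
qed

lemma cdist_G_Lipschitz: "i < N \<Longrightarrow> cdist (G i x) (G i y) \<le> exp LB * cdist x y"
  by (rule cdist_G_le) (auto intro: G'_bounds)

lemma uniform_modulus:
  fixes f :: "nat \<Rightarrow> real \<Rightarrow> real"
  assumes "\<And>i. i < N \<Longrightarrow> per1 (f i)" "\<And>i. i < N \<Longrightarrow> continuous_on UNIV (f i)" "e > 0"
  shows "\<exists>d>0. \<forall>i x y. i < N \<longrightarrow> \<bar>x - y\<bar> \<le> d \<longrightarrow> \<bar>f i x - f i y\<bar> < e"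
proof -
  have "\<exists>d>0. \<forall>x y. \<bar>x - y\<bar> \<le> d \<longrightarrow> \<bar>f i x - f i y\<bar> < e" if "i < N" for i
    by (rule per1_uniformly_continuous[OF assms(1,2)[OF that] assms(3)]) blast
  then obtain D where D: "\<And>i. i < N \<Longrightarrow> D i > 0 \<and> (\<forall>x y. \<bar>x - y\<bar> \<le> D i \<longrightarrow> \<bar>f i x - f i y\<bar> < e)" by metis
  show ?thesis
  proof (intro exI[of _ "Min (D ` {..<N})"] conjI allI impI)
    show "0 < Min (D ` {..<N})" using D N_pos by (subst Min_gr_iff) auto
    fix i x y assume "i < N" "\<bar>x - y\<bar> \<le> Min (D ` {..<N})"
    moreover have "Min (D ` {..<N}) \<le> D i" using \<open>i < N\<close> by (intro Min_le) auto
    ultimately show "\<bar>f i x - f i y\<bar> < e" using D[of i] by (meson order_trans)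
  qed
qed

text \<open>By uniform continuity of the log-derivative, its value at one point bounds it near that
  point up to \<open>eps\<close>, with a radius common to all points and all maps.\<close>

lemma cdist_G_local:
  assumes "eps > 0"
  obtains \<delta> where "\<delta> > 0"
    "\<And>i x y. i < N \<Longrightarrow> cdist x y \<le> \<delta> \<Longrightarrow> cdist (G i x) (G i y) \<le> exp (la i x + eps) * cdist x y"
proof -
  obtain d where d: "d > 0" "\<And>i x y. i < N \<Longrightarrow> \<bar>x - y\<bar> \<le> d \<Longrightarrow> \<bar>la i x - la i y\<bar> < eps"
    using uniform_modulus[of la eps] la_per1 la_cont assms by blast
  show ?thesis
  proof (rule that[OF d(1)])
    fix i x y assume i: "i < N" and c: "cdist x y \<le> d"
    show "cdist (G i x) (G i y) \<le> exp (la i x + eps) * cdist x y"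
    proof (rule cdist_G_le[OF i])
      fix \<xi> assume "\<bar>\<xi> - x\<bar> \<le> cdist x y"
      then have "\<bar>la i \<xi> - la i x\<bar> < eps" using c by (intro d(2) i) simp
      then have "exp (la i \<xi>) \<le> exp (la i x + eps)" by simp
      then show "\<bar>G' i \<xi>\<bar> \<le> exp (la i x + eps)" by (simp add: exp_la i)
    qed
  qed
qed

text \<open>The window of radius q about x + q * s is the interval from x + q * (s - 1) to x + q *
  (s + 1), whose ends lie on opposite sides of x, or at x, since |s| <= 1. Stretching about x by any
  slope up to exp LB therefore stays inside the window of radius q * exp LB with the same
  \<open>s\<close>. This crude inclusion holds at all scales.\<close>

lemma window_G_lower:
  assumes i: "i < N" and r: "0 < r" and s: "\<bar>s\<bar> \<le> 1"
    and z: "cdist z (x + r * exp (- LB) * (\<sigma> i * s)) < r * exp (- LB)"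
  shows "cdist (G i z) (G i x + r * s) < r"
proof -
  define q where "q = r * exp (- LB)"
  have qr: "q * exp LB = r" by (simp add: q_def flip: exp_add)
  have q: "q > 0" using r by (simp add: q_def)
  obtain k :: int where k: "\<bar>z - (x + q * (\<sigma> i * s)) + of_int k\<bar> < q"
    using z unfolding cdist_less_iff q_def by blast
  define u where "u = z + of_int k - x"
  obtain \<xi> where \<xi>: "G i (z + of_int k) - G i x = u * G' i \<xi>"
    using mean_value_between[of "G i" "G' i" x "z + of_int k"] G_deriv[OF i] unfolding u_def by metis
  have g: "G' i \<xi> = \<sigma> i * \<bar>G' i \<xi>\<bar>" using sgn_G'[OF i, of \<xi>] by (metis sgn_mult_abs)
  define g where "g = \<bar>G' i \<xi>\<bar>"
  have g0: "0 < g" "g \<le> exp LB" using G'_nz[OF i] G'_bounds[OF i] by (auto simp: g_def)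
  define v where "v = \<sigma> i * u"
  have v: "q * (s - 1) < v" "v < q * (s + 1)"
    using \<sigma>_cases[OF i] k by (auto simp: v_def u_def algebra_simps)
  have "r * (s - 1) = exp LB * (q * (s - 1))" by (simp flip: qr)
  also have "\<dots> \<le> g * (q * (s - 1))"
    using s q g0 by (intro mult_right_mono_neg) (auto simp: mult_le_0_iff)
  also have "\<dots> < g * v" using v g0 by simp
  finally have 1: "r * (s - 1) < g * v" .
  have "g * v < g * (q * (s + 1))" using v g0 by simp
  also have "\<dots> \<le> exp LB * (q * (s + 1))"
    using s q g0 by (intro mult_right_mono) auto
  also have "\<dots> = r * (s + 1)" by (simp flip: qr)
  finally have 2: "g * v < r * (s + 1)" .
  have "G i (z + of_int k) - G i x = g * v"
    using \<xi> arg_cong[OF g, of "\<lambda>t. u * t"] unfolding g_def v_def by (simp only: mult_ac)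
  then have *: "\<bar>G i (z + of_int k) - (G i x + r * s)\<bar> < r" using 1 2 by (auto simp: algebra_simps)
  have "G i (z + of_int k) - G i z \<in> \<int>" by (rule G_int[OF i]) simp
  then obtain j where "G i (z + of_int k) - G i z = of_int j" by (auto elim: Ints_cases)
  then have "G i z - (G i x + r * s) + of_int j = G i (z + of_int k) - (G i x + r * s)" by simp
  then show ?thesis unfolding cdist_less_iff using * by metis
qed

text \<open>The sharp counterpart of \<open>window_G_lower\<close> for preimages: at small scales
  the inverse is nearly affine with slope of size \<open>exp (- la i x)\<close>, so the preimage of
  a window fits into one whose radius is scaled by that slope, up to exp(eps), with the same
  \<open>s\<close> up to orientation.\<close>

lemma window_G_upper:
  assumes "eps > 0"
  obtains r0 where "r0 > 0"
    "\<And>i r s x z. i < N \<Longrightarrow> 0 < r \<Longrightarrow> r \<le> r0 \<Longrightarrow> \<bar>s\<bar> \<le> 1 \<Longrightarrow> cdist (G i z) (G i x + r * s) < r \<Longrightarrow>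
      cdist z (x + r * exp (eps - la i x) * (\<sigma> i * s)) < r * exp (eps - la i x)"
proof -
  \<comment> \<open>Every slope a of an inverse is at least exp(-LB), so e <= a and e <= a * (exp
    eps - 1). A slope c within e of a then satisfies 0 < c <= a * exp eps.\<close>
  define e where "e = exp (- LB) * min 1 (exp eps - 1)"
  have e: "e > 0" using assms by (simp add: e_def)
  obtain d where d: "d > 0" "\<And>i x y. i < N \<Longrightarrow> \<bar>x - y\<bar> \<le> d \<Longrightarrow> \<bar>H' i x - H' i y\<bar> < e"
    using uniform_modulus[of H' e] H'_per1 H'_cont e by blast
  show ?thesis
  proof (rule that[of "d / 2"])
    show "d / 2 > 0" using d by simp
    fix i r s x z
    assume i: "i < N" and r: "0 < r" "r \<le> d / 2" and s: "\<bar>s\<bar> \<le> 1" and z: "cdist (G i z) (G i x + r * s) < r"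
    obtain k :: int where k: "\<bar>G i z - (G i x + r * s) + of_int k\<bar> < r" using z unfolding cdist_less_iff by blast
    define w where "w = G i z + of_int k"
    have rs: "\<bar>r * s\<bar> \<le> r" using r s by (simp add: abs_mult)
    have w: "r * (s - 1) < w - G i x" "w - G i x < r * (s + 1)" "\<bar>w - G i x\<bar> \<le> d"
      using k rs r by (auto simp: w_def algebra_simps)
    obtain \<xi> where \<xi>: "\<bar>\<xi> - G i x\<bar> \<le> \<bar>w - G i x\<bar>" "H i w - H i (G i x) = (w - G i x) * H' i \<xi>"
      using mean_value_between[of "H i" "H' i" "G i x" w] H_deriv[OF i] by metis
    have dH: "\<bar>H' i \<xi> - H' i (G i x)\<bar> < e" using \<xi> w by (intro d(2) i) simp
    define a where "a = exp (- la i x)"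
    have a0: "a > 0" "a \<ge> exp (- LB)" using LB[OF i, of x] by (auto simp: a_def)
    have Ha: "H' i (G i x) = \<sigma> i * a"
    proof -
      have "G' i x = \<sigma> i * exp (la i x)" using sgn_G'[OF i, of x] exp_la[OF i] by (metis sgn_mult_abs)
      then have "H' i (G i x) * \<sigma> i * exp (la i x) = 1" using H'_G[OF i, of x] by simp
      then have "H' i (G i x) * \<sigma> i = a" by (simp add: a_def exp_minus field_simps)
      then show ?thesis using \<sigma>_cases[OF i] by auto
    qed
    define c where "c = \<sigma> i * H' i \<xi>"
    have ca: "\<bar>c - a\<bar> < e" using dH Ha \<sigma>_cases[OF i] by (auto simp: c_def)
    have ea: "e \<le> a" "e \<le> a * (exp eps - 1)"
      using a0 assms unfolding e_def
      by (auto intro!: mult_mono order_trans[OF mult_mono[of "exp (- LB)" a "min 1 (exp eps - 1)" 1]])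
    have c: "0 < c" "c \<le> a * exp eps" using ca ea by (auto simp: algebra_simps)
    define r' where "r' = r * exp (eps - la i x)"
    have r': "r' = r * (a * exp eps)" by (simp add: r'_def a_def exp_diff exp_minus divide_simps)
    have cr: "r * c \<le> r'" unfolding r' using c r by (intro mult_left_mono) auto
    define u where "u = H i w - x"
    have u: "\<sigma> i * u = c * (w - G i x)" using \<xi> HG[OF i] by (simp add: u_def c_def)
    have "r' * (s - 1) \<le> c * (r * (s - 1))"
      using mult_right_mono_neg[OF cr, of "s - 1"] s by (simp add: mult_ac)
    also have "\<dots> < c * (w - G i x)" using w c by simp
    finally have 1: "r' * (s - 1) < \<sigma> i * u" by (simp add: u)
    have "c * (w - G i x) < c * (r * (s + 1))" using w c by simp
    also have "\<dots> \<le> r' * (s + 1)"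
      using mult_right_mono[OF cr, of "s + 1"] s by (simp add: mult_ac)
    finally have 2: "\<sigma> i * u < r' * (s + 1)" by (simp add: u)
    have *: "\<bar>u - r' * (\<sigma> i * s)\<bar> < r'" using 1 2 \<sigma>_cases[OF i] by (auto simp: algebra_simps)
    have "H i w - z \<in> \<int>"
      using shift_Ints[OF H_shift[OF i], of "G i z" k] HG[OF i, of z] by (simp add: w_def)
    then obtain j where "H i w - z = of_int j" by (auto elim: Ints_cases)
    then have "z - (x + r' * (\<sigma> i * s)) + of_int j = u - r' * (\<sigma> i * s)" by (simp add: u_def)
    then show "cdist z (x + r * exp (eps - la i x) * (\<sigma> i * s)) < r * exp (eps - la i x)"
      unfolding cdist_less_iff using * by (metis r'_def)
  qed
qed

section \<open>The Markov operator and the expected logarithm of the derivative\<close>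

definition Pop :: "(real \<Rightarrow> real) \<Rightarrow> real \<Rightarrow> real"
  where "Pop g x = (\<Sum>i<N. p i * g (G i x))"

definition psi :: "real \<Rightarrow> real"
  where "psi x = (\<Sum>i<N. p i * la i x)"

text \<open>By the chain rule, the expected logarithm of the absolute derivative at x of the
  composition of n random maps.\<close>

definition S :: "nat \<Rightarrow> real \<Rightarrow> real"
  where "S n x = (\<Sum>k<n. (Pop ^^ k) psi x)"

lemma per1_Pop:
  assumes "per1 g"
  shows "per1 (Pop g)"
proof -
  have "g (G i (x + 1)) = g (G i x)" if "i < N" for i x
    by (rule per1_cong_Ints[OF assms], rule G_int[OF that]) simp
  then show ?thesis by (simp add: per1_def Pop_def)
qed

lemma cont_Pop:
  assumes "continuous_on UNIV g"
  shows "continuous_on UNIV (Pop g)"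
proof -
  have "continuous_on UNIV (\<lambda>x. g (G i x))" if "i < N" for i
    by (rule continuous_on_compose2[OF assms G_cont[OF that]]) simp
  then show ?thesis unfolding Pop_def by (intro continuous_on_sum continuous_on_mult_left) auto
qed

lemma per1_Pop_pow: "per1 g \<Longrightarrow> per1 ((Pop ^^ k) g)"
  and cont_Pop_pow: "continuous_on UNIV g \<Longrightarrow> continuous_on UNIV ((Pop ^^ k) g)"
  by (induction k) (auto intro: per1_Pop cont_Pop)

lemma psum_abs: "\<bar>\<Sum>i<N. p i * f i\<bar> \<le> (\<Sum>i<N. p i * \<bar>f i\<bar>)"
proof -
  have "\<bar>\<Sum>i<N. p i * f i\<bar> \<le> (\<Sum>i<N. \<bar>p i * f i\<bar>)" by (rule sum_abs)
  also have "\<dots> = (\<Sum>i<N. p i * \<bar>f i\<bar>)" by (intro sum.cong refl) (simp add: abs_mult abs_of_pos p_pos)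
  finally show ?thesis .
qed

lemma psum_add_const: "(\<Sum>i<N. p i * (f i + c)) = (\<Sum>i<N. p i * f i) + c"
  by (simp add: distrib_left sum.distrib p_sum flip: sum_distrib_right)

lemma psum_mono: "(\<And>i. i < N \<Longrightarrow> f i \<le> g i) \<Longrightarrow> (\<Sum>i<N. p i * f i) \<le> (\<Sum>i<N. p i * g i)"
  using p_pos by (intro sum_mono mult_left_mono) (auto intro: less_imp_le)

lemma psum_abs_le:
  assumes "\<And>i. i < N \<Longrightarrow> \<bar>f i\<bar> \<le> M"
  shows "\<bar>\<Sum>i<N. p i * f i\<bar> \<le> M"
  using psum_abs[of f] psum_mono[of "\<lambda>i. \<bar>f i\<bar>" "\<lambda>_. M", OF assms]
  by (simp add: p_sum flip: sum_distrib_right)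

lemma Pop_abs_le: "(\<And>x. \<bar>g x\<bar> \<le> M) \<Longrightarrow> \<bar>Pop g x\<bar> \<le> M"
  unfolding Pop_def by (rule psum_abs_le)

lemma Pop_pow_abs_le: "(\<And>x. \<bar>g x\<bar> \<le> M) \<Longrightarrow> \<bar>(Pop ^^ k) g x\<bar> \<le> M"
  by (induction k arbitrary: x) (auto intro: Pop_abs_le)

lemma per1_psi: "per1 psi"
  using la_per1 by (simp add: psi_def per1_def)

lemma cont_psi: "continuous_on UNIV psi"
  unfolding psi_def using la_cont by (intro continuous_intros) auto

lemma psi_abs_le: "\<bar>psi x\<bar> \<le> LB"
  unfolding psi_def using LB by (rule psum_abs_le)

lemma S_abs_le: "\<bar>S n x\<bar> \<le> real n * LB"
proof -
  have "\<bar>S n x\<bar> \<le> (\<Sum>k<n. \<bar>(Pop ^^ k) psi x\<bar>)" unfolding S_def by (rule sum_abs)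
  also have "\<dots> \<le> (\<Sum>k<n. LB)" by (intro sum_mono Pop_pow_abs_le psi_abs_le)
  finally show ?thesis by simp
qed

lemma per1_S: "per1 (S n)"
  using per1_Pop_pow[OF per1_psi] by (simp add: S_def per1_def)

lemma cont_S: "continuous_on UNIV (S n)"
  unfolding S_def by (intro continuous_intros cont_Pop_pow cont_psi)

lemma S_Suc: "S (Suc k) x = psi x + Pop (S k) x"
proof -
  have "S (Suc k) x = psi x + (\<Sum>j<k. Pop ((Pop ^^ j) psi) x)"
    unfolding S_def by (subst sum.lessThan_Suc_shift) simp
  also have "(\<Sum>j<k. Pop ((Pop ^^ j) psi) x) = Pop (S k) x"
    unfolding S_def Pop_def[of _ x] by (simp add: sum_distrib_left) (rule sum.swap)
  finally show ?thesis .
qed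

end

section \<open>Masses of windows\<close>

lemma borel_measurable_cdist [measurable]:
  assumes "f \<in> borel_measurable M" "g \<in> borel_measurable M"
  shows "(\<lambda>x. cdist (f x) (g x)) \<in> borel_measurable M"
  using assms by (rule borel_measurable_continuous_Pair) (intro continuous_intros)

text \<open>\<open>unif01\<close> plays the role of Lebesgue measure on the circle, for the centres
  of windows; \<open>unifpm1\<close> below is the law of the relative position \<open>s\<close> of a
  window that contains a given point.\<close>

definition unif01 :: "real measure"
  where "unif01 = density lborel (\<lambda>x. ennreal (indicator {0..1} x))"

definition unifpm1 :: "real measure"
  where "unifpm1 = density lborel (\<lambda>x. ennreal (indicator {-1..1} x / 2))"

lemma sets_unif01 [measurable_cong, simp]: "sets unif01 = sets borel"
  and space_unif01 [simp]: "space unif01 = UNIV"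
  and sets_unifpm1 [measurable_cong, simp]: "sets unifpm1 = sets borel"
  and space_unifpm1 [simp]: "space unifpm1 = UNIV"
  by (auto simp: unif01_def unifpm1_def)

lemma prob_space_unif01: "prob_space unif01"
proof
  have "emeasure unif01 UNIV = (\<integral>\<^sup>+ x. indicator {0..1::real} x \<partial>lborel)"
    by (simp add: unif01_def emeasure_density ennreal_indicator)
  then show "emeasure unif01 (space unif01) = 1" by simp
qed

lemma prob_space_unifpm1: "prob_space unifpm1"
proof
  have "emeasure unifpm1 UNIV = (\<integral>\<^sup>+ x. ennreal (1/2) * indicator {-1..1::real} x \<partial>lborel)"
    by (simp add: unifpm1_def emeasure_density)
      (auto intro!: nn_integral_cong simp: indicator_def)
  also have "\<dots> = ennreal (1/2) * ennreal 2"
    by (subst nn_integral_cmult) auto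
  also have "\<dots> = 1"
    by (subst ennreal_mult[symmetric]) auto
  finally show "emeasure unifpm1 (space unifpm1) = 1" by simp
qed

lemma AE_unifpm1: "AE s in unifpm1. \<bar>s\<bar> \<le> 1"
  unfolding unifpm1_def by (subst AE_density) (auto simp: indicator_def)

lemma integral_unif01:
  fixes f :: "real \<Rightarrow> real"
  assumes "f \<in> borel_measurable borel"
  shows "(\<integral>y. f y \<partial>unif01) = (\<integral>y. indicator {0..1} y * f y \<partial>lborel)"
  using assms unfolding unif01_def by (subst integral_density) auto

lemma integral_unifpm1:
  fixes f :: "real \<Rightarrow> real"
  assumes "f \<in> borel_measurable borel"
  shows "(\<integral>y. f y \<partial>unifpm1) = (\<integral>y. indicator {-1..1} y / 2 * f y \<partial>lborel)"
  using assms unfolding unifpm1_def by (subst integral_density) auto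

text \<open>The symmetry that absorbs the sign \<open>\<sigma> i\<close> of orientation-reversing
  maps.\<close>

lemma integral_unifpm1_reflect:
  fixes f :: "real \<Rightarrow> real"
  assumes [measurable]: "f \<in> borel_measurable borel" and "c = 1 \<or> c = -1"
  shows "(\<integral>s. f (c * s) \<partial>unifpm1) = (\<integral>s. f s \<partial>unifpm1)"
  using assms(2)
proof
  assume c: "c = -1"
  have "(\<integral>s. f s \<partial>unifpm1) = (\<integral>s. indicator {-1..1} s / 2 * f s \<partial>lborel)"
    by (rule integral_unifpm1) simp
  also have "\<dots> = (\<integral>s. indicator {-1..1} (0 + (-1) * s) / 2 * f (0 + (-1) * s) \<partial>lborel)"
    by (subst lborel_integral_real_affine[where c="-1" and t=0]) auto
  also have "\<dots> = (\<integral>s. indicator {-1..1} s / 2 * f (- s) \<partial>lborel)"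
    by (intro Bochner_Integration.integral_cong refl) (auto simp: indicator_def)
  also have "\<dots> = (\<integral>s. f (- s) \<partial>unifpm1)"
    by (rule integral_unifpm1[symmetric]) simp
  finally show ?thesis by (simp add: c)
qed simp

lemma integrable_indicator_bounded:
  fixes k :: "real \<Rightarrow> real"
  assumes [measurable]: "k \<in> borel_measurable borel" and "\<And>y. \<bar>k y\<bar> \<le> M"
  shows "integrable lborel (\<lambda>y. indicator {a..<b} y * k y)"
proof (rule Bochner_Integration.integrable_bound)
  show "integrable lborel (\<lambda>y. M * indicator {a..<b} y)" by (cases "a \<le> b") auto
  show "AE y in lborel. norm (indicator {a..<b} y * k y) \<le> norm (M * indicator {a..<b} y)"
  proof (rule AE_I2)
    fix y
    have "\<bar>k y\<bar> \<le> \<bar>M\<bar>" using assms(2)[of y] by linarith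
    then show "norm (indicator {a..<b} y * k y) \<le> norm (M * indicator {a..<b} y)"
      by (simp add: indicator_def abs_mult)
  qed
qed simp

text \<open>The interval is cut at the integer \<open>c\<close> in it; moving the left piece by 1
  gives the unit interval from \<open>c\<close> to \<open>c + 1\<close>, and an integer shift leads
  to [0,1).\<close>

lemma integral_periodic_shift:
  fixes k :: "real \<Rightarrow> real"
  assumes [measurable]: "k \<in> borel_measurable borel" and M: "\<And>y. \<bar>k y\<bar> \<le> M" and per: "per1 k"
  shows "(\<integral>y. k y \<partial>unif01) = (\<integral>y. indicator {a..<a+1} y * k y \<partial>lborel)"
proof -
  define I where "I u v = (\<integral>y. indicator {u..<v} y * k y \<partial>lborel)" for u v :: real
  have split: "I u w = I u v + I v w" if "u \<le> v" "v \<le> w" for u v w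
  proof -
    have "I u w = (\<integral>y. indicator {u..<v} y * k y + indicator {v..<w} y * k y \<partial>lborel)"
      unfolding I_def using that by (intro Bochner_Integration.integral_cong refl) (auto simp: indicator_def)
    also have "\<dots> = I u v + I v w"
      unfolding I_def by (intro Bochner_Integration.integral_add integrable_indicator_bounded[OF assms(1) M])
    finally show ?thesis .
  qed
  have shift: "I (u + of_int j) (v + of_int j) = I u v" for u v and j :: int
  proof -
    have "I (u + of_int j) (v + of_int j) =
      (\<integral>y. indicator {u + of_int j..<v + of_int j} (of_int j + 1 * y) * k (of_int j + 1 * y) \<partial>lborel)"
      unfolding I_def by (subst lborel_integral_real_affine[where c=1 and t="of_int j"]) auto
    also have "\<dots> = I u v"
      unfolding I_def using per1_add_int[OF per, of _ j]
      by (intro Bochner_Integration.integral_cong refl) (auto simp: indicator_def add.commute)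
    finally show ?thesis .
  qed
  define c where "c = \<lceil>a\<rceil>"
  have c: "a \<le> of_int c" "of_int c \<le> a + 1" unfolding c_def by linarith+
  have "I a (a + 1) = I a (of_int c) + I (of_int c) (a + 1)" using c by (rule split)
  also have "I a (of_int c) = I (a + 1) (of_int c + 1)" using shift[of a 1 "of_int c"] by simp
  also have "I (a + 1) (of_int c + 1) + I (of_int c) (a + 1) = I (of_int c) (of_int c + 1)"
    using split[of "of_int c" "a + 1" "of_int c + 1"] c by simp
  also have "\<dots> = I 0 1" using shift[of 0 c 1] by (simp add: add.commute)
  also have "I 0 1 = (\<integral>y. k y \<partial>unif01)"
    unfolding I_def integral_unif01[OF assms(1)]
  proof (rule integral_cong_AE)
    have "AE y in lborel. y \<noteq> (1::real)" by (rule AE_lborel_singleton)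
    then show "AE y in lborel. indicator {0..<1} y * k y = indicator {0..1} y * k y"
      by eventually_elim (auto simp: indicator_def)
  qed auto
  finally show ?thesis by (simp add: I_def)
qed

text \<open>As r <= 1/2, the arc about x does not overlap itself: in the period centred at x it is
  an interval, and y = x + r * s is an affine substitution. The factor 2 * r contains the 2 that
  offsets the density 1/2 of \<open>unifpm1\<close>. Strict and weak inequalities differ at single
  points only.\<close>

lemma integral_window:
  fixes h :: "real \<Rightarrow> real"
  assumes [measurable]: "h \<in> borel_measurable borel" and M: "\<And>y. \<bar>h y\<bar> \<le> M" and per: "per1 h"
    and r: "0 < r" "r \<le> 1/2"
  shows "(\<integral>y. (if cdist x y < r then h y else 0) \<partial>unif01) = 2 * r * (\<integral>s. h (x + r * s) \<partial>unifpm1)"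
proof -
  define k where "k y = (if cdist x y < r then h y else 0)" for y
  have [measurable]: "k \<in> borel_measurable borel" unfolding k_def by measurable
  have Mk: "\<bar>k y\<bar> \<le> M" for y using M[of y] order_trans[OF abs_ge_zero M[of y]] by (simp add: k_def)
  have perk: "per1 k" using per per1_cdist(2)[of x] by (simp add: per1_def k_def)
  have "(\<integral>y. k y \<partial>unif01) = (\<integral>y. indicator {x - 1/2..<x - 1/2 + 1} y * k y \<partial>lborel)"
    by (rule integral_periodic_shift) (auto intro: Mk perk)
  also have "\<dots> = (\<integral>y. indicator {-1..1} ((y - x) / r) * h y \<partial>lborel)"
  proof (rule integral_cong_AE)
    have "AE y in lborel. y \<noteq> x - r" "AE y in lborel. y \<noteq> x + r"
      "AE y in lborel. y \<noteq> x + 1/2" by (rule AE_lborel_singleton)+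
    then show "AE y in lborel. indicator {x - 1/2..<x - 1/2 + 1} y * k y = indicator {-1..1} ((y - x) / r) * h y"
    proof eventually_elim
      case (elim y)
      have eq: "cdist x y < r \<longleftrightarrow> \<bar>x - y\<bar> < r" if "\<bar>x - y\<bar> \<le> 1/2"
      proof
        assume "cdist x y < r"
        then obtain j :: int where j: "\<bar>x - y + of_int j\<bar> < r" unfolding cdist_less_iff by blast
        have "\<bar>of_int j :: real\<bar> < 1" using j that r by linarith
        then have "j = 0" by linarith
        then show "\<bar>x - y\<bar> < r" using j by simp
      qed (use cdist_le_abs[of x y] in linarith)
      have in1: "(y - x) / r \<in> {-1..1} \<longleftrightarrow> \<bar>x - y\<bar> < r"
        using elim r by (auto simp: field_simps)
      show ?case
      proof (cases "\<bar>x - y\<bar> \<le> 1/2")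
        case True
        then have "x - 1/2 \<le> y" "y \<le> x + 1/2" by linarith+
        then have "y \<in> {x - 1/2..<x - 1/2 + 1}" using elim(3) by simp
        then show ?thesis using eq[OF True] in1 by (simp add: k_def indicator_def)
      next
        case False
        have "y \<notin> {x - 1/2..<x - 1/2 + 1}"
        proof
          assume "y \<in> {x - 1/2..<x - 1/2 + 1}"
          then have "x - 1/2 \<le> y" "y < x - 1/2 + 1" by (simp_all only: atLeastLessThan_iff)
          then show False using False by linarith
        qed
        moreover have "\<not> \<bar>x - y\<bar> < r" using False r by linarith
        ultimately show ?thesis using in1 by (auto simp: indicator_def)
      qed
    qed
  qed auto
  also have "\<dots> = \<bar>r\<bar> * (\<integral>s. indicator {-1..1} ((x + r * s - x) / r) * h (x + r * s) \<partial>lborel)"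
    using r by (subst lborel_integral_real_affine[where c=r and t=x]) auto
  also have "\<dots> = 2 * r * (\<integral>s. indicator {-1..1} s / 2 * h (x + r * s) \<partial>lborel)"
    using r by simp
  also have "\<dots> = 2 * r * (\<integral>s. h (x + r * s) \<partial>unifpm1)"
    by (subst integral_unifpm1) auto
  finally show ?thesis by (simp add: k_def)
qed

abbreviation win :: "(real \<Rightarrow> real) \<Rightarrow> real \<Rightarrow> real \<Rightarrow> real"
  where "win h r x \<equiv> (\<integral>s. h (x + r * s) \<partial>unifpm1)"

lemma (in finite_measure) integrable_real_bounded:
  fixes f :: "'a \<Rightarrow> real"
  assumes "f \<in> borel_measurable M" "\<And>x. \<bar>f x\<bar> \<le> B"
  shows "integrable M f"
  using assms by (intro integrable_const_bound[of _ B]) auto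

lemma (in prob_space) integral_real_bounded:
  fixes f :: "'a \<Rightarrow> real"
  assumes "f \<in> borel_measurable M" "\<And>x. \<bar>f x\<bar> \<le> B"
  shows "\<bar>\<integral>x. f x \<partial>M\<bar> \<le> B"
proof -
  have "\<bar>\<integral>x. f x \<partial>M\<bar> \<le> (\<integral>x. \<bar>f x\<bar> \<partial>M)" by (rule integral_abs_bound)
  also have "\<dots> \<le> (\<integral>x. B \<partial>M)"
    using assms order_trans[OF abs_ge_zero assms(2)]
    by (intro integral_mono integrable_real_bounded[of _ B]) auto
  finally show ?thesis by (simp add: prob_space)
qed

text \<open>The mass that the image under \<open>T\<close> of the measure with density
  \<open>w\<close> gives to the open arc of radius \<open>r\<close> about \<open>y\<close>.\<close>

definition winmass :: "real measure \<Rightarrow> (real \<Rightarrow> real) \<Rightarrow> (real \<Rightarrow> real) \<Rightarrow> real \<Rightarrow> real \<Rightarrow> real"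
  where "winmass \<nu> T w r y = (\<integral>x. (if cdist (T x) y < r then w x else 0) \<partial>\<nu>)"

context real_distribution
begin

lemma borel_measurable_winmass [measurable]:
  assumes [measurable]: "T \<in> borel_measurable borel" "w \<in> borel_measurable borel"
  shows "winmass M T w r \<in> borel_measurable borel"
  unfolding winmass_def by measurable

lemma integrable_bounded_borel:
  fixes f :: "real \<Rightarrow> real"
  assumes "f \<in> borel_measurable borel" "\<And>x. \<bar>f x\<bar> \<le> B"
  shows "integrable M f"
  using assms by (intro integrable_real_bounded[of _ B]) auto

lemma winmass_bounds:
  assumes [measurable]: "T \<in> borel_measurable borel" "w \<in> borel_measurable borel"
    and "\<And>x. 0 \<le> w x" "\<And>x. w x \<le> B"
  shows "0 \<le> winmass M T w r y" "winmass M T w r y \<le> B"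
proof -
  show "0 \<le> winmass M T w r y" unfolding winmass_def using assms by (intro integral_nonneg_AE) auto
  have B: "0 \<le> B" using assms(3,4)[of 0] by linarith
  have "winmass M T w r y \<le> (\<integral>x. B \<partial>M)"
    unfolding winmass_def using assms B
    by (intro integral_mono integrable_bounded_borel[of _ B]) (auto simp: abs_le_iff)
  then show "winmass M T w r y \<le> B" using prob_space by simp
qed

lemma per1_winmass: "per1 (winmass M T w r)"
  using per1_cdist(2) by (auto simp: per1_def winmass_def)

text \<open>Exchanges centres and points: y lies within r of T x iff, modulo 1, y = T x + r * s with
  |s| < 1. Thus \<open>\<nu>\<close>-means of window averages become Lebesgue integrals of mass
  times h; with h a logarithm of a mass these are entropies.\<close>

lemma winmass_Fubini:
  assumes [measurable]: "T \<in> borel_measurable borel" "w \<in> borel_measurable borel" "h \<in> borel_measurable borel"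
    and w: "\<And>x. \<bar>w x\<bar> \<le> B" and h: "\<And>y. \<bar>h y\<bar> \<le> C" and per: "per1 h" and r: "0 < r" "r \<le> 1/2"
  shows "(\<integral>y. winmass M T w r y * h y \<partial>unif01) = 2 * r * (\<integral>x. w x * win h r (T x) \<partial>M)"
proof -
  interpret U: prob_space unif01 by (rule prob_space_unif01)
  interpret P: pair_prob_space M unif01 ..
  define f where "f x y = (if cdist (T x) y < r then w x * h y else 0)" for x y
  have B: "0 \<le> B" "0 \<le> C" using w[of 0] h[of 0] by linarith+
  have [measurable]: "(\<lambda>(x, y). f x y) \<in> borel_measurable (M \<Otimes>\<^sub>M unif01)"
    unfolding f_def by measurable
  have int: "integrable (M \<Otimes>\<^sub>M unif01) (\<lambda>(x, y). f x y)"
    using w h B by (intro P.integrable_real_bounded[of _ "B * C"])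
      (auto simp: f_def abs_mult intro!: mult_mono)
  have "(\<integral>y. winmass M T w r y * h y \<partial>unif01) = (\<integral>y. (\<integral>x. f x y \<partial>M) \<partial>unif01)"
    unfolding winmass_def f_def
    by (intro Bochner_Integration.integral_cong refl)
      (auto simp flip: integral_mult_left_zero intro!: Bochner_Integration.integral_cong)
  also have "\<dots> = (\<integral>x. (\<integral>y. f x y \<partial>unif01) \<partial>M)"
    by (rule P.Fubini_integral[OF int])
  also have "\<dots> = (\<integral>x. w x * (2 * r * win h r (T x)) \<partial>M)"
  proof (intro Bochner_Integration.integral_cong refl)
    fix x
    have "(\<integral>y. f x y \<partial>unif01) = (\<integral>y. w x * (if cdist (T x) y < r then h y else 0) \<partial>unif01)"
      unfolding f_def by (intro Bochner_Integration.integral_cong refl) auto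
    also have "\<dots> = w x * (2 * r * win h r (T x))"
      using integral_window[OF assms(3) h per r, of "T x"] by simp
    finally show "(\<integral>y. f x y \<partial>unif01) = w x * (2 * r * win h r (T x))" .
  qed
  also have "\<dots> = 2 * r * (\<integral>x. w x * win h r (T x) \<partial>M)"
    by (subst integral_mult_right_zero[symmetric]) (simp add: mult_ac)
  finally show ?thesis .
qed

lemma winmass_total:
  assumes [measurable]: "T \<in> borel_measurable borel" "w \<in> borel_measurable borel"
    and w: "\<And>x. \<bar>w x\<bar> \<le> B" and r: "0 < r" "r \<le> 1/2"
  shows "(\<integral>y. winmass M T w r y \<partial>unif01) = 2 * r * (\<integral>x. w x \<partial>M)"
proof -
  interpret W: prob_space unifpm1 by (rule prob_space_unifpm1)
  show ?thesis
    using winmass_Fubini[of T w "\<lambda>_. 1" B 1] w r W.prob_space by (simp add: per1_def)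
qed

end

section \<open>Entropy of stationary measures\<close>

text \<open>The shift \<open>ka\<close> keeps the logarithm bounded, so that windows of mass zero do no harm; all estimates are
  uniform in \<open>ka \<le> r\<close>.\<close>

definition lk :: "real \<Rightarrow> real \<Rightarrow> real"
  where "lk ka v = ln ((v + ka) / (1 + ka))"

lemma lk_mono: "0 < ka \<Longrightarrow> 0 \<le> v \<Longrightarrow> v \<le> v' \<Longrightarrow> lk ka v \<le> lk ka v'"
  by (auto simp: lk_def divide_right_mono)

text \<open>The denominator \<open>1 + ka\<close> of \<open>lk\<close> is there for this sign; it
  cancels in differences (\<open>lk_diff\<close>).\<close>

lemma lk_nonpos: "0 < ka \<Longrightarrow> 0 \<le> v \<Longrightarrow> v \<le> 1 \<Longrightarrow> lk ka v \<le> 0"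
  by (auto simp: lk_def)

lemma lk_diff: "0 < ka \<Longrightarrow> 0 \<le> v \<Longrightarrow> 0 \<le> w \<Longrightarrow> lk ka v - lk ka w = ln ((v + ka) / (w + ka))"
  by (simp add: lk_def ln_div)

lemma lk_abs: "0 < ka \<Longrightarrow> 0 \<le> v \<Longrightarrow> v \<le> 1 \<Longrightarrow> \<bar>lk ka v\<bar> \<le> - lk ka 0"
  using lk_mono[of ka 0 v] lk_nonpos[of ka v] by simp

lemma lk_mult:
  assumes "0 < ka" "0 < c" "c \<le> 1" "0 \<le> v"
  shows "lk ka v + ln c \<le> lk ka (c * v)"
proof -
  have "lk ka v + ln c = ln (c * (v + ka) / (1 + ka))"
    using assms by (simp add: lk_def ln_div ln_mult)
  also have "\<dots> \<le> lk ka (c * v)" unfolding lk_def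
  proof (subst ln_le_cancel_iff)
    have "c * ka \<le> ka" using assms by simp
    then show "c * (v + ka) / (1 + ka) \<le> (c * v + ka) / (1 + ka)"
      using assms by (intro divide_right_mono) (auto simp: distrib_left)
  qed (use assms in \<open>auto intro!: divide_pos_pos mult_pos_pos add_nonneg_pos\<close>)
  finally show ?thesis .
qed

lemma borel_measurable_lk [measurable]:
  assumes [measurable]: "f \<in> borel_measurable M"
  shows "(\<lambda>x. lk ka (f x)) \<in> borel_measurable M"
  unfolding lk_def by measurable

text \<open>A Kullback-Leibler divergence dominates the squared Hellinger distance: ln t <= t - 1 at
  t = sqrt(B/A) gives A * ln(A/B) >= A - B + (sqrt A - sqrt B)^2, and the linear terms cancel in the
  mean because \<open>b\<close> is the mean of the \<open>a i\<close>.\<close>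

lemma log_sum_gap:
  fixes a p :: "nat \<Rightarrow> real"
  assumes p: "\<And>i. i < N \<Longrightarrow> 0 \<le> p i" "(\<Sum>i<N. p i) = 1" and a: "\<And>i. i < N \<Longrightarrow> 0 \<le> a i"
    and ka: "0 < ka" and j: "j < N" and b: "b = (\<Sum>i<N. p i * a i)"
  shows "p j * (sqrt (a j + ka) - sqrt (b + ka))\<^sup>2 \<le> (\<Sum>i<N. p i * (a i * (lk ka (a i) - lk ka b)))"
proof -
  have b0: "0 \<le> b" using p a unfolding b by (intro sum_nonneg mult_nonneg_nonneg) auto
  define B where "B = b + ka"
  have B: "B > 0" using b0 ka by (simp add: B_def)
  have sB: "(sqrt B)\<^sup>2 = B" "sqrt B > 0" using B by auto
  have gap: "(a i - b) * (1 - ka / B) + (sqrt (a i + ka) - sqrt B)\<^sup>2 \<le> a i * (lk ka (a i) - lk ka b)" if i: "i < N" for i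
  proof -
    define A where "A = a i + ka"
    have A: "A > 0" using a[OF i] ka by (simp add: A_def)
    have sA: "(sqrt A)\<^sup>2 = A" "sqrt A > 0" using A by auto
    have l: "lk ka (a i) - lk ka b = ln (A / B)"
      using a[OF i] b0 ka by (simp add: lk_diff A_def B_def)
    have "- ln (A / B) = 2 * ln (sqrt B / sqrt A)"
      using A B by (simp add: ln_div ln_sqrt)
    also have "\<dots> \<le> 2 * (sqrt B / sqrt A - 1)"
      using sA sB ln_le_minus_one[of "sqrt B / sqrt A"] by simp
    finally have "A * (2 * (1 - sqrt B / sqrt A)) \<le> A * ln (A / B)"
      using A by (intro mult_left_mono) auto
    moreover have "A * (2 * (1 - sqrt B / sqrt A)) = 2 * A - 2 * sqrt A * sqrt B"
      using sA by (simp add: field_simps power2_eq_square)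
    moreover have "(sqrt A - sqrt B)\<^sup>2 = A + B - 2 * sqrt A * sqrt B"
      using A B by (simp add: power2_diff)
    ultimately have 1: "(A - B) + (sqrt A - sqrt B)\<^sup>2 \<le> A * ln (A / B)" by linarith
    \<comment> \<open>The logarithm is weighted by \<open>a i\<close>, not by A = a i + ka. The
      surplus \<open>ka * ln (A / B)\<close> is at most (A - B) times the constant ka / B, so it
      also disappears in the mean.\<close>
    have "ln (A / B) \<le> A / B - 1" using A B by (intro ln_le_minus_one) simp
    then have "ka * ln (A / B) \<le> ka * (A / B - 1)" using ka by simp
    also have "\<dots> = (A - B) * (ka / B)" using B by (simp add: field_simps)
    finally have 2: "ka * ln (A / B) \<le> (A - B) * (ka / B)" .
    have "a i * ln (A / B) = A * ln (A / B) - ka * ln (A / B)" by (simp add: A_def algebra_simps)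
    then have "(A - B) * (1 - ka / B) + (sqrt A - sqrt B)\<^sup>2 \<le> a i * ln (A / B)"
      using 1 2 by (simp add: algebra_simps)
    moreover have e: "a i - b = A - B" by (simp add: A_def B_def)
    ultimately show ?thesis unfolding l e unfolding A_def[symmetric] by blast
  qed
  have "p j * (sqrt (a j + ka) - sqrt B)\<^sup>2 \<le> (\<Sum>i<N. p i * (sqrt (a i + ka) - sqrt B)\<^sup>2)"
    using j p by (intro member_le_sum) auto
  also have "\<dots> = (\<Sum>i<N. p i * ((a i - b) * (1 - ka / B) + (sqrt (a i + ka) - sqrt B)\<^sup>2))"
  proof -
    have "(\<Sum>i<N. p i * ((a i - b) * c)) = c * ((\<Sum>i<N. p i * a i) - b * (\<Sum>i<N. p i))" for c
      by (simp add: sum_distrib_left sum_subtractf algebra_simps)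
    then have "(\<Sum>i<N. p i * ((a i - b) * (1 - ka / B))) = 0" by (simp add: p b)
    then show ?thesis by (simp only: distrib_left sum.distrib)
  qed
  also have "\<dots> \<le> (\<Sum>i<N. p i * (a i * (lk ka (a i) - lk ka b)))"
    using p gap by (intro sum_mono mult_left_mono) auto
  finally show ?thesis by (simp add: B_def)
qed

text \<open>A shift by \<open>m\<close> is made of \<open>m\<close> unit shifts, each of which
  telescopes over k to a difference of end values; monotonicity moves these to \<open>K\<close> and
  to \<open>m\<close>.\<close>

lemma antimono_shift_sum:
  fixes c :: "int \<Rightarrow> real"
  assumes c: "\<And>a b. a \<le> b \<Longrightarrow> c b \<le> c a"
  shows "(\<Sum>k<K. c (int k + int m) - c (int k)) \<le> real m * c (int K) - real m * c (int m)"
proof (induction m)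
  case (Suc m)
  have "(\<Sum>k<K. c (int k + int (Suc m)) - c (int k)) =
      (\<Sum>k<K. c (int (Suc k) + int m) - c (int k + int m)) + (\<Sum>k<K. c (int k + int m) - c (int k))"
    by (simp add: sum.distrib[symmetric] add_ac)
  also have "(\<Sum>k<K. c (int (Suc k) + int m) - c (int k + int m)) = c (int K + int m) - c (int m)"
    by (subst sum_lessThan_telescope[of "\<lambda>k. c (int k + int m)"]) simp
  also have "\<dots> \<le> c (int K) - c (int (Suc m))"
    using c[of "int K" "int K + int m"] c[of "int m" "int (Suc m)"] by simp
  finally have "(\<Sum>k<K. c (int k + int (Suc m)) - c (int k)) \<le>
      c (int K) - c (int (Suc m)) + (real m * c (int K) - real m * c (int m))" using Suc by linarith
  moreover have "real m * c (int (Suc m)) \<le> real m * c (int m)"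
    using c[of "int m" "int (Suc m)"] by (intro mult_left_mono) auto
  ultimately show ?case by (simp add: algebra_simps)
qed simp

text \<open>The same for shifts to smaller indices. Indices below 0 occur, hence integer arguments;
  the terms at the lower end are dropped by their sign.\<close>

lemma antimono_shift_sum_neg:
  fixes c :: "int \<Rightarrow> real"
  assumes c: "\<And>a b. a \<le> b \<Longrightarrow> c b \<le> c a" and c0: "\<And>a. c a \<le> 0"
  shows "(\<Sum>k<K. c (int k - int m) - c (int k)) \<le> - real m * c (int K)"
proof (induction m)
  case (Suc m)
  have "(\<Sum>k<K. c (int k - int (Suc m)) - c (int k)) =
      (\<Sum>k<K. c (int k - int m) - c (int k)) - (\<Sum>k<K. c (int (Suc k) - int (Suc m)) - c (int k - int (Suc m)))"
    by (simp add: sum_subtractf[symmetric] algebra_simps)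
  also have "(\<Sum>k<K. c (int (Suc k) - int (Suc m)) - c (int k - int (Suc m))) = c (int K - int (Suc m)) - c (- int (Suc m))"
    by (subst sum_lessThan_telescope[of "\<lambda>k. c (int k - int (Suc m))"]) simp
  also have "(\<Sum>k<K. c (int k - int m) - c (int k)) - \<dots> \<le> - real m * c (int K) - c (int K)"
    using c[of "int K - int (Suc m)" "int K"] c0[of "- int (Suc m)"] Suc by linarith
  finally show ?case by (simp add: algebra_simps)
qed simp

text \<open>A discrete form of the bound of \<open>\<integral>\<^bsub>T\<^esub>\<^bsup>\<tau>\<^esup> (f (t + \<beta>) - f t) dt\<close>, which only sees \<open>f\<close> near the end points.\<close>

lemma antimono_telescope:
  fixes f :: "real \<Rightarrow> real"
  assumes f: "\<And>s t. s \<le> t \<Longrightarrow> f t \<le> f s" and f0: "\<And>t. f t \<le> 0"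
    and \<delta>: "\<delta> > 0" and \<beta>: "\<bar>\<beta>\<bar> \<le> B"
  shows "\<delta> * (\<Sum>k<K. f (T + real k * \<delta> + \<beta>) - f (T + real k * \<delta>)) \<le>
    (\<beta> - \<delta>) * f (T + real K * \<delta>) - B * f (T + B)"
proof -
  \<comment> \<open>Rounding \<beta> down to a multiple of \<delta> only increases f(t + \<beta>).
    The price is the \<delta> in the coefficient \<open>\<beta> - \<delta>\<close>, where
    \<open>f\<close> is nonpositive.\<close>
  define m where "m = \<lfloor>\<beta> / \<delta>\<rfloor>"
  have m: "of_int m * \<delta> \<le> \<beta>" "\<beta> - \<delta> \<le> of_int m * \<delta>"
  proof -
    have "of_int m \<le> \<beta> / \<delta>" "\<beta> / \<delta> - 1 \<le> of_int m" unfolding m_def by linarith+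
    then show "of_int m * \<delta> \<le> \<beta>" "\<beta> - \<delta> \<le> of_int m * \<delta>" using \<delta> by (simp_all add: field_simps)
  qed
  define c where "c k = f (T + of_int k * \<delta>)" for k :: int
  have c: "c b \<le> c a" if "a \<le> b" for a b unfolding c_def using that \<delta> by (intro f) simp
  have c0: "c a \<le> 0" for a unfolding c_def by (rule f0)
  have B: "0 \<le> B" using \<beta> by linarith
  have "(\<Sum>k<K. f (T + real k * \<delta> + \<beta>) - f (T + real k * \<delta>)) \<le> (\<Sum>k<K. c (int k + m) - c (int k))"
  proof (rule sum_mono)
    fix k
    have "f (T + real k * \<delta> + \<beta>) \<le> c (int k + m)" unfolding c_def using m by (intro f) (simp add: algebra_simps)
    then show "f (T + real k * \<delta> + \<beta>) - f (T + real k * \<delta>) \<le> c (int k + m) - c (int k)" by (simp add: c_def)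
  qed
  then have 1: "\<delta> * (\<Sum>k<K. f (T + real k * \<delta> + \<beta>) - f (T + real k * \<delta>)) \<le> \<delta> * (\<Sum>k<K. c (int k + m) - c (int k))"
    using \<delta> by simp
  have 2: "(of_int m * \<delta>) * c (int K) \<le> (\<beta> - \<delta>) * c (int K)"
    using m c0 by (intro mult_right_mono_neg) auto
  have 3: "0 \<le> - B * f (T + B)" using B f0[of "T + B"] by (simp add: mult_nonneg_nonpos)
  have "\<delta> * (\<Sum>k<K. c (int k + m) - c (int k)) \<le> (of_int m * \<delta>) * c (int K) - B * f (T + B)"
  proof (cases "m \<ge> 0")
    case True
    have "(\<Sum>k<K. c (int k + m) - c (int k)) \<le> of_int m * c (int K) - of_int m * c m"
      using antimono_shift_sum[where c=c and K=K and m="nat m"] c True by simp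
    then have "\<delta> * (\<Sum>k<K. c (int k + m) - c (int k)) \<le> \<delta> * (of_int m * c (int K) - of_int m * c m)"
      using \<delta> by simp
    moreover have "- (of_int m * \<delta>) * c m \<le> B * (- f (T + B))"
    proof -
      have mB: "of_int m * \<delta> \<le> B" using m \<beta> by linarith
      have "f (T + B) \<le> c m" unfolding c_def using mB by (intro f) simp
      then have "(of_int m * \<delta>) * (- c m) \<le> B * (- f (T + B))"
        using mB True \<delta> B c0[of m] by (intro mult_mono) auto
      then show ?thesis by simp
    qed
    ultimately show ?thesis by (simp add: algebra_simps)
  next
    case False
    have "(\<Sum>k<K. c (int k + m) - c (int k)) \<le> of_int m * c (int K)"
      using antimono_shift_sum_neg[where c=c and K=K and m="nat (- m)"] c c0 False by simp
    then have "\<delta> * (\<Sum>k<K. c (int k + m) - c (int k)) \<le> \<delta> * (of_int m * c (int K))"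
      using \<delta> by simp
    then show ?thesis using 3 by (simp add: algebra_simps)
  qed
  then show ?thesis using 1 2 by (simp add: c_def)
qed

text \<open>\<open>\<nu>\<close> is a law on the line, but stationarity is tested on periodic
  functions only: it is a property of the projection of \<open>\<nu>\<close> to the circle.\<close>

locale stationary_ifs = lifted_ifs N p G G' H H' + real_distribution \<nu>
  for N p G G' H H' \<nu> +
  assumes stationary: "\<And>g. continuous_on UNIV g \<Longrightarrow> per1 g \<Longrightarrow> (\<integral>x. Pop g x \<partial>\<nu>) = (\<integral>x. g x \<partial>\<nu>)"
begin

interpretation W: prob_space unifpm1 by (rule prob_space_unifpm1)
interpretation U: prob_space unif01 by (rule prob_space_unif01)

lemma measure_UNIV [simp]: "measure unifpm1 UNIV = 1" "measure unif01 UNIV = 1" "measure \<nu> UNIV = 1"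
  using W.prob_space U.prob_space prob_space by simp_all

lemma G_measurable [measurable]: "i < N \<Longrightarrow> G i \<in> borel_measurable borel"
  using G_cont by (intro borel_measurable_continuous_onI)

lemma Pop_measurable [measurable]:
  assumes [measurable]: "g \<in> borel_measurable borel"
  shows "Pop g \<in> borel_measurable borel"
  unfolding Pop_def by measurable

lemma integral_Pop:
  assumes [measurable]: "g \<in> borel_measurable borel" and "\<And>x. \<bar>g x\<bar> \<le> M"
  shows "(\<integral>x. Pop g x \<partial>\<nu>) = (\<Sum>i<N. p i * (\<integral>x. g (G i x) \<partial>\<nu>))"
  unfolding Pop_def using assms
  by (subst Bochner_Integration.integral_sum) (auto intro!: integrable_mult_right integrable_bounded_borel[of _ M])

text \<open>Stationarity is given for continuous functions. The cut-offs \<open>g k\<close> tend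
  pointwise to \<open>u\<close> on the open arc and to 0 off it, and dominated convergence carries
  the identity over.\<close>

lemma stationary_winmass:
  fixes u :: "real \<Rightarrow> real"
  assumes u: "continuous_on UNIV u" "per1 u"
  shows "(\<Sum>i<N. p i * winmass \<nu> (G i) (\<lambda>x. u (G i x)) r y) = winmass \<nu> (\<lambda>x. x) u r y"
proof -
  have [measurable]: "u \<in> borel_measurable borel" using u by (intro borel_measurable_continuous_onI)
  obtain M where M: "\<And>x. \<bar>u x\<bar> \<le> M" using per1_continuous_bounded[OF u(2,1)] by blast
  define g where "g k x = min 1 (real k * max 0 (r - cdist x y)) * u x" for k x
  have gc: "continuous_on UNIV (g k)" for k
    unfolding g_def using u by (intro continuous_intros) auto
  have gp: "per1 (g k)" for k
    using u(2) per1_cdist(1)[of y] by (simp add: g_def per1_def)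
  have gb: "\<bar>g k x\<bar> \<le> M" for k x
  proof -
    have "\<bar>min 1 (real k * max 0 (r - cdist x y))\<bar> \<le> 1" by (auto simp: min_def max_def)
    then have "\<bar>g k x\<bar> \<le> 1 * \<bar>u x\<bar>" unfolding g_def abs_mult by (intro mult_right_mono) auto
    then show ?thesis using M[of x] by simp
  qed
  have lim: "(\<lambda>k. g k x) \<longlonglongrightarrow> (if cdist x y < r then u x else 0)" for x
  proof (cases "cdist x y < r")
    case True
    have "eventually (\<lambda>k. g k x = u x) sequentially"
    proof -
      have "eventually (\<lambda>k. real k \<ge> 1 / (r - cdist x y)) sequentially"
        using filterlim_real_sequentially by (simp add: filterlim_at_top)
      then show ?thesis
      proof eventually_elim
        case (elim k)
        then have "real k * (r - cdist x y) \<ge> 1" using True by (simp add: field_simps)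
        then show ?case using True by (simp add: g_def min_def)
      qed
    qed
    then show ?thesis using True by (simp add: tendsto_eventually)
  qed (auto simp: g_def)
  have limT: "(\<lambda>k. \<integral>x. g k (T x) \<partial>\<nu>) \<longlonglongrightarrow> winmass \<nu> T (\<lambda>x. u (T x)) r y"
    if [measurable]: "T \<in> borel_measurable borel" for T
    unfolding winmass_def
  proof (rule integral_dominated_convergence[where w="\<lambda>_. M"])
    show "(\<lambda>x. g k (T x)) \<in> borel_measurable \<nu>" for k unfolding g_def by measurable
    show "AE x in \<nu>. (\<lambda>k. g k (T x)) \<longlonglongrightarrow> (if cdist (T x) y < r then u (T x) else 0)" using lim by simp
  qed (use gb in auto)
  have "(\<lambda>k. \<Sum>i<N. p i * (\<integral>x. g k (G i x) \<partial>\<nu>)) \<longlonglongrightarrow> (\<Sum>i<N. p i * winmass \<nu> (G i) (\<lambda>x. u (G i x)) r y)"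
    by (intro tendsto_intros limT) simp
  moreover have "(\<lambda>k. \<integral>x. g k x \<partial>\<nu>) \<longlonglongrightarrow> winmass \<nu> (\<lambda>x. x) u r y"
    by (rule limT) simp
  moreover have "(\<Sum>i<N. p i * (\<integral>x. g k (G i x) \<partial>\<nu>)) = (\<integral>x. g k x \<partial>\<nu>)" for k
    using integral_Pop[of "g k" M] gb stationary[OF gc gp, of k] borel_measurable_continuous_onI[OF gc, of k] by simp
  ultimately show ?thesis by (simp add: LIMSEQ_unique)
qed

text \<open>Here \<open>h\<close> is only Borel, as logarithms of window masses are. Both sides are
  moved to the centres y by \<open>winmass_Fubini\<close>, where \<open>stationary_winmass\<close>
  applies for each y.\<close>

lemma stationary_smooth:
  fixes u h :: "real \<Rightarrow> real"
  assumes u: "continuous_on UNIV u" "per1 u"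
    and [measurable]: "h \<in> borel_measurable borel" and h: "\<And>y. \<bar>h y\<bar> \<le> C" "per1 h"
    and r: "0 < r" "r \<le> 1/2"
  shows "(\<integral>x. Pop (\<lambda>x. u x * win h r x) x \<partial>\<nu>) = (\<integral>x. u x * win h r x \<partial>\<nu>)"
proof -
  have [measurable]: "u \<in> borel_measurable borel" using u by (intro borel_measurable_continuous_onI)
  obtain M where M: "\<And>x. \<bar>u x\<bar> \<le> M" using per1_continuous_bounded[OF u(2,1)] by blast
  have int: "integrable unif01 (\<lambda>y. winmass \<nu> T w r y * h y)"
    if [measurable]: "T \<in> borel_measurable borel" "w \<in> borel_measurable borel" and w: "\<And>x. \<bar>w x\<bar> \<le> M" for T w
  proof (rule U.integrable_real_bounded)
    have M0: "0 \<le> M" using w[of 0] by linarith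
    have "\<bar>winmass \<nu> T w r y\<bar> \<le> M" for y unfolding winmass_def
      using w M0 by (intro integral_real_bounded) auto
    then show "\<bar>winmass \<nu> T w r y * h y\<bar> \<le> M * C" for y
      using h(1)[of y] M0 unfolding abs_mult by (intro mult_mono) auto
  qed measurable
  have "\<bar>u x * win h r x\<bar> \<le> M * C" for x
    unfolding abs_mult using M h(1) order_trans[OF abs_ge_zero M[of x]]
    by (intro mult_mono W.integral_real_bounded) auto
  then have "2 * r * (\<integral>x. Pop (\<lambda>x. u x * win h r x) x \<partial>\<nu>) =
    (\<Sum>i<N. p i * (2 * r * (\<integral>x. u (G i x) * win h r (G i x) \<partial>\<nu>)))"
    by (subst integral_Pop) (auto simp: sum_distrib_left mult_ac)
  also have "\<dots> = (\<Sum>i<N. p i * (\<integral>y. winmass \<nu> (G i) (\<lambda>x. u (G i x)) r y * h y \<partial>unif01))"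
    using M h r by (intro sum.cong refl arg_cong2[of _ _ _ _ "(*)"] winmass_Fubini[symmetric]) auto
  also have "\<dots> = (\<integral>y. (\<Sum>i<N. p i * (winmass \<nu> (G i) (\<lambda>x. u (G i x)) r y * h y)) \<partial>unif01)"
    using M int by (subst Bochner_Integration.integral_sum) auto
  also have "\<dots> = (\<integral>y. winmass \<nu> (\<lambda>x. x) u r y * h y \<partial>unif01)"
    by (simp add: sum_distrib_right mult.assoc flip: stationary_winmass[OF u])
  also have "\<dots> = 2 * r * (\<integral>x. u x * win h r x \<partial>\<nu>)"
    using M h r by (intro winmass_Fubini) auto
  finally show ?thesis using r by simp
qed

section \<open>Log-masses of windows and their behaviour under the maps\<close>

definition q :: "real \<Rightarrow> real \<Rightarrow> real" where "q r = winmass \<nu> (\<lambda>x. x) (\<lambda>_. 1) r"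
definition qi :: "nat \<Rightarrow> real \<Rightarrow> real \<Rightarrow> real" where "qi i r = winmass \<nu> (G i) (\<lambda>_. 1) r"

lemma q_measurable [measurable]: "q r \<in> borel_measurable borel"
  and qi_measurable [measurable]: "i < N \<Longrightarrow> qi i r \<in> borel_measurable borel"
  by (auto simp: q_def qi_def)

lemma q_bounds [simp]: "0 \<le> q r y" "q r y \<le> 1"
  unfolding q_def using winmass_bounds[of "\<lambda>x. x" "\<lambda>_. 1" 1] by auto

lemma qi_bounds: "i < N \<Longrightarrow> 0 \<le> qi i r y" "i < N \<Longrightarrow> qi i r y \<le> 1"
  unfolding qi_def using winmass_bounds[of "G i" "\<lambda>_. 1" 1] by auto

lemma per1_q: "per1 (q r)" and per1_qi: "per1 (qi i r)"
  unfolding q_def qi_def by (rule per1_winmass)+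

lemma q_eq: "q r y = (\<Sum>i<N. p i * qi i r y)"
  using stationary_winmass[of "\<lambda>_. 1" r y] by (simp add: q_def qi_def per1_def)

lemma q_ge: "i < N \<Longrightarrow> p i * qi i r y \<le> q r y"
  unfolding q_eq using p_pos qi_bounds(1)
  by (intro member_le_sum mult_nonneg_nonneg) (auto intro: less_imp_le)

lemma q_mono:
  assumes "\<And>z. cdist z y < r \<Longrightarrow> cdist z y' < r'"
  shows "q r y \<le> q r' y'"
  unfolding q_def winmass_def using assms by (intro integral_mono integrable_bounded_borel[of _ 1]) auto

lemma qi_le_q:
  assumes "i < N" "\<And>z. cdist (G i z) y < r \<Longrightarrow> cdist z y' < r'"
  shows "qi i r y \<le> q r' y'"
  unfolding q_def qi_def winmass_def using assms by (intro integral_mono integrable_bounded_borel[of _ 1]) auto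

lemma q_le_qi:
  assumes "i < N" "\<And>z. cdist z y' < r' \<Longrightarrow> cdist (G i z) y < r"
  shows "q r' y' \<le> qi i r y"
  unfolding q_def qi_def winmass_def using assms by (intro integral_mono integrable_bounded_borel[of _ 1]) auto

text \<open>For \<open>s\<close> in \<open>[-1,1]\<close>, the windows of radius \<open>r\<close> about \<open>x + r * s\<close> are those that contain \<open>x\<close>: this makes
  \<open>ph\<close> monotone in \<open>r\<close> and almost equivariant under the maps.\<close>

definition ph :: "real \<Rightarrow> real \<Rightarrow> real \<Rightarrow> real"
  where "ph ka r x = (\<integral>s. lk ka (q r (x + r * s)) \<partial>unifpm1)"

text \<open>Point and measure are moved by the same map: at \<open>G i x\<close> the windows are
  weighed by the image of \<open>\<nu>\<close> under \<open>G i\<close>, whereas \<open>ph\<close>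
  weighs windows at x by \<open>\<nu>\<close>.\<close>

definition phi :: "real \<Rightarrow> real \<Rightarrow> real \<Rightarrow> real"
  where "phi ka r x = (\<Sum>i<N. p i * (\<integral>s. lk ka (qi i r (G i x + r * s)) \<partial>unifpm1))"

abbreviation mph :: "real \<Rightarrow> real \<Rightarrow> real"
  where "mph ka r \<equiv> (\<integral>x. ph ka r x \<partial>\<nu>)"

text \<open>Times 2 * r, this is the Lebesgue integral over the centres of the p-mean divergence of
  the masses \<open>qi\<close> from their mixture \<open>q\<close> (step \<open>ent\<close> of
  \<open>entropy_gap\<close>).\<close>

abbreviation gain :: "real \<Rightarrow> real \<Rightarrow> real"
  where "gain ka r \<equiv> (\<integral>x. phi ka r x - ph ka r x \<partial>\<nu>)"

lemma ph_measurable [measurable]: "ph ka r \<in> borel_measurable borel"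
  and phi_measurable [measurable]: "phi ka r \<in> borel_measurable borel"
  unfolding ph_def phi_def by measurable

lemma ph_abs: "0 < ka \<Longrightarrow> \<bar>ph ka r x\<bar> \<le> - lk ka 0"
  unfolding ph_def by (intro W.integral_real_bounded lk_abs) auto

lemma phi_abs: "0 < ka \<Longrightarrow> \<bar>phi ka r x\<bar> \<le> - lk ka 0"
  unfolding phi_def by (intro psum_abs_le W.integral_real_bounded lk_abs qi_bounds) auto

lemma ph_integrable [simp]: "0 < ka \<Longrightarrow> integrable \<nu> (\<lambda>x. ph ka r x)"
  by (rule integrable_bounded_borel[OF _ ph_abs]) auto

lemma phi_integrable [simp]: "0 < ka \<Longrightarrow> integrable \<nu> (\<lambda>x. phi ka r x)"
  by (rule integrable_bounded_borel[OF _ phi_abs]) auto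

lemma W_mono:
  fixes f g :: "real \<Rightarrow> real"
  assumes "f \<in> borel_measurable borel" "g \<in> borel_measurable borel"
    and "\<And>s. \<bar>f s\<bar> \<le> B" "\<And>s. \<bar>g s\<bar> \<le> B" "\<And>s. \<bar>s\<bar> \<le> 1 \<Longrightarrow> f s \<le> g s"
  shows "(\<integral>s. f s \<partial>unifpm1) \<le> (\<integral>s. g s \<partial>unifpm1)"
  using assms AE_unifpm1 by (intro integral_mono_AE W.integrable_real_bounded[of _ B]) auto

lemma ph_nonpos: "0 < ka \<Longrightarrow> ph ka r x \<le> 0"
proof -
  assume ka: "0 < ka"
  have "ph ka r x \<le> (\<integral>s. 0 \<partial>unifpm1)" unfolding ph_def
    by (rule W_mono[where B="- lk ka 0"]) (use ka in \<open>auto intro!: lk_abs lk_nonpos\<close>)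
  then show ?thesis by simp
qed

text \<open>For fixed \<open>s\<close> with |s| <= 1, the windows from x + r * (s - 1) to x + r * (s
  + 1) are nested in r.\<close>

lemma ph_mono_radius:
  assumes "0 < ka" "0 < r" "r \<le> r'"
  shows "ph ka r x \<le> ph ka r' x"
  unfolding ph_def
proof (rule W_mono[where B="- lk ka 0"])
  fix s :: real assume s: "\<bar>s\<bar> \<le> 1"
  show "lk ka (q r (x + r * s)) \<le> lk ka (q r' (x + r' * s))"
  proof (intro lk_mono assms q_mono q_bounds)
    fix z assume "cdist z (x + r * s) < r"
    then obtain k :: int where k: "\<bar>z - (x + r * s) + of_int k\<bar> < r" unfolding cdist_less_iff by blast
    have "\<bar>(r' - r) * s\<bar> \<le> r' - r" using assms s by (simp add: abs_mult mult_left_le)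
    moreover have "z - (x + r' * s) + of_int k = (z - (x + r * s) + of_int k) - (r' - r) * s"
      by (simp add: algebra_simps)
    ultimately have "\<bar>z - (x + r' * s) + of_int k\<bar> < r'" using k by linarith
    then show "cdist z (x + r' * s) < r'" unfolding cdist_less_iff by blast
  qed
qed (use assms in \<open>auto intro!: lk_abs\<close>)

text \<open>The mass of a window under the image measure is the \<open>\<nu>\<close>-mass of its
  preimage, which \<open>window_G_upper\<close> encloses in a window at x. This is the step that
  ties scales to derivatives.\<close>

lemma phi_le_ph:
  assumes "eps > 0"
  obtains r0 where "r0 > 0" "\<And>ka r x. 0 < ka \<Longrightarrow> 0 < r \<Longrightarrow> r \<le> r0 \<Longrightarrow>
    phi ka r x \<le> (\<Sum>i<N. p i * ph ka (r * exp (eps - la i x)) x)"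
proof -
  obtain r0 where r0: "r0 > 0"
    "\<And>i r s x z. i < N \<Longrightarrow> 0 < r \<Longrightarrow> r \<le> r0 \<Longrightarrow> \<bar>s\<bar> \<le> 1 \<Longrightarrow> cdist (G i z) (G i x + r * s) < r \<Longrightarrow>
      cdist z (x + r * exp (eps - la i x) * (\<sigma> i * s)) < r * exp (eps - la i x)"
    using window_G_upper[OF assms] by metis
  show ?thesis
  proof (rule that[OF r0(1)], unfold phi_def, rule psum_mono)
    fix i and ka r x :: real assume i: "i < N" and ka: "0 < ka" and r: "0 < r" "r \<le> r0"
    define r' where "r' = r * exp (eps - la i x)"
    have "(\<integral>s. lk ka (qi i r (G i x + r * s)) \<partial>unifpm1) \<le> (\<integral>s. lk ka (q r' (x + r' * (\<sigma> i * s))) \<partial>unifpm1)"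
      using i ka r
      by (intro W_mono[where B="- lk ka 0"])
        (auto intro!: lk_abs lk_mono qi_le_q r0 qi_bounds simp: r'_def)
    also have "\<dots> = ph ka r' x" unfolding ph_def
      by (rule integral_unifpm1_reflect[where f="\<lambda>s. lk ka (q r' (x + r' * s))"]) (auto simp: \<sigma>_cases i)
    finally show "(\<integral>s. lk ka (qi i r (G i x + r * s)) \<partial>unifpm1) \<le> ph ka (r * exp (eps - la i x)) x"
      by (simp add: r'_def)
  qed
qed

text \<open>By stationarity \<open>\<nu>\<close> dominates p i times its image under
  \<open>G i\<close>, which costs \<open>ln (p i)\<close>; the window inclusion is the crude one.
  The bound is pointwise and one-sided.\<close>

lemma ph_G_ge:
  assumes i: "i < N" and ka: "0 < ka" and r: "0 < r"
  shows "ph ka (r * exp (- LB)) x + ln (p i) \<le> ph ka r (G i x)"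
proof -
  define r' where "r' = r * exp (- LB)"
  have "ph ka r' x = (\<integral>s. lk ka (q r' (x + r' * (\<sigma> i * s))) \<partial>unifpm1)" unfolding ph_def
    by (rule integral_unifpm1_reflect[where f="\<lambda>s. lk ka (q r' (x + r' * s))", symmetric]) (auto simp: \<sigma>_cases i)
  then have "ph ka r' x + ln (p i) = (\<integral>s. lk ka (q r' (x + r' * (\<sigma> i * s))) + ln (p i) \<partial>unifpm1)"
    using ka by (subst Bochner_Integration.integral_add)
      (auto intro!: W.integrable_real_bounded[of _ "- lk ka 0"] lk_abs simp: W.prob_space)
  also have "\<dots> \<le> ph ka r (G i x)"
    unfolding ph_def
  proof (rule W_mono[where B="- lk ka 0 + \<bar>ln (p i)\<bar>"])
    fix s :: real
    show "\<bar>lk ka (q r' (x + r' * (\<sigma> i * s))) + ln (p i)\<bar> \<le> - lk ka 0 + \<bar>ln (p i)\<bar>"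
      using lk_abs[OF ka q_bounds(1,2)[of r' "x + r' * (\<sigma> i * s)"]] by linarith
    show "\<bar>lk ka (q r (G i x + r * s))\<bar> \<le> - lk ka 0 + \<bar>ln (p i)\<bar>"
      using lk_abs[OF ka q_bounds(1,2)[of r "G i x + r * s"]] by linarith
    assume s: "\<bar>s\<bar> \<le> 1"
    have "q r' (x + r' * (\<sigma> i * s)) \<le> qi i r (G i x + r * s)"
      using window_G_lower[OF i r s] by (intro q_le_qi i) (simp add: r'_def)
    then have "lk ka (q r' (x + r' * (\<sigma> i * s))) \<le> lk ka (qi i r (G i x + r * s))"
      by (intro lk_mono ka) auto
    also have "lk ka (qi i r (G i x + r * s)) + ln (p i) \<le> lk ka (p i * qi i r (G i x + r * s))"
      by (intro lk_mult ka p_pos p_le_1 i qi_bounds)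
    also have "\<dots> \<le> lk ka (q r (G i x + r * s))"
      using p_pos[OF i] qi_bounds(1)[OF i] by (intro lk_mono ka q_ge i mult_nonneg_nonneg) auto
    finally show "lk ka (q r' (x + r' * (\<sigma> i * s))) + ln (p i) \<le> lk ka (q r (G i x + r * s))" by simp
  qed auto
  finally show ?thesis by (simp add: r'_def)
qed

text \<open>Log-masses far beyond ln(1/r) come from windows much lighter than r, and in such a
  window the weight has at most M times the mass. So the excess contributes only M, however
  \<open>g\<close> is placed; the coefficient of ln(1/r) is the integral of
  \<open>g\<close>.\<close>

lemma ph_weighted_bound:
  assumes [measurable]: "g \<in> borel_measurable borel" and g: "\<And>x. 0 \<le> g x" "\<And>x. g x \<le> M"
    and ka: "0 < ka" "ka \<le> 1" and r: "0 < r" "r \<le> 1/2"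
  shows "(\<integral>x. g x * (- ph ka r x) \<partial>\<nu>) \<le> ln (1 / r) * (\<integral>x. g x \<partial>\<nu>) + M"
proof -
  define v where "v = winmass \<nu> (\<lambda>x. x) g r"
  have [measurable]: "v \<in> borel_measurable borel" by (simp add: v_def)
  have v: "0 \<le> v y" "v y \<le> M" "v y \<le> M * q r y" for y
  proof -
    show "0 \<le> v y" "v y \<le> M" unfolding v_def using g winmass_bounds[of "\<lambda>x. x" g M] by auto
    have M: "0 \<le> M" using g[of 0] by linarith
    have "v y \<le> (\<integral>x. M * (if cdist x y < r then 1 else 0) \<partial>\<nu>)"
      unfolding v_def winmass_def using g M
      by (intro integral_mono integrable_bounded_borel[of _ M]) auto
    then show "v y \<le> M * q r y" by (simp add: q_def winmass_def)
  qed
  have gM: "\<bar>g x\<bar> \<le> M" for x using g by (simp add: abs_le_iff order_trans[OF _ g(1)])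
  have "2 * r * (\<integral>x. g x * ph ka r x \<partial>\<nu>) = (\<integral>y. v y * lk ka (q r y) \<partial>unif01)"
    unfolding v_def ph_def using per1_q[of r] ka r gM
    by (intro winmass_Fubini[symmetric, where B=M and C="- lk ka 0"]) (auto intro!: lk_abs simp: per1_def)
  then have "2 * r * (\<integral>x. g x * (- ph ka r x) \<partial>\<nu>) = (\<integral>y. v y * (- lk ka (q r y)) \<partial>unif01)" by simp
  also have "\<dots> \<le> (\<integral>y. ln (1 / r) * v y + 2 * r * M \<partial>unif01)"
  proof (rule integral_mono)
    have "\<bar>v y * - lk ka (q r y)\<bar> \<le> M * (- lk ka 0)" for y
    proof -
      have "0 \<le> M" using g[of 0] by linarith
      then show ?thesis unfolding abs_mult abs_minus_cancel
        using v[of y] lk_abs[OF ka(1) q_bounds(1,2)[of r y]] by (intro mult_mono) auto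
    qed
    then show "integrable unif01 (\<lambda>y. v y * - lk ka (q r y))"
      by (intro U.integrable_real_bounded) auto
    show "integrable unif01 (\<lambda>y. ln (1 / r) * v y + 2 * r * M)"
      using v by (intro Bochner_Integration.integrable_add integrable_mult_right U.integrable_real_bounded[of v M])
        (auto intro!: U.integrable_real_bounded)
    fix y
    have Q: "q r y + ka > 0" using ka by (simp add: add_nonneg_pos)
    have "- lk ka (q r y) = ln ((1 + ka) / (q r y + ka))"
      using Q ka by (simp add: lk_def ln_div)
    also have "\<dots> \<le> ln (2 / (q r y + ka))" using Q ka by (simp add: divide_right_mono)
    \<comment> \<open>Comparison with a mass of order r: the second term is at most 2 * r / (q +
      ka), and v <= M * q turns it into at most 2 * r * M.\<close>
    also have "\<dots> = ln (1 / r) + ln (2 * r / (q r y + ka))" using Q r by (simp add: ln_div ln_mult)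
    also have "ln (2 * r / (q r y + ka)) \<le> 2 * r / (q r y + ka)"
      using Q r ln_le_minus_one[of "2 * r / (q r y + ka)"] by simp
    finally have "v y * (- lk ka (q r y)) \<le> v y * (ln (1 / r) + 2 * r / (q r y + ka))"
      using v by (intro mult_left_mono) auto
    also have "\<dots> = ln (1 / r) * v y + 2 * r * (v y / (q r y + ka))" by (simp add: algebra_simps)
    also have "v y / (q r y + ka) \<le> M"
    proof -
      have "0 \<le> M" using g[of 0] by linarith
      then have "M * q r y \<le> M * (q r y + ka)" using ka by (intro mult_left_mono) auto
      then show ?thesis using v(3)[of y] Q by (simp add: divide_le_eq)
    qed
    finally show "v y * - lk ka (q r y) \<le> ln (1 / r) * v y + 2 * r * M"
      using r by (simp add: mult_left_mono)
  qed
  also have "\<dots> = ln (1 / r) * (2 * r * (\<integral>x. g x \<partial>\<nu>)) + 2 * r * M"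
    using v winmass_total[of "\<lambda>x. x" g M r] gM r
    by (subst Bochner_Integration.integral_add)
      (auto intro!: U.integrable_real_bounded[of _ M] simp: U.prob_space v_def)
  finally have "2 * r * (\<integral>x. g x * (- ph ka r x) \<partial>\<nu>) \<le> 2 * r * (ln (1 / r) * (\<integral>x. g x \<partial>\<nu>) + M)"
    by (simp add: algebra_simps)
  then show ?thesis using r by (simp only: mult_le_cancel_left)
qed

text \<open>The large window is enlarged to radius 2 * r about the centre of the small one, so that
  both masses depend on one centre y. Then q' * ln(Q / q') <= Q integrates to the total mass 4 * r,
  apart from the shift \<open>ka\<close>. Pointwise, such a bound would amount to a doubling
  property of \<open>\<nu>\<close>.\<close>

lemma ph_refine:
  assumes ka: "0 < ka" "ka \<le> r" and r: "0 < r" "r \<le> 1/4" and L: "1 \<le> L"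
  shows "mph ka r - mph ka (r / L) \<le> 5 * L / 2"
proof -
  define r' where "r' = r / L"
  have r': "0 < r'" "r' \<le> r" using r L by (auto simp: r'_def field_simps)
  define h where "h y = lk ka (q (2 * r) y) - lk ka (q r' y)" for y
  have [measurable]: "h \<in> borel_measurable borel" unfolding h_def by measurable
  have hb: "\<bar>h y\<bar> \<le> 2 * (- lk ka 0)" for y
    using lk_abs[OF ka(1) q_bounds(1,2)[of "2 * r" y]] lk_abs[OF ka(1) q_bounds(1,2)[of r' y]]
    unfolding h_def by linarith
  have hp: "per1 h" using per1_q[of "2 * r"] per1_q[of r'] by (simp add: h_def per1_def)
  have pt: "ph ka r x - ph ka r' x \<le> win h r' x" for x
  proof -
    have "ph ka r x \<le> (\<integral>s. lk ka (q (2 * r) (x + r' * s)) \<partial>unifpm1)"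
      unfolding ph_def
    proof (rule W_mono[where B="- lk ka 0"])
      fix s :: real assume s: "\<bar>s\<bar> \<le> 1"
      show "lk ka (q r (x + r * s)) \<le> lk ka (q (2 * r) (x + r' * s))"
      proof (intro lk_mono ka q_mono q_bounds)
        fix z assume z: "cdist z (x + r * s) < r"
        have "cdist (x + r * s) (x + r' * s) \<le> \<bar>(r - r') * s\<bar>"
          using cdist_le_abs[of "x + r * s" "x + r' * s"] by (simp add: algebra_simps)
        also have "\<dots> \<le> r - r'" using r' s by (simp add: abs_mult mult_left_le)
        finally show "cdist z (x + r' * s) < 2 * r"
          using z r' cdist_triangle[of z "x + r' * s" "x + r * s"] by linarith
      qed
    qed (use ka in \<open>auto intro!: lk_abs\<close>)
    moreover have "win h r' x = (\<integral>s. lk ka (q (2 * r) (x + r' * s)) \<partial>unifpm1) - ph ka r' x"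
      unfolding h_def ph_def using ka
      by (intro Bochner_Integration.integral_diff W.integrable_real_bounded[of _ "- lk ka 0"]) (auto intro!: lk_abs)
    ultimately show ?thesis by linarith
  qed
  have ib: "\<bar>win h r' x\<bar> \<le> 2 * (- lk ka 0)" for x
    by (rule W.integral_real_bounded) (use hb in auto)
  have "mph ka r - mph ka r' = (\<integral>x. ph ka r x - ph ka r' x \<partial>\<nu>)"
    using ka by simp
  also have "\<dots> \<le> (\<integral>x. win h r' x \<partial>\<nu>)"
    using ka pt by (intro integral_mono integrable_bounded_borel[OF _ ib]) auto
  finally have "2 * r' * (mph ka r - mph ka r') \<le> 2 * r' * (\<integral>x. win h r' x \<partial>\<nu>)"
    using r' by (intro mult_left_mono) auto
  also have "\<dots> = (\<integral>y. q r' y * h y \<partial>unif01)"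
    using winmass_Fubini[of "\<lambda>x. x" "\<lambda>_. 1" h 1 "2 * (- lk ka 0)" r'] hb hp r' r by (simp add: q_def)
  also have "\<dots> \<le> (\<integral>y. q (2 * r) y + ka \<partial>unif01)"
  proof (rule integral_mono)
    have "\<bar>q r' y * h y\<bar> \<le> 1 * (2 * (- lk ka 0))" for y
      unfolding abs_mult using hb by (intro mult_mono) auto
    then show "integrable unif01 (\<lambda>y. q r' y * h y)"
      by (intro U.integrable_real_bounded) auto
    show "integrable unif01 (\<lambda>y. q (2 * r) y + ka)"
      by (intro Bochner_Integration.integrable_add U.integrable_real_bounded[of _ 1] U.integrable_real_bounded[of _ ka]) (use ka in auto)
    fix y
    define A B where "A = q (2 * r) y + ka" and "B = q r' y + ka"
    have AB: "A > 0" "B > 0" using ka by (auto simp: A_def B_def add_nonneg_pos)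
    have "h y = ln (A / B)" unfolding h_def A_def B_def using ka by (intro lk_diff) auto
    also have "\<dots> \<le> A / B" using AB ln_le_minus_one[of "A / B"] by simp
    finally have "q r' y * h y \<le> q r' y * (A / B)" by (intro mult_left_mono) auto
    also have "\<dots> \<le> B * (A / B)" using AB ka by (intro mult_right_mono) (auto simp: B_def)
    also have "\<dots> = A" using AB by simp
    finally show "q r' y * h y \<le> q (2 * r) y + ka" by (simp add: A_def)
  qed
  also have "\<dots> = 4 * r + ka"
    using winmass_total[of "\<lambda>x. x" "\<lambda>_. 1" 1 "2 * r"] r
    by (subst Bochner_Integration.integral_add)
      (auto intro!: U.integrable_real_bounded[of "q (2 * r)" 1] simp: q_def[symmetric])
  also have "\<dots> \<le> 2 * r' * (5 * L / 2)" using ka L by (simp add: r'_def)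
  finally show ?thesis using r' unfolding r'_def by (simp only: mult_le_cancel_left)
qed

text \<open>The square of the difference of the roots, supplied by \<open>log_sum_gap\<close>, is bounded below by testing against \<open>g\<close>.\<close>

lemma entropy_gap:
  fixes g :: "real \<Rightarrow> real"
  assumes j: "j < N" and g: "continuous_on UNIV g" "per1 g"
    and ne: "(\<integral>x. g (G j x) \<partial>\<nu>) \<noteq> (\<integral>x. g x \<partial>\<nu>)"
  obtains \<eta> r0 where "\<eta> > 0" "r0 > 0"
    "\<And>ka r. 0 < ka \<Longrightarrow> ka \<le> r \<Longrightarrow> r \<le> r0 \<Longrightarrow>
      \<eta> \<le> gain ka r"
proof -
  have [measurable]: "g \<in> borel_measurable borel" using g by (intro borel_measurable_continuous_onI)
  obtain M where M: "M > 0" "\<And>x. \<bar>g x\<bar> \<le> M" using per1_continuous_bounded[OF g(2,1)] by blast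
  define \<Delta> where "\<Delta> = (\<integral>x. g (G j x) \<partial>\<nu>) - (\<integral>x. g x \<partial>\<nu>)"
  \<comment> \<open>Replacing \<open>g\<close> by its window average costs \<gamma> in each of the
    two integrals; one third of the difference survives.\<close>
  define \<gamma> where "\<gamma> = \<bar>\<Delta>\<bar> / 3"
  have \<gamma>: "\<gamma> > 0" using ne by (simp add: \<gamma>_def \<Delta>_def)
  obtain d where d: "d > 0" "\<And>x y. \<bar>x - y\<bar> \<le> d \<Longrightarrow> \<bar>g x - g y\<bar> < \<gamma>"
    using per1_uniformly_continuous[OF g(2,1) \<gamma>] by blast
  define sg where "sg = sgn \<Delta>"
  have sg: "\<bar>sg\<bar> = 1" "sg * \<Delta> = 3 * \<gamma>" using \<gamma> by (auto simp: sg_def \<gamma>_def sgn_if)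
  define \<eta> where "\<eta> = p j * \<gamma>\<^sup>2 / (6 * M\<^sup>2)"
  \<comment> \<open>This value maximizes \<open>2 * \<theta> / M * (2 * r) * \<gamma> - 2 *
    \<theta>\<^sup>2 * (6 * r)\<close>, the bound reached at the end; its maximum times
    \<open>p j\<close> is \<open>2 * r * \<eta>\<close>.\<close>
  define \<theta> where "\<theta> = \<gamma> / (6 * M)"
  have \<theta>: "\<theta> > 0" using \<gamma> M by (simp add: \<theta>_def)
  show ?thesis
  proof (rule that[of \<eta> "min d (1/2)"])
    show "\<eta> > 0" using p_pos[OF j] \<gamma> M by (simp add: \<eta>_def)
    show "0 < min d (1/2)" using d by simp
    fix ka r :: real assume ka: "0 < ka" "ka \<le> r" and rr: "r \<le> min d (1/2)"
    have r: "0 < r" "r \<le> 1/2" "r \<le> d" using ka rr by auto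
    let ?kl = "\<lambda>y. \<Sum>i<N. p i * (qi i r y * (lk ka (qi i r y) - lk ka (q r y)))"
    have ib: "integrable unif01 (\<lambda>y. qi i r y * lk ka (q r' y))" "integrable unif01 (\<lambda>y. qi i r y * lk ka (qi i r y))"
      if i: "i < N" for i r'
    proof -
      have "\<bar>qi i r y * lk ka (q r' y)\<bar> \<le> 1 * (- lk ka 0)" "\<bar>qi i r y * lk ka (qi i r y)\<bar> \<le> 1 * (- lk ka 0)" for y
        unfolding abs_mult using i qi_bounds[OF i] lk_abs[OF ka(1)] lk_nonpos[OF ka(1), of 0] by (intro mult_mono; simp)+
      then show "integrable unif01 (\<lambda>y. qi i r y * lk ka (q r' y))" "integrable unif01 (\<lambda>y. qi i r y * lk ka (qi i r y))"
        using i by (auto intro!: U.integrable_real_bounded[of _ "1 * (- lk ka 0)"])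
    qed
    have ent: "2 * r * gain ka r = (\<integral>y. ?kl y \<partial>unif01)"
    proof -
      let ?I = "\<lambda>i x. \<integral>s. lk ka (qi i r (G i x + r * s)) \<partial>unifpm1"
      have I: "integrable \<nu> (?I i)" if "i < N" for i
        using that ka by (intro integrable_bounded_borel[of _ "- lk ka 0"] W.integral_real_bounded lk_abs qi_bounds) auto
      have phi: "2 * r * (\<integral>x. ?I i x \<partial>\<nu>) = (\<integral>y. qi i r y * lk ka (qi i r y) \<partial>unif01)" if i: "i < N" for i
      proof -
        have "(\<integral>y. winmass \<nu> (G i) (\<lambda>_. 1) r y * lk ka (qi i r y) \<partial>unif01) = 2 * r * (\<integral>x. 1 * ?I i x \<partial>\<nu>)"
          using i r ka per1_qi[of i r]
          by (intro winmass_Fubini[where B=1 and C="- lk ka 0"]) (auto simp: per1_def intro!: lk_abs qi_bounds)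
        then show ?thesis by (simp add: qi_def[symmetric])
      qed
      have "(\<integral>y. winmass \<nu> (\<lambda>x. x) (\<lambda>_. 1) r y * lk ka (q r y) \<partial>unif01) =
          2 * r * (\<integral>x. 1 * (\<integral>s. lk ka (q r (x + r * s)) \<partial>unifpm1) \<partial>\<nu>)"
        using r ka per1_q[of r]
        by (intro winmass_Fubini[where B=1 and C="- lk ka 0"]) (auto simp: per1_def intro!: lk_abs)
      then have "2 * r * mph ka r = (\<integral>y. q r y * lk ka (q r y) \<partial>unif01)" by (simp add: q_def[symmetric] ph_def)
      also have "\<dots> = (\<integral>y. (\<Sum>i<N. p i * (qi i r y * lk ka (q r y))) \<partial>unif01)"
        by (intro Bochner_Integration.integral_cong refl) (subst (1) q_eq, simp add: sum_distrib_right mult.assoc)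
      finally have ph: "2 * r * mph ka r = \<dots>" .
      have "2 * r * (\<integral>x. phi ka r x \<partial>\<nu>) = (\<Sum>i<N. p i * (2 * r * (\<integral>x. ?I i x \<partial>\<nu>)))"
        unfolding phi_def using I by (subst Bochner_Integration.integral_sum) (auto simp: sum_distrib_left mult_ac)
      also have "\<dots> = (\<integral>y. (\<Sum>i<N. p i * (qi i r y * lk ka (qi i r y))) \<partial>unif01)"
        using ib phi by (subst Bochner_Integration.integral_sum) auto
      finally have "2 * r * gain ka r = (\<integral>y. (\<Sum>i<N. p i * (qi i r y * lk ka (qi i r y))) \<partial>unif01) - 2 * r * mph ka r"
        using ka by (simp add: right_diff_distrib)
      also have "\<dots> = (\<integral>y. ?kl y \<partial>unif01)"
        unfolding ph right_diff_distrib sum_subtractf using ib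
        by (subst Bochner_Integration.integral_diff) auto
      finally show ?thesis .
    qed
    \<comment> \<open>A lower bound of \<open>?kl\<close> that is affine in the masses, so that its
      integral can be computed. It comes from (A - B)^2 >= 2 * |A - B| * t - t^2 with t = \<theta> *
      (A + B), where |A - B| * (A + B) is the difference of the masses, tested against
      \<open>g\<close>.\<close>
    define e where "e y = p j * (2 * \<theta> / M * sg * (g y * (qi j r y - q r y)) - 2 * \<theta>\<^sup>2 * (qi j r y + q r y + 2 * ka))" for y
    have e: "e y \<le> ?kl y" for y
    proof -
      define A B where "A = sqrt (qi j r y + ka)" and "B = sqrt (q r y + ka)"
      have AB: "A\<^sup>2 = qi j r y + ka" "B\<^sup>2 = q r y + ka" "0 \<le> A" "0 \<le> B"
        using ka qi_bounds(1)[OF j, of r y] q_bounds(1)[of r y] by (auto simp: A_def B_def)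
      have "sg * (g y * (qi j r y - q r y)) \<le> \<bar>sg * (g y * (qi j r y - q r y))\<bar>" by simp
      also have "\<dots> = \<bar>g y\<bar> * \<bar>A\<^sup>2 - B\<^sup>2\<bar>" by (simp add: abs_mult sg AB)
      also have "\<dots> \<le> M * \<bar>A\<^sup>2 - B\<^sup>2\<bar>" using M by (intro mult_right_mono) auto
      also have "A\<^sup>2 - B\<^sup>2 = (A - B) * (A + B)" by (simp add: power2_eq_square algebra_simps)
      finally have "2 * \<theta> / M * (sg * (g y * (qi j r y - q r y))) \<le> 2 * \<theta> / M * (M * \<bar>(A - B) * (A + B)\<bar>)"
        using \<theta> M by (intro mult_left_mono) auto
      also have "\<dots> = 2 * \<bar>A - B\<bar> * (\<theta> * (A + B))" using M AB by (simp add: abs_mult)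
      also have "\<dots> \<le> \<bar>A - B\<bar>\<^sup>2 + (\<theta> * (A + B))\<^sup>2" by (rule sum_squares_bound)
      also have "\<dots> \<le> (A - B)\<^sup>2 + \<theta>\<^sup>2 * (2 * (A\<^sup>2 + B\<^sup>2))"
        using sum_squares_bound[of A B] by (auto simp: power_mult_distrib power2_sum intro!: mult_left_mono)
      finally have "2 * \<theta> / M * (sg * (g y * (qi j r y - q r y))) - 2 * \<theta>\<^sup>2 * (qi j r y + q r y + 2 * ka) \<le> (A - B)\<^sup>2"
        by (simp add: AB algebra_simps)
      then have "e y \<le> p j * (A - B)\<^sup>2"
        unfolding e_def using p_pos[OF j] by (intro mult_left_mono) (auto simp: mult.assoc)
      also have "\<dots> \<le> ?kl y"
        unfolding A_def B_def using p_pos p_sum qi_bounds ka j q_eq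
        by (intro log_sum_gap) (auto intro: less_imp_le)
      finally show ?thesis .
    qed
    define gr where "gr x = win g r x" for x
    have grb: "\<bar>gr x\<bar> \<le> M" for x unfolding gr_def by (rule W.integral_real_bounded) (use M in auto)
    have [measurable]: "gr \<in> borel_measurable borel" unfolding gr_def by measurable
    have grg: "\<bar>gr x - g x\<bar> \<le> \<gamma>" for x
    proof -
      have "\<bar>\<integral>s. g (x + r * s) - g x \<partial>unifpm1\<bar> \<le> (\<integral>s. \<bar>g (x + r * s) - g x\<bar> \<partial>unifpm1)" by (rule integral_abs_bound)
      also have "\<dots> \<le> (\<integral>s. \<gamma> \<partial>unifpm1)"
      proof (rule integral_mono_AE)
        have "\<bar>\<bar>g (x + r * s) - g x\<bar>\<bar> \<le> 2 * M" for s using M(2)[of "x + r * s"] M(2)[of x] by linarith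
        then show "integrable unifpm1 (\<lambda>s. \<bar>g (x + r * s) - g x\<bar>)" by (intro W.integrable_real_bounded) auto
        show "AE s in unifpm1. \<bar>g (x + r * s) - g x\<bar> \<le> \<gamma>" using AE_unifpm1
        proof eventually_elim
          case (elim s)
          then have "r * \<bar>s\<bar> \<le> r" using r by (intro mult_left_le) auto
          then have "r * \<bar>s\<bar> \<le> d" using r(3) by linarith
          then have "\<bar>(x + r * s) - x\<bar> \<le> d" using r by (simp add: abs_mult)
          then show ?case using d by (intro less_imp_le)
        qed
      qed auto
      also have "(\<integral>s. g (x + r * s) - g x \<partial>unifpm1) = gr x - g x"
        unfolding gr_def using M by (subst Bochner_Integration.integral_diff) (auto intro!: W.integrable_real_bounded[of _ M])
      finally show ?thesis by simp
    qed
    have close: "\<bar>(\<integral>x. gr (T x) \<partial>\<nu>) - (\<integral>x. g (T x) \<partial>\<nu>)\<bar> \<le> \<gamma>"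
      if [measurable]: "T \<in> borel_measurable borel" for T
    proof -
      have "(\<integral>x. gr (T x) \<partial>\<nu>) - (\<integral>x. g (T x) \<partial>\<nu>) = (\<integral>x. gr (T x) - g (T x) \<partial>\<nu>)"
        using grb M by (subst Bochner_Integration.integral_diff) (auto intro!: integrable_bounded_borel[of _ M])
      then show ?thesis using grg by (simp add: integral_real_bounded)
    qed
    have gq: "(\<integral>y. qi j r y * g y \<partial>unif01) = 2 * r * (\<integral>x. gr (G j x) \<partial>\<nu>)"
      "(\<integral>y. q r y * g y \<partial>unif01) = 2 * r * (\<integral>x. gr x \<partial>\<nu>)"
      unfolding qi_def q_def gr_def using M g r j
      by (subst winmass_Fubini[where B=1 and C=M]; simp)+
    have igq: "integrable unif01 (\<lambda>y. qi j r y * g y)" "integrable unif01 (\<lambda>y. q r y * g y)"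
    proof -
      have "\<bar>qi j r y * g y\<bar> \<le> 1 * M" "\<bar>q r y * g y\<bar> \<le> 1 * M" for y
        unfolding abs_mult using qi_bounds[OF j, of r y] M by (intro mult_mono; simp)+
      then show "integrable unif01 (\<lambda>y. qi j r y * g y)" "integrable unif01 (\<lambda>y. q r y * g y)"
        using j by (auto intro!: U.integrable_real_bounded[of _ "1 * M"])
    qed
    have iq: "integrable unif01 (qi j r)" "integrable unif01 (q r)"
      using j qi_bounds[OF j] by (auto intro!: U.integrable_real_bounded[of _ 1])
    have tot: "(\<integral>y. qi j r y \<partial>unif01) = 2 * r" "(\<integral>y. q r y \<partial>unif01) = 2 * r"
      using winmass_total[of "G j" "\<lambda>_. 1" 1 r] winmass_total[of "\<lambda>x. x" "\<lambda>_. 1" 1 r] r j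
      by (auto simp: q_def[symmetric] qi_def[symmetric])
    have int_e: "(\<integral>y. e y \<partial>unif01) = p j * (2 * \<theta> / M * sg * (2 * r * ((\<integral>x. gr (G j x) \<partial>\<nu>) - (\<integral>x. gr x \<partial>\<nu>)))
        - 2 * \<theta>\<^sup>2 * (4 * r + 2 * ka))"
    proof -
      have "(\<integral>y. e y \<partial>unif01) = (\<integral>y. p j * (2 * \<theta> / M * sg * (qi j r y * g y - q r y * g y) - 2 * \<theta>\<^sup>2 * (qi j r y + q r y + 2 * ka)) \<partial>unif01)"
        unfolding e_def by (intro Bochner_Integration.integral_cong refl) (simp add: algebra_simps)
      also have "\<dots> = p j * (2 * \<theta> / M * sg * ((\<integral>y. qi j r y * g y \<partial>unif01) - (\<integral>y. q r y * g y \<partial>unif01))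
          - 2 * \<theta>\<^sup>2 * ((\<integral>y. qi j r y \<partial>unif01) + (\<integral>y. q r y \<partial>unif01) + 2 * ka))"
        using igq iq by simp
      finally show ?thesis unfolding gq tot by (simp add: algebra_simps)
    qed
    have "3 * \<gamma> - 2 * \<gamma> \<le> sg * ((\<integral>x. gr (G j x) \<partial>\<nu>) - (\<integral>x. gr x \<partial>\<nu>))"
    proof -
      have "\<bar>((\<integral>x. gr (G j x) \<partial>\<nu>) - (\<integral>x. gr x \<partial>\<nu>)) - \<Delta>\<bar> \<le> 2 * \<gamma>"
        using close[of "\<lambda>x. x"] close[of "G j"] j unfolding \<Delta>_def by (simp add: abs_le_iff)
      then have "\<bar>sg * (((\<integral>x. gr (G j x) \<partial>\<nu>) - (\<integral>x. gr x \<partial>\<nu>)) - \<Delta>)\<bar> \<le> 2 * \<gamma>" by (simp add: abs_mult sg)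
      then show ?thesis using sg(2) by (simp add: right_diff_distrib abs_le_iff)
    qed
    then have "2 * \<theta> / M * (2 * r) * \<gamma> \<le> 2 * \<theta> / M * (2 * r) * (sg * ((\<integral>x. gr (G j x) \<partial>\<nu>) - (\<integral>x. gr x \<partial>\<nu>)))"
      using \<theta> M r by (intro mult_left_mono) auto
    moreover have "2 * \<theta>\<^sup>2 * (4 * r + 2 * ka) \<le> 2 * \<theta>\<^sup>2 * (6 * r)" using ka by (intro mult_left_mono) auto
    ultimately have "p j * (2 * \<theta> / M * (2 * r) * \<gamma> - 2 * \<theta>\<^sup>2 * (6 * r)) \<le> (\<integral>y. e y \<partial>unif01)"
      unfolding int_e using p_pos[OF j] by (intro mult_left_mono) (auto simp: mult_ac)
    moreover have "p j * (2 * \<theta> / M * (2 * r) * \<gamma> - 2 * \<theta>\<^sup>2 * (6 * r)) = 2 * r * \<eta>"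
      using M by (simp add: \<theta>_def \<eta>_def power2_eq_square field_simps)
    moreover have "(\<integral>y. e y \<partial>unif01) \<le> (\<integral>y. ?kl y \<partial>unif01)"
    proof (rule integral_mono[OF _ _ e])
      show "integrable unif01 e" unfolding e_def using igq iq
        by (simp add: right_diff_distrib mult.commute[of "g _"])
      show "integrable unif01 ?kl"
        unfolding right_diff_distrib using ib
        by (intro Bochner_Integration.integrable_sum Bochner_Integration.integrable_diff integrable_mult_right) auto
    qed
    ultimately have "2 * r * \<eta> \<le> 2 * r * gain ka r"
      unfolding ent by linarith
    then show "\<eta> \<le> gain ka r"
      using r by simp
  qed
qed

section \<open>Almost stationarity of the log-mass and the two bounds of the drift\<close>

definition cp :: real where "cp = (\<Sum>i<N. - ln (p i))"

lemma cp: "i < N \<Longrightarrow> - ln (p i) \<le> cp"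
  unfolding cp_def using p_pos p_le_1 by (intro member_le_sum[of i _ "\<lambda>i. - ln (p i)"]) auto

text \<open>For \<open>u * ph\<close> stationarity is exact (\<open>stationary_smooth\<close>), so
  the error is the mean of |ph (G i x) - ph x|. \<open>ph_G_ge\<close> bounds this difference from
  below only, but its mean is zero and |t| <= t + 2 * m whenever t >= -m. The mean of m is bounded
  by \<open>ph_refine\<close>, independently of r.\<close>

lemma ph_almost_invariant:
  assumes u: "continuous_on UNIV u" "per1 u" "\<And>x. \<bar>u x\<bar> \<le> M"
    and ka: "0 < ka" "ka \<le> r" and r: "0 < r" "r \<le> 1/4"
  shows "\<bar>(\<integral>x. Pop u x * (- ph ka r x) \<partial>\<nu>) - (\<integral>x. u x * (- ph ka r x) \<partial>\<nu>)\<bar> \<le> M * (5 * exp LB + 2 * cp)"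
proof -
  have [measurable]: "u \<in> borel_measurable borel" using u by (intro borel_measurable_continuous_onI)
  define r' where "r' = r * exp (- LB)"
  have r': "0 < r'" "r' \<le> r" using r LB_pos by (auto simp: r'_def mult_left_le)
  have M: "0 \<le> M" using u(3)[of 0] by linarith
  define f where "f v x = v x * ph ka r x" for v x
  have [measurable]: "f v \<in> borel_measurable borel" if [measurable]: "v \<in> borel_measurable borel" for v
    unfolding f_def by measurable
  have sm: "(\<integral>x. Pop (f v) x \<partial>\<nu>) = (\<integral>x. f v x \<partial>\<nu>)" if "continuous_on UNIV v" "per1 v" for v
    unfolding f_def ph_def using that ka r per1_q[of r]
    by (intro stationary_smooth[where C="- lk ka 0"]) (auto intro!: lk_abs simp: per1_def)
  have fb: "\<bar>f v x\<bar> \<le> m * (- lk ka 0)" if "\<And>x. \<bar>v x\<bar> \<le> m" for v m x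
    unfolding f_def abs_mult using that ph_abs[OF ka(1)] order_trans[OF abs_ge_zero that] by (intro mult_mono) auto
  have int: "integrable \<nu> (f v)" "integrable \<nu> (Pop (f v))"
    if [measurable]: "v \<in> borel_measurable borel" and "\<And>x. \<bar>v x\<bar> \<le> m" for v m
    using fb[OF that(2)] by (auto intro!: integrable_bounded_borel[of _ "m * (- lk ka 0)"] Pop_abs_le)
  \<comment> \<open>The p-mean of t + 2 * m, with t = ph (G i x) - ph x and m = cp + ph x - ph' x,
    where ph' is taken at the radius r'.\<close>
  define e where "e x = 2 * cp - 2 * ph ka r' x + ph ka r x + Pop (f (\<lambda>_. 1)) x" for x
  have pt: "\<bar>Pop (f u) x - f (Pop u) x\<bar> \<le> M * e x" for x
  proof -
    have "\<bar>u (G i x) * (ph ka r (G i x) - ph ka r x)\<bar> \<le> M * (ph ka r (G i x) + (2 * cp - 2 * ph ka r' x + ph ka r x))"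
      if i: "i < N" for i
    proof -
      have "ph ka r' x - cp \<le> ph ka r (G i x)"
        using ph_G_ge[OF i ka(1) r(1), of x] cp[OF i] by (simp add: r'_def)
      moreover have "ph ka r' x \<le> ph ka r x" using ph_mono_radius ka r' by blast
      moreover have "0 \<le> cp" using cp[OF i] p_le_1[OF i] p_pos[OF i] ln_le_zero_iff[of "p i"] by linarith
      ultimately have "\<bar>ph ka r (G i x) - ph ka r x\<bar> \<le> ph ka r (G i x) + (2 * cp - 2 * ph ka r' x + ph ka r x)"
        by linarith
      then show ?thesis unfolding abs_mult using u(3) M by (intro mult_mono) auto
    qed
    then have "(\<Sum>i<N. p i * \<bar>u (G i x) * (ph ka r (G i x) - ph ka r x)\<bar>) \<le>
        (\<Sum>i<N. p i * (M * (ph ka r (G i x) + (2 * cp - 2 * ph ka r' x + ph ka r x))))" by (rule psum_mono)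
    also have "\<dots> = M * e x"
      using psum_add_const[of "\<lambda>i. ph ka r (G i x)" "2 * cp - 2 * ph ka r' x + ph ka r x"]
      by (simp add: e_def Pop_def f_def mult.left_commute[of _ M] flip: sum_distrib_left)
    finally have "(\<Sum>i<N. p i * \<bar>u (G i x) * (ph ka r (G i x) - ph ka r x)\<bar>) \<le> M * e x" .
    moreover have "Pop (f u) x - f (Pop u) x = (\<Sum>i<N. p i * (u (G i x) * (ph ka r (G i x) - ph ka r x)))"
      by (simp add: Pop_def f_def sum_distrib_right sum_subtractf right_diff_distrib mult.assoc)
    moreover have "\<bar>\<Sum>i<N. p i * (u (G i x) * (ph ka r (G i x) - ph ka r x))\<bar> \<le>
        (\<Sum>i<N. p i * \<bar>u (G i x) * (ph ka r (G i x) - ph ka r x)\<bar>)"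
      by (rule psum_abs)
    ultimately show ?thesis by linarith
  qed
  have int_Pu: "integrable \<nu> (f (Pop u))" by (rule int(1)[OF _ Pop_abs_le[OF u(3)]]) simp
  have int_u: "integrable \<nu> (Pop (f u))" by (rule int(2)[OF _ u(3)]) simp
  have int_e: "integrable \<nu> e" unfolding e_def using ka int[of "\<lambda>_. 1" 1] by simp
  have "\<bar>(\<integral>x. Pop u x * (- ph ka r x) \<partial>\<nu>) - (\<integral>x. u x * (- ph ka r x) \<partial>\<nu>)\<bar> = \<bar>\<integral>x. Pop (f u) x - f (Pop u) x \<partial>\<nu>\<bar>"
    unfolding Bochner_Integration.integral_diff[OF int_u int_Pu] sm[OF u(1,2)] by (simp add: f_def[abs_def])
  also have "\<dots> \<le> (\<integral>x. \<bar>Pop (f u) x - f (Pop u) x\<bar> \<partial>\<nu>)" by (rule integral_abs_bound)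
  also have "\<dots> \<le> (\<integral>x. M * e x \<partial>\<nu>)"
    using pt int_Pu int_u int_e
    by (intro integral_mono integrable_abs Bochner_Integration.integrable_diff integrable_mult_right) auto
  also have "\<dots> = M * (2 * cp + 2 * (mph ka r - mph ka r'))"
    using sm[of "\<lambda>_. 1"] ka int[of "\<lambda>_. 1" 1] unfolding e_def by (simp add: per1_def f_def)
  also have "\<dots> \<le> M * (5 * exp LB + 2 * cp)"
  proof (rule mult_left_mono[OF _ M])
    have "r / exp LB = r'" by (simp only: r'_def exp_minus divide_inverse)
    moreover have "1 \<le> exp LB" using LB_pos by simp
    ultimately show "2 * cp + 2 * (mph ka r - mph ka r') \<le> 5 * exp LB + 2 * cp"
      using ph_refine[OF ka r, of "exp LB"] by simp
  qed
  finally show ?thesis .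
qed

text \<open>Sums the gap over the scales exp(-(T + k * eps)), k < K. At each point
  \<open>phi_le_ph\<close> makes the summands differences of one monotone function of the log-scale,
  so only the end scales survive: \<tau>, with coefficient \<open>psi - 2 * eps\<close>, and the
  fixed scale T + B, which goes into the constant.\<close>

lemma drift_bound:
  assumes gap: "\<And>ka r. 0 < ka \<Longrightarrow> ka \<le> r \<Longrightarrow> r \<le> r0 \<Longrightarrow>
      \<eta> \<le> gain ka r"
    and r0: "r0 > 0" and eps: "eps > 0"
  obtains T C where "T \<ge> ln 4"
    "\<And>K \<tau>. \<tau> = T + real K * eps \<Longrightarrow>
      (\<integral>x. psi x * (- ph (exp (- \<tau>)) (exp (- \<tau>)) x) \<partial>\<nu>) \<le> C + 2 * eps * \<tau> - \<eta> * (real K * eps)"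
proof -
  obtain r1 where r1: "r1 > 0"
    "\<And>ka r x. 0 < ka \<Longrightarrow> 0 < r \<Longrightarrow> r \<le> r1 \<Longrightarrow> phi ka r x \<le> (\<Sum>i<N. p i * ph ka (r * exp (eps - la i x)) x)"
    using phi_le_ph[OF eps] by metis
  define T where "T = max (ln 4) (max (- ln r0) (- ln r1))"
  define B where "B = LB + eps"
  have T: "exp (- T) \<le> 1/4" "exp (- T) \<le> r0" "exp (- T) \<le> r1"
  proof -
    have *: "exp (- T) \<le> a" if "- ln a \<le> T" "a > 0" for a
    proof -
      have "exp (- T) \<le> exp (ln a)" using that by (subst exp_le_cancel_iff) linarith
      then show ?thesis using that by simp
    qed
    show "exp (- T) \<le> 1/4" by (rule *) (auto simp: T_def ln_div)
    show "exp (- T) \<le> r0" by (rule *) (auto simp: T_def r0)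
    show "exp (- T) \<le> r1" by (rule *) (auto simp: T_def r1)
  qed
  have B: "B > 0" using LB_pos eps by (simp add: B_def)
  have T4: "T \<ge> ln 4" by (simp add: T_def)
  show ?thesis
  proof (rule that[of T "2 * eps + B * (T + B + 1)", OF T4])
    fix K \<tau> assume \<tau>_def: "\<tau> = T + real K * eps"
    \<comment> \<open>One shift for all scales, namely the final radius: this gives
      \<open>ka \<le> rk k\<close>, as \<open>gap\<close> demands, and the bound ends at
      \<open>ph\<close> with both arguments equal.\<close>
    define ka where "ka = exp (- \<tau>)"
    have ka: "0 < ka" "ka \<le> exp (- T)" using eps by (auto simp: ka_def \<tau>_def)
    have ka1: "ka \<le> 1/4" using ka T by linarith
    define rk where "rk k = exp (- (T + real k * eps))" for k
    have rk: "0 < rk k" "rk k \<le> exp (- T)" for k using eps by (auto simp: rk_def)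
    have rkka: "ka \<le> rk k" if "k < K" for k using that eps by (auto simp: rk_def ka_def \<tau>_def)
    have pt: "eps * (\<Sum>k<K. phi ka (rk k) x - ph ka (rk k) x) \<le>
        (psi x - 2 * eps) * ph ka (exp (- \<tau>)) x - B * ph ka (exp (- (T + B))) x" for x
    proof -
      \<comment> \<open>In the log-scale t = - ln r, scaling the radius by
        \<open>exp (eps - la i x)\<close> adds \<open>la i x - eps\<close> to t: a bounded shift, as
        in \<open>antimono_telescope\<close>.\<close>
      define f where "f t = ph ka (exp (- t)) x" for t
      define d where "d i k = f (T + real k * eps + (la i x - eps)) - f (T + real k * eps)" for i k
      have "phi ka (rk k) x - ph ka (rk k) x \<le> (\<Sum>i<N. p i * d i k)" for k
      proof -
        have "phi ka (rk k) x \<le> (\<Sum>i<N. p i * ph ka (rk k * exp (eps - la i x)) x)"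
          using rk[of k] T by (intro r1(2) ka) auto
        moreover have "rk k * exp (eps - la i x) = exp (- (T + real k * eps + (la i x - eps)))" for i
          unfolding rk_def exp_add[symmetric] by (simp add: algebra_simps)
        ultimately show ?thesis
          using psum_add_const[of "\<lambda>i. f (T + real k * eps + (la i x - eps))" "- f (T + real k * eps)"]
          by (simp add: d_def f_def rk_def)
      qed
      then have "eps * (\<Sum>k<K. phi ka (rk k) x - ph ka (rk k) x) \<le> eps * (\<Sum>k<K. \<Sum>i<N. p i * d i k)"
        using eps by (intro mult_left_mono sum_mono) auto
      also have "\<dots> = (\<Sum>i<N. p i * (eps * (\<Sum>k<K. d i k)))"
        by (subst sum.swap) (simp add: sum_distrib_left mult.left_commute)
      also have "\<dots> \<le> (\<Sum>i<N. p i * ((la i x - eps - eps) * f (T + real K * eps) - B * f (T + B)))"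
      proof (rule psum_mono)
        fix i assume i: "i < N"
        show "eps * (\<Sum>k<K. d i k) \<le> (la i x - eps - eps) * f (T + real K * eps) - B * f (T + B)"
          unfolding d_def
        proof (rule antimono_telescope[OF _ _ eps])
          show "f t \<le> f s" if "s \<le> t" for s t
            unfolding f_def using that by (intro ph_mono_radius ka) auto
          show "f t \<le> 0" for t unfolding f_def by (rule ph_nonpos[OF ka(1)])
          show "\<bar>la i x - eps\<bar> \<le> B" using LB[OF i, of x] eps unfolding B_def by linarith
        qed
      qed
      also have "\<dots> = (psi x - 2 * eps) * f \<tau> - B * f (T + B)"
        using psum_add_const[of "\<lambda>i. la i x * f \<tau>" "- (2 * eps * f \<tau>) - B * f (T + B)"]
        by (simp add: psi_def \<tau>_def algebra_simps sum_distrib_left)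
      finally show ?thesis by (simp add: f_def)
    qed
    have [measurable]: "psi \<in> borel_measurable borel" using cont_psi by (intro borel_measurable_continuous_onI)
    have int: "integrable \<nu> (\<lambda>x. psi x * ph ka r x)" for r
    proof (rule integrable_bounded_borel)
      show "\<bar>psi x * ph ka r x\<bar> \<le> LB * (- lk ka 0)" for x
        unfolding abs_mult using psi_abs_le ph_abs[OF ka(1)] LB_pos by (intro mult_mono) auto
    qed measurable
    have "\<eta> * (real K * eps) = eps * (\<Sum>k<K. \<eta>)" by simp
    also have "\<dots> \<le> eps * (\<Sum>k<K. gain ka (rk k))"
      using eps T rk rkka by (intro mult_left_mono sum_mono gap ka) (auto intro: order_trans)
    also have "\<dots> = (\<integral>x. eps * (\<Sum>k<K. phi ka (rk k) x - ph ka (rk k) x) \<partial>\<nu>)"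
      using ka by (subst Bochner_Integration.integral_sum[symmetric]) auto
    also have "\<dots> \<le> (\<integral>x. (psi x - 2 * eps) * ph ka (exp (- \<tau>)) x - B * ph ka (exp (- (T + B))) x \<partial>\<nu>)"
      using int ka by (intro integral_mono pt) (auto simp: left_diff_distrib)
    also have "\<dots> = (\<integral>x. psi x * ph ka (exp (- \<tau>)) x \<partial>\<nu>) - 2 * eps * mph ka (exp (- \<tau>)) - B * mph ka (exp (- (T + B)))"
      using int ka by (simp add: left_diff_distrib)
    finally have main: "\<eta> * (real K * eps) \<le> - (\<integral>x. psi x * (- ph ka (exp (- \<tau>)) x) \<partial>\<nu>)
        + 2 * eps * (\<integral>x. - ph ka (exp (- \<tau>)) x \<partial>\<nu>) + B * (\<integral>x. - ph ka (exp (- (T + B))) x \<partial>\<nu>)"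
      by simp
    have mass: "(\<integral>x. - ph ka (exp (- t)) x \<partial>\<nu>) \<le> t + 1" if "T \<le> t" for t
    proof -
      have "exp (- t) \<le> exp (- T)" using that by simp
      then have "exp (- t) \<le> 1/2" using T by linarith
      then show ?thesis
        using ph_weighted_bound[of "\<lambda>_. 1" 1 ka "exp (- t)"] ka ka1 by (simp add: ln_div)
    qed
    have "2 * eps * (\<integral>x. - ph ka (exp (- \<tau>)) x \<partial>\<nu>) \<le> 2 * eps * (\<tau> + 1)"
      using eps by (intro mult_left_mono mass) (auto simp: \<tau>_def)
    moreover have "B * (\<integral>x. - ph ka (exp (- (T + B))) x \<partial>\<nu>) \<le> B * (T + B + 1)"
      using B by (intro mult_left_mono mass) auto
    ultimately show "(\<integral>x. psi x * (- ph (exp (- \<tau>)) (exp (- \<tau>)) x) \<partial>\<nu>)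
       \<le> 2 * eps + B * (T + B + 1) + 2 * eps * \<tau> - \<eta> * (real K * eps)"
      using main by (simp add: distrib_left ka_def)
  qed
qed

text \<open>Almost stationarity allows to replace n * psi by \<open>S n\<close> at a cost
  independent of r. The deficit n * (c + eps) - S n is nonnegative with integral at most n * eps, so
  \<open>ph_weighted_bound\<close> limits its contribution to n * eps * ln(1/r) plus a
  constant.\<close>

lemma psi_weighted_lower:
  assumes n: "n \<ge> 1" and Sn: "\<And>x. S n x \<le> real n * (c + eps)" and c: "0 \<le> c" "c \<le> (\<integral>x. psi x \<partial>\<nu>)" and eps: "eps > 0"
  obtains C where "\<And>r. 0 < r \<Longrightarrow> r \<le> 1/4 \<Longrightarrow> - eps * ln (1 / r) - C \<le> (\<integral>x. psi x * (- ph r r x) \<partial>\<nu>)"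
proof -
  have [measurable]: "(Pop ^^ k) psi \<in> borel_measurable borel" for k
    using cont_Pop_pow[OF cont_psi] by (intro borel_measurable_continuous_onI)
  have [measurable]: "psi \<in> borel_measurable borel" using cont_psi by (intro borel_measurable_continuous_onI)
  have Mk: "\<bar>(Pop ^^ k) psi x\<bar> \<le> LB" for k x by (intro Pop_pow_abs_le psi_abs_le)
  have [measurable]: "S n \<in> borel_measurable borel" unfolding S_def by measurable
  have int_Pop: "(\<integral>x. (Pop ^^ k) psi x \<partial>\<nu>) = (\<integral>x. psi x \<partial>\<nu>)" for k
    by (induction k) (simp_all add: stationary cont_Pop_pow per1_Pop_pow cont_psi per1_psi)
  define c0 where "c0 = LB * (5 * exp LB + 2 * cp)"
  define LB' where "LB' = real n * (c + eps) + real n * LB"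
  show ?thesis
  proof (rule that[of "real n * c0 + LB'"])
    fix r :: real assume r: "0 < r" "r \<le> 1/4"
    define D where "D x = - ph r r x" for x
    have [measurable]: "D \<in> borel_measurable borel" unfolding D_def by measurable
    have D0: "0 \<le> D x" for x using ph_nonpos[OF r(1)] by (simp add: D_def)
    have Db: "\<bar>D x\<bar> \<le> - lk r 0" for x using ph_abs[OF r(1)] by (simp add: D_def)
    have int: "integrable \<nu> (\<lambda>x. u x * D x)" if [measurable]: "u \<in> borel_measurable borel" and "\<And>x. \<bar>u x\<bar> \<le> m" for u m
    proof (rule integrable_bounded_borel)
      have "0 \<le> m" using that(2)[of 0] by linarith
      then show "\<bar>u x * D x\<bar> \<le> m * (- lk r 0)" for x
        unfolding abs_mult using that(2) Db by (intro mult_mono) auto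
    qed measurable
    have inv: "\<bar>(\<integral>x. (Pop ^^ k) psi x * D x \<partial>\<nu>) - (\<integral>x. psi x * D x \<partial>\<nu>)\<bar> \<le> real k * c0" for k
    proof (induction k)
      case (Suc k)
      have "\<bar>(\<integral>x. Pop ((Pop ^^ k) psi) x * D x \<partial>\<nu>) - (\<integral>x. (Pop ^^ k) psi x * D x \<partial>\<nu>)\<bar> \<le> c0"
        unfolding D_def c0_def using r Mk
        by (intro ph_almost_invariant cont_Pop_pow per1_Pop_pow cont_psi per1_psi) auto
      then show ?case using Suc by (simp add: distrib_right abs_le_iff)
    qed simp
    have "(\<integral>x. S n x * D x \<partial>\<nu>) = (\<integral>x. (\<Sum>k<n. (Pop ^^ k) psi x * D x) \<partial>\<nu>)"
      unfolding S_def by (simp add: sum_distrib_right)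
    also have "\<dots> = (\<Sum>k<n. (\<integral>x. (Pop ^^ k) psi x * D x \<partial>\<nu>))"
      using Mk by (intro Bochner_Integration.integral_sum int[of _ LB]) auto
    also have "\<dots> \<le> (\<Sum>k<n. (\<integral>x. psi x * D x \<partial>\<nu>) + real n * c0)"
    proof (intro sum_mono)
      fix k assume "k \<in> {..<n}"
      moreover have "0 \<le> c0"
        using inv[of 1] by (simp add: order_trans[OF abs_ge_zero])
      ultimately have "real k * c0 \<le> real n * c0" by (intro mult_right_mono) auto
      then show "(\<integral>x. (Pop ^^ k) psi x * D x \<partial>\<nu>) \<le> (\<integral>x. psi x * D x \<partial>\<nu>) + real n * c0"
        using inv[of k] by linarith
    qed
    finally have up: "(\<integral>x. S n x * D x \<partial>\<nu>) \<le> real n * ((\<integral>x. psi x * D x \<partial>\<nu>) + real n * c0)" by simp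
    define g where "g x = real n * (c + eps) - S n x" for x
    have [measurable]: "g \<in> borel_measurable borel" unfolding g_def by measurable
    have g: "0 \<le> g x" "g x \<le> LB'" for x
      using Sn[of x] S_abs_le[of n x] unfolding g_def LB'_def by (auto simp: abs_le_iff)
    have gint: "(\<integral>x. g x \<partial>\<nu>) \<le> real n * eps"
    proof -
      have "(\<integral>x. S n x \<partial>\<nu>) = real n * (\<integral>x. psi x \<partial>\<nu>)"
        unfolding S_def using Mk int_Pop
        by (subst Bochner_Integration.integral_sum) (auto intro!: integrable_bounded_borel[of _ LB])
      moreover have "(\<integral>x. g x \<partial>\<nu>) = real n * (c + eps) - (\<integral>x. S n x \<partial>\<nu>)"
        unfolding g_def using S_abs_le[of n] by (subst Bochner_Integration.integral_diff)
          (auto intro!: integrable_bounded_borel[of "S n" "real n * LB"])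
      moreover have "real n * c \<le> real n * (\<integral>x. psi x \<partial>\<nu>)" using c by (intro mult_left_mono) auto
      ultimately show ?thesis by (simp add: distrib_left)
    qed
    have "(\<integral>x. g x * D x \<partial>\<nu>) \<le> ln (1 / r) * (\<integral>x. g x \<partial>\<nu>) + LB'"
      unfolding D_def using g r by (intro ph_weighted_bound) auto
    also have "\<dots> \<le> ln (1 / r) * (real n * eps) + LB'"
      using gint r by (intro add_right_mono mult_left_mono) (auto simp: ln_div)
    finally have gD: "(\<integral>x. g x * D x \<partial>\<nu>) \<le> ln (1 / r) * (real n * eps) + LB'" .
    have "(\<integral>x. g x * D x \<partial>\<nu>) = real n * (c + eps) * (\<integral>x. D x \<partial>\<nu>) - (\<integral>x. S n x * D x \<partial>\<nu>)"
      unfolding g_def left_diff_distrib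
      using int[of "S n" "real n * LB"] int[of "\<lambda>_. 1" 1] S_abs_le[of n] by (subst Bochner_Integration.integral_diff) auto
    \<comment> \<open>Here 0 <= c enters: the main term c + eps has the favourable sign and is
      discarded.\<close>
    moreover have "0 \<le> real n * (c + eps) * (\<integral>x. D x \<partial>\<nu>)"
      using c eps D0 by (intro mult_nonneg_nonneg integral_nonneg_AE) auto
    ultimately have "- (real n * (eps * ln (1 / r))) - LB' \<le> real n * ((\<integral>x. psi x * D x \<partial>\<nu>) + real n * c0)"
      using up gD by (simp add: mult_ac)
    moreover have "LB' \<le> real n * LB'"
      using g[of 0] n by (simp add: mult_le_cancel_right1 order_trans[of 0 "g 0" LB'])
    ultimately have "real n * (- eps * ln (1 / r) - LB') \<le> real n * ((\<integral>x. psi x * D x \<partial>\<nu>) + real n * c0)"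
      by (simp add: right_diff_distrib)
    then have "- eps * ln (1 / r) - LB' \<le> (\<integral>x. psi x * D x \<partial>\<nu>) + real n * c0"
      using n by (simp add: mult_le_cancel_left)
    then show "- eps * ln (1 / r) - (real n * c0 + LB') \<le> (\<integral>x. psi x * (- ph r r x) \<partial>\<nu>)"
      unfolding D_def by linarith
  qed
qed

lemma all_invariant_if_nonneg_exponent:
  assumes Sn: "\<And>eps. eps > 0 \<Longrightarrow> \<exists>n\<ge>1. \<forall>x. S n x \<le> real n * (c + eps)"
    and c: "0 \<le> c" "c \<le> (\<integral>x. psi x \<partial>\<nu>)"
    and j: "j < N" and g: "continuous_on UNIV g" "per1 (g :: real \<Rightarrow> real)"
  shows "(\<integral>x. g (G j x) \<partial>\<nu>) = (\<integral>x. g x \<partial>\<nu>)"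
proof (rule ccontr)
  assume "(\<integral>x. g (G j x) \<partial>\<nu>) \<noteq> (\<integral>x. g x \<partial>\<nu>)"
  then obtain \<eta> r0 where \<eta>: "\<eta> > 0" and r0: "r0 > 0" and
    gap: "\<And>ka r. 0 < ka \<Longrightarrow> ka \<le> r \<Longrightarrow> r \<le> r0 \<Longrightarrow>
      \<eta> \<le> gain ka r"
    using entropy_gap[OF j g] by metis
  \<comment> \<open>The two bounds give \<eta> * (K * eps) <= 3 * eps * \<tau> + const with \<tau> =
    T + K * eps; any eps with 3 * eps < \<eta> makes this fail for large K.\<close>
  define eps where "eps = \<eta> / 8"
  have eps: "eps > 0" using \<eta> by (simp add: eps_def)
  obtain T C where T: "T \<ge> ln 4" and up: "\<And>K \<tau>. \<tau> = T + real K * eps \<Longrightarrow>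
      (\<integral>x. psi x * (- ph (exp (- \<tau>)) (exp (- \<tau>)) x) \<partial>\<nu>) \<le> C + 2 * eps * \<tau> - \<eta> * (real K * eps)"
    using drift_bound[OF gap r0 eps] by blast
  obtain n where n: "n \<ge> 1" "\<And>x. S n x \<le> real n * (c + eps)" using Sn[OF eps] by blast
  obtain C' where low: "\<And>r. 0 < r \<Longrightarrow> r \<le> 1/4 \<Longrightarrow> - eps * ln (1 / r) - C' \<le> (\<integral>x. psi x * (- ph r r x) \<partial>\<nu>)"
    using psi_weighted_lower[OF n c eps] by blast
  have "real K * (5 * eps * eps) \<le> C + C' + 3 * eps * T" for K
  proof -
    define \<tau> where "\<tau> = T + real K * eps"
    have "T \<le> \<tau>" using eps by (simp add: \<tau>_def)
    then have "exp (- \<tau>) \<le> exp (- ln 4)" using T by simp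
    then have "exp (- \<tau>) \<le> 1/4" by (simp add: exp_minus)
    then have "- eps * \<tau> - C' \<le> (\<integral>x. psi x * (- ph (exp (- \<tau>)) (exp (- \<tau>)) x) \<partial>\<nu>)"
      using low[of "exp (- \<tau>)"] by (simp add: ln_div)
    also have "\<dots> \<le> C + 2 * eps * \<tau> - \<eta> * (real K * eps)" by (rule up[OF \<tau>_def])
    finally have "- eps * \<tau> - C' \<le> C + 2 * eps * \<tau> - \<eta> * (real K * eps)" .
    moreover have "\<eta> = 8 * eps" by (simp add: eps_def)
    ultimately show ?thesis by (simp add: \<tau>_def algebra_simps)
  qed
  moreover obtain K :: nat where "real K * (5 * eps * eps) > C + C' + 3 * eps * T"
    using reals_Archimedean3[of "5 * eps * eps"] eps by (metis mult_pos_pos zero_less_numeral)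
  ultimately show False by (meson not_le)
qed

end

section \<open>The Lyapunov exponent\<close>

context lifted_ifs
begin

definition coin_pmf :: "nat pmf"
  where "coin_pmf = embed_pmf (\<lambda>i. if i < N then p i else 0)"

lemma pmf_coin_pmf: "pmf coin_pmf i = (if i < N then p i else 0)"
  unfolding coin_pmf_def
proof (rule pmf_embed_pmf)
  show "0 \<le> (if i < N then p i else 0)" for i using p_pos[of i] by (auto intro: less_imp_le)
  have "(\<integral>\<^sup>+ i. ennreal (if i < N then p i else 0) \<partial>count_space UNIV) = (\<Sum>i<N. ennreal (if i < N then p i else 0))"
    by (rule nn_integral_count_space') auto
  also have "\<dots> = (\<Sum>i<N. ennreal (p i))" by (intro sum.cong) auto
  also have "\<dots> = ennreal (\<Sum>i<N. p i)" using p_pos by (intro sum_ennreal) (auto intro: less_imp_le)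
  finally show "(\<integral>\<^sup>+ i. ennreal (if i < N then p i else 0) \<partial>count_space UNIV) = 1" by (simp add: p_sum)
qed

lemma set_coin_pmf: "set_pmf coin_pmf \<subseteq> {..<N}"
  by (auto simp: set_pmf_iff pmf_coin_pmf split: if_splits)

text \<open>The law of the point after k random steps, with the first map drawn first. As a pmf of
  finite support it makes all expectations finite sums.\<close>

primrec chain :: "nat \<Rightarrow> real \<Rightarrow> real pmf"
  where
    "chain 0 x = return_pmf x"
  | "chain (Suc k) x = bind_pmf coin_pmf (\<lambda>i. chain k (G i x))"

lemma finite_set_chain: "finite (set_pmf (chain k x))"
  using finite_subset[OF set_coin_pmf] by (induction k arbitrary: x) auto

lemma expectation_chain:
  fixes g :: "real \<Rightarrow> real"
  shows "measure_pmf.expectation (chain k x) g = (Pop ^^ k) g x"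
proof (induction k arbitrary: x)
  case (Suc k)
  have "measure_pmf.expectation (chain (Suc k) x) g = (\<Sum>i<N. pmf coin_pmf i *\<^sub>R measure_pmf.expectation (chain k (G i x)) g)"
    unfolding chain.simps by (rule pmf_expectation_bind) (auto simp: finite_set_chain set_coin_pmf)
  also have "\<dots> = (\<Sum>i<N. p i * (Pop ^^ k) g (G i x))" by (intro sum.cong) (auto simp: Suc pmf_coin_pmf)
  also have "\<dots> = (Pop ^^ Suc k) g x" by (simp add: Pop_def[of "(Pop ^^ k) g"])
  finally show ?case .
qed simp

text \<open>The law of the chain at a uniform random time below \<open>n\<close>, reduced modulo 1.
  Periodic functions do not notice the reduction, and it confines all these laws to one bounded
  interval, whence tightness. The interval is left-open as in the definition of tightness and starts
  at -1 so as to contain 0.\<close>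

lemma Cesaro_measure:
  assumes n: "n \<ge> 1"
  obtains \<mu> where "real_distribution \<mu>" "measure \<mu> {-1<..1} = 1"
    "\<And>g :: real \<Rightarrow> real. continuous_on UNIV g \<Longrightarrow> per1 g \<Longrightarrow> (\<integral>x. g x \<partial>\<mu>) = (\<Sum>k<n. (Pop ^^ k) g x0) / real n"
proof -
  define K where "K = bind_pmf (pmf_of_set {..<n}) (\<lambda>k. chain k x0)"
  define \<mu> where "\<mu> = distr (measure_pmf K) borel frac"
  have ne: "{..<n} \<noteq> {}" using n by (simp add: lessThan_empty_iff)
  show ?thesis
  proof (rule that[of \<mu>])
    show "real_distribution \<mu>" unfolding \<mu>_def by (rule prob_space.real_distribution_distr[OF measure_pmf.prob_space_axioms]) simp
    have "frac x \<in> {-1<..1}" for x :: real using frac_ge_0[of x] frac_lt_1[of x]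
      unfolding greaterThanAtMost_iff by linarith
    then have "frac -` {-1<..1} = (UNIV :: real set)" by blast
    then have "measure \<mu> {-1<..1} = measure (measure_pmf K) UNIV"
      unfolding \<mu>_def by (subst measure_distr) auto
    then show "measure \<mu> {-1<..1} = 1" by simp
    fix g :: "real \<Rightarrow> real" assume g: "continuous_on UNIV g" "per1 g"
    have [measurable]: "g \<in> borel_measurable borel" using g by (intro borel_measurable_continuous_onI)
    have "(\<integral>x. g x \<partial>\<mu>) = measure_pmf.expectation K (\<lambda>x. g (frac x))"
      unfolding \<mu>_def by (rule integral_distr) auto
    also have "\<dots> = measure_pmf.expectation K g" by (simp add: per1_frac[OF g(2)])
    also have "\<dots> = (\<Sum>k<n. measure_pmf.expectation (chain k x0) g /\<^sub>R real (card {..<n}))"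
      unfolding K_def by (rule pmf_expectation_bind_pmf_of_set) (auto simp: ne finite_set_chain)
    also have "\<dots> = (\<Sum>k<n. (Pop ^^ k) g x0) / real n"
      by (simp add: expectation_chain divide_inverse sum_distrib_left mult.commute)
    finally show "(\<integral>x. g x \<partial>\<mu>) = (\<Sum>k<n. (Pop ^^ k) g x0) / real n" .
  qed
qed

text \<open>A Krylov-Bogolyubov argument: \<open>\<nu>\<close> is a limit of Cesaro means started at points that maximize the
  averages of \<open>psi\<close>.\<close>

lemma maximizing_stationary:
  assumes max: "\<And>n y. n \<ge> 1 \<Longrightarrow> S n y \<le> S n (x n)" and lower: "\<And>n. n \<ge> 1 \<Longrightarrow> real n * c \<le> S n (x n)"
  obtains \<nu> where "stationary_ifs N p G G' H H' \<nu>" "c \<le> (\<integral>x. psi x \<partial>\<nu>)"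
proof -
  have "\<exists>\<mu>. real_distribution \<mu> \<and> measure \<mu> {-1<..1} = 1 \<and>
    (\<forall>g :: real \<Rightarrow> real. continuous_on UNIV g \<longrightarrow> per1 g \<longrightarrow>
      (\<integral>x. g x \<partial>\<mu>) = (\<Sum>k<Suc n. (Pop ^^ k) g (x (Suc n))) / real (Suc n))" for n
    using Cesaro_measure[of "Suc n" "x (Suc n)"] by (metis le_add1 plus_1_eq_Suc)
  then obtain \<mu> where \<mu>: "\<And>n. real_distribution (\<mu> n)" "\<And>n. measure (\<mu> n) {-1<..1} = 1"
    and int\<mu>: "\<And>n g. continuous_on UNIV g \<Longrightarrow> per1 (g :: real \<Rightarrow> real) \<Longrightarrow>
      (\<integral>x. g x \<partial>\<mu> n) = (\<Sum>k<Suc n. (Pop ^^ k) g (x (Suc n))) / real (Suc n)"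
    by metis
  have "tight \<mu>" unfolding tight_def
  proof (intro conjI allI impI \<mu>)
    fix eps :: real assume "eps > 0"
    then have "(-1::real) < 1 \<and> (\<forall>n. 1 - eps < measure (\<mu> n) {-1<..1})" by (simp add: \<mu>)
    then show "\<exists>a b. a < b \<and> (\<forall>n. 1 - eps < measure (\<mu> n) {a<..b})" by blast
  qed
  from tight_imp_convergent_subsubsequence[OF this strict_mono_id]
  obtain r \<nu> where r: "strict_mono (r :: nat \<Rightarrow> nat)" and \<nu>: "real_distribution \<nu>" and wc: "weak_conv_m (\<lambda>n. \<mu> (r n)) \<nu>"
    by (auto simp: comp_def)
  have lim: "(\<lambda>n. \<integral>x. g x \<partial>\<mu> (r n)) \<longlonglongrightarrow> (\<integral>x. g x \<partial>\<nu>)"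
    if g: "continuous_on UNIV g" "per1 g" for g :: "real \<Rightarrow> real"
  proof -
    obtain M where "\<And>x. \<bar>g x\<bar> \<le> M" using per1_continuous_bounded[OF g(2,1)] by blast
    then show ?thesis
      using g(1) \<mu>(1) \<nu> wc
      by (intro weak_conv_imp_integral_bdd_continuous_conv[where B=M])
        (auto simp: continuous_on_eq_continuous_at)
  qed
  have r_inf: "filterlim (\<lambda>n. real (Suc (r n))) at_top sequentially"
    using filterlim_subseq[OF r] filterlim_real_sequentially filterlim_Suc
    by (intro filterlim_compose[OF filterlim_real_sequentially] filterlim_compose[OF filterlim_Suc])
  have stat: "(\<integral>x. Pop g x \<partial>\<nu>) = (\<integral>x. g x \<partial>\<nu>)"
    if g: "continuous_on UNIV g" "per1 g" for g :: "real \<Rightarrow> real"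
  proof -
    obtain M where M: "M > 0" "\<And>x. \<bar>g x\<bar> \<le> M" using per1_continuous_bounded[OF g(2,1)] by blast
    \<comment> \<open>Applying \<open>Pop\<close> shifts the Cesaro sum by one index, so only two
      end terms remain and the difference is of order 1/n.\<close>
    have Pg: "(\<integral>x. Pop g x \<partial>\<mu> n) - (\<integral>x. g x \<partial>\<mu> n) = ((Pop ^^ Suc n) g (x (Suc n)) - g (x (Suc n))) / real (Suc n)" for n
    proof -
      have "(\<Sum>k<Suc n. (Pop ^^ k) (Pop g) (x (Suc n))) - (\<Sum>k<Suc n. (Pop ^^ k) g (x (Suc n))) =
        (\<Sum>k<Suc n. (Pop ^^ Suc k) g (x (Suc n)) - (Pop ^^ k) g (x (Suc n)))"
        by (simp add: sum_subtractf funpow_Suc_right del: funpow.simps)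
      also have "\<dots> = (Pop ^^ Suc n) g (x (Suc n)) - g (x (Suc n))"
        by (subst sum_lessThan_telescope) simp
      finally show ?thesis
        using g by (simp add: int\<mu> cont_Pop per1_Pop diff_divide_distrib[symmetric] del: funpow.simps sum.lessThan_Suc)
    qed
    have "(\<lambda>n. (\<integral>x. Pop g x \<partial>\<mu> (r n)) - (\<integral>x. g x \<partial>\<mu> (r n))) \<longlonglongrightarrow> 0"
    proof (rule Lim_null_comparison)
      show "(\<lambda>n. (2 * M) / real (Suc (r n))) \<longlonglongrightarrow> 0"
        by (rule tendsto_divide_0[OF tendsto_const]) (rule filterlim_at_top_imp_at_infinity[OF r_inf])
      show "eventually (\<lambda>n. norm ((\<integral>x. Pop g x \<partial>\<mu> (r n)) - (\<integral>x. g x \<partial>\<mu> (r n))) \<le> (2 * M) / real (Suc (r n))) sequentially"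
      proof (rule always_eventually, rule allI)
        fix n
        have "\<bar>(Pop ^^ Suc (r n)) g (x (Suc (r n))) - g (x (Suc (r n)))\<bar> \<le> 2 * M"
          using Pop_pow_abs_le[of g M, OF M(2), where k="Suc (r n)" and x="x (Suc (r n))"] M(2)[of "x (Suc (r n))"] by linarith
        then show "norm ((\<integral>x. Pop g x \<partial>\<mu> (r n)) - (\<integral>x. g x \<partial>\<mu> (r n))) \<le> (2 * M) / real (Suc (r n))"
          unfolding Pg by (simp add: divide_right_mono del: funpow.simps)
      qed
    qed
    moreover have "(\<lambda>n. (\<integral>x. Pop g x \<partial>\<mu> (r n)) - (\<integral>x. g x \<partial>\<mu> (r n))) \<longlonglongrightarrow> (\<integral>x. Pop g x \<partial>\<nu>) - (\<integral>x. g x \<partial>\<nu>)"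
      by (intro tendsto_diff lim cont_Pop per1_Pop g)
    ultimately show ?thesis using LIMSEQ_unique by fastforce
  qed
  show ?thesis
  proof (rule that)
    show "stationary_ifs N p G G' H H' \<nu>"
      using lifted_ifs_axioms \<nu> stat by (auto simp: stationary_ifs_def stationary_ifs_axioms_def)
    show "c \<le> (\<integral>x. psi x \<partial>\<nu>)"
    proof (rule tendsto_lowerbound[OF lim[OF cont_psi per1_psi]])
      show "eventually (\<lambda>n. c \<le> (\<integral>x. psi x \<partial>\<mu> (r n))) sequentially"
      proof (rule always_eventually, rule allI)
        fix n
        show "c \<le> (\<integral>x. psi x \<partial>\<mu> (r n))"
          using lower[of "Suc (r n)"] unfolding int\<mu>[OF cont_psi per1_psi] S_def
          by (simp add: field_simps del: sum.lessThan_Suc)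
      qed
    qed simp
  qed
qed

text \<open>Each \<open>S n\<close> attains its maximum by periodicity and compactness. If no
  \<open>S n\<close> is uniformly negative then all these maxima are nonnegative, and so is the
  maximal exponent \<open>c\<close>; this is the situation of
  \<open>all_invariant_if_nonneg_exponent\<close>.\<close>

lemma negative_exponent_or_invariant:
  assumes "\<nexists>n a. n \<ge> 1 \<and> 0 < a \<and> (\<forall>x. S n x \<le> - a)"
  obtains \<nu> where "real_distribution \<nu>"
    "\<And>j g. j < N \<Longrightarrow> continuous_on UNIV g \<Longrightarrow> per1 (g :: real \<Rightarrow> real) \<Longrightarrow> (\<integral>x. g (G j x) \<partial>\<nu>) = (\<integral>x. g x \<partial>\<nu>)"
proof -
  have "\<exists>x. \<forall>y. S n y \<le> S n x" for n
  proof -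
    obtain x where x: "\<And>y. y \<in> {0..1} \<Longrightarrow> S n y \<le> S n x"
      using continuous_attains_sup[of "{0..1::real}" "S n"] continuous_on_subset[OF cont_S, of "{0..1}" n]
      by (metis atLeastAtMost_iff compact_Icc empty_iff le_numeral_extra(3) subset_UNIV zero_le_one)
    have "S n y \<le> S n x" for y
      using x[of "frac y"] per1_frac[OF per1_S, of n y] frac_ge_0[of y] frac_lt_1[of y] by auto
    then show ?thesis by blast
  qed
  then obtain x where x: "\<And>n y. S n y \<le> S n (x n)" by metis
  have nonneg: "0 \<le> S n (x n)" if "n \<ge> 1" for n
  proof (rule ccontr)
    assume "\<not> 0 \<le> S n (x n)"
    then have "n \<ge> 1 \<and> 0 < - S n (x n) \<and> (\<forall>y. S n y \<le> - (- S n (x n)))" using x that by auto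
    then show False using assms by blast
  qed
  \<comment> \<open>An infimum serves both needs: n * c lies below every maximum, and for each eps
    some n has \<open>S n\<close> <= n * (c + eps) at all points.\<close>
  define c where "c = (INF n\<in>{1..}. S n (x n) / real n)"
  have bdd: "bdd_below ((\<lambda>n. S n (x n) / real n) ` {1..})"
    using nonneg by (intro bdd_belowI[of _ 0]) auto
  have c0: "0 \<le> c" unfolding c_def using nonneg by (intro cINF_greatest) auto
  have lower: "real n * c \<le> S n (x n)" if "n \<ge> 1" for n
  proof -
    have "c \<le> S n (x n) / real n" unfolding c_def using that by (intro cINF_lower bdd) auto
    then show ?thesis using that by (simp add: field_simps)
  qed
  obtain \<nu> where \<nu>: "stationary_ifs N p G G' H H' \<nu>" "c \<le> (\<integral>x. psi x \<partial>\<nu>)"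
    using maximizing_stationary[of x c] x lower by blast
  interpret \<nu>: stationary_ifs N p G G' H H' \<nu> by fact
  have Sn: "\<exists>n\<ge>1. \<forall>y. S n y \<le> real n * (c + eps)" if "eps > 0" for eps
  proof -
    have "\<exists>n\<in>{1..}. S n (x n) / real n < c + eps"
      using that cINF_less_iff[OF _ bdd, of "c + eps"] unfolding c_def by auto
    then obtain n where n: "n \<ge> 1" "S n (x n) / real n < c + eps" by auto
    then have "S n (x n) \<le> real n * (c + eps)" by (simp add: field_simps)
    then show ?thesis using n(1) x[of n] by (meson order_trans)
  qed
  show ?thesis
    using that[of \<nu>] \<nu>.all_invariant_if_nonneg_exponent[OF Sn c0 \<nu>(2)] \<nu>.real_distribution_axioms by blast
qed

end

section \<open>Contraction\<close>

text \<open>For negative z = -w, compare with 1 / (1 + w) and use (1 - w + w^2) * (1 + w) = 1 +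
  w^3.\<close>

lemma exp_le_quadratic:
  fixes z :: real
  assumes "z \<le> 1"
  shows "exp z \<le> 1 + z + z\<^sup>2"
proof (cases "z \<ge> 0")
  case True
  then show ?thesis using assms exp_bound[of z] by simp
next
  case False
  define w where "w = - z"
  have w: "w > 0" using False by (simp add: w_def)
  have "exp z = 1 / exp w" by (simp add: w_def exp_minus divide_inverse)
  also have "\<dots> \<le> 1 / (1 + w)" using w by (intro divide_left_mono) (auto simp: add_pos_pos)
  also have "\<dots> \<le> 1 - w + w\<^sup>2"
  proof -
    have "(1 - w + w\<^sup>2) * (1 + w) = 1 + w ^ 3" by (simp add: algebra_simps power2_eq_square power3_eq_cube)
    then show ?thesis using w by (simp add: pos_divide_le_eq)
  qed
  finally show ?thesis by (simp add: w_def)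
qed

context lifted_ifs
begin

abbreviation cpow :: "real \<Rightarrow> real \<Rightarrow> real \<Rightarrow> real"
  where "cpow al \<equiv> (\<lambda>x y. cdist x y powr al)"

text \<open>Induction on the first step: exp(al * z) is replaced by 1 + al * z + B^2, the mean of z
  over the first map rebuilds \<open>S (Suc k) x\<close>, and 1 + t <= exp t restores the
  exponential. The error B^2 per step is quadratic in \<open>al\<close>. Starting within \<delta> *
  exp(-LB)^k keeps the pair within \<delta>, where \<open>\<delta>\<close> controls the distortion,
  before every one of the k steps.\<close>

lemma local_moment_bound:
  assumes eps: "eps > 0" and \<delta>': "\<delta> > 0"
    and \<delta>: "\<And>i x y. i < N \<Longrightarrow> cdist x y \<le> \<delta> \<Longrightarrow> cdist (G i x) (G i y) \<le> exp (la i x + eps) * cdist x y"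
    and al: "0 < al" "al * (real n * (LB + eps)) \<le> 1"
  shows "k \<le> n \<Longrightarrow> cdist x y \<le> \<delta> * exp (- LB) ^ k \<Longrightarrow> (avg2 N G p ^^ k) (cpow al) x y \<le>
    exp (al * (S k x + real k * eps) + real k * (al * (real n * (LB + eps)))\<^sup>2) * cdist x y powr al"
proof (induction k arbitrary: x y)
  case 0
  then show ?case by (simp add: S_def)
next
  case (Suc k)
  define B where "B = al * (real n * (LB + eps))"
  define V where "V = cdist x y powr al"
  define z where "z i = S k (G i x) + la i x + real (Suc k) * eps" for i
  have "exp (- LB) ^ Suc k \<le> 1" using LB_pos by (intro power_le_one) auto
  then have xy: "cdist x y \<le> \<delta>" using Suc.prems(2) \<delta>' by (meson mult_left_le less_imp_le order_trans)
  have term_le: "(avg2 N G p ^^ k) (cpow al) (G i x) (G i y) \<le> (1 + al * z i + B\<^sup>2) * (exp (real k * B\<^sup>2) * V)"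
    if i: "i < N" for i
  proof -
    have "0 \<le> real (Suc k) * eps" using eps by simp
    then have "\<bar>z i\<bar> \<le> real k * LB + LB + real (Suc k) * eps"
      using S_abs_le[of k "G i x"] LB[OF i, of x] unfolding z_def by linarith
    also have "\<dots> = real (Suc k) * (LB + eps)" by (simp add: algebra_simps)
    also have "\<dots> \<le> real n * (LB + eps)" using Suc.prems(1) LB_pos eps by (intro mult_right_mono) auto
    finally have z: "\<bar>al * z i\<bar> \<le> B" using al(1) by (simp add: B_def abs_mult)
    have "cdist (G i x) (G i y) \<le> exp LB * cdist x y" by (rule cdist_G_Lipschitz[OF i])
    also have "\<dots> \<le> exp LB * (\<delta> * exp (- LB) ^ Suc k)" using Suc.prems(2) by (intro mult_left_mono) auto
    also have "\<dots> = \<delta> * exp (- LB) ^ k" by (simp add: exp_minus)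
    finally have "(avg2 N G p ^^ k) (cpow al) (G i x) (G i y) \<le>
        exp (al * (S k (G i x) + real k * eps) + real k * B\<^sup>2) * cdist (G i x) (G i y) powr al"
      unfolding B_def using Suc.prems(1) by (intro Suc.IH) simp_all
    also have "cdist (G i x) (G i y) powr al \<le> (exp (la i x + eps) * cdist x y) powr al"
      using al(1) \<delta>[OF i xy] by (intro powr_mono2) auto
    also have "\<dots> = exp (al * (la i x + eps)) * V" by (simp add: powr_mult V_def powr_def[of "exp _"])
    also have "exp (al * (S k (G i x) + real k * eps) + real k * B\<^sup>2) * \<dots> = exp (al * z i) * (exp (real k * B\<^sup>2) * V)"
      by (simp add: z_def exp_add[symmetric] algebra_simps)
    also have "exp (al * z i) \<le> 1 + al * z i + (al * z i)\<^sup>2"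
      using z al(2) by (intro exp_le_quadratic) (simp add: B_def)
    also have "\<dots> \<le> 1 + al * z i + B\<^sup>2" using power_mono[OF z, of 2] by simp
    finally show ?thesis by (simp add: V_def mult_right_mono)
  qed
  have "(avg2 N G p ^^ Suc k) (cpow al) x y \<le> (\<Sum>i<N. p i * ((1 + al * z i + B\<^sup>2) * (exp (real k * B\<^sup>2) * V)))"
    unfolding avg2_pow_Suc using term_le by (rule psum_mono)
  also have "\<dots> = (\<Sum>i<N. p i * (al * z i + (1 + B\<^sup>2))) * (exp (real k * B\<^sup>2) * V)"
    by (simp add: sum_distrib_right mult.assoc add_ac)
  also have "(\<Sum>i<N. p i * (al * z i + (1 + B\<^sup>2))) = 1 + (al * (S (Suc k) x + real (Suc k) * eps) + B\<^sup>2)"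
  proof -
    have "(\<Sum>i<N. p i * (al * z i)) = al * (S (Suc k) x + real (Suc k) * eps)"
      using psum_add_const[of "\<lambda>i. S k (G i x) + la i x" "real (Suc k) * eps"]
      unfolding z_def mult.left_commute[of _ al] sum_distrib_left[symmetric] S_Suc Pop_def psi_def
      by (simp add: distrib_left sum.distrib)
    then show ?thesis by (simp add: psum_add_const)
  qed
  also have "(1 + (al * (S (Suc k) x + real (Suc k) * eps) + B\<^sup>2)) * (exp (real k * B\<^sup>2) * V) \<le>
      exp (al * (S (Suc k) x + real (Suc k) * eps) + B\<^sup>2) * (exp (real k * B\<^sup>2) * V)"
    by (intro mult_right_mono exp_ge_add_one_self) (simp add: V_def)
  also have "\<dots> = exp (al * (S (Suc k) x + real (Suc k) * eps) + real (Suc k) * B\<^sup>2) * V"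
    by (simp add: exp_add[symmetric] algebra_simps)
  finally show ?case by (simp only: B_def V_def)
qed

lemma local_contraction:
  assumes n: "n \<ge> 1" and a: "0 < a" and Sn: "\<And>x. S n x \<le> - a"
  obtains al \<delta> lam where "0 < al" "al \<le> 1" "0 < \<delta>" "\<delta> \<le> 1" "0 < lam" "lam < 1"
    "\<And>x y. cdist x y \<le> \<delta> \<Longrightarrow> (avg2 N G p ^^ n) (cpow al) x y \<le> lam * cdist x y powr al"
proof -
  define eps where "eps = a / (2 * real n)"
  have eps: "eps > 0" "real n * eps = a / 2" using a n by (auto simp: eps_def)
  have "\<exists>\<delta>>0. \<forall>i x y. i < N \<longrightarrow> cdist x y \<le> \<delta> \<longrightarrow> cdist (G i x) (G i y) \<le> exp (la i x + eps) * cdist x y"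
    by (rule cdist_G_local[OF eps(1)]) blast
  then obtain \<delta>' where \<delta>': "\<delta>' > 0"
    and G\<delta>': "\<forall>i x y. i < N \<longrightarrow> cdist x y \<le> \<delta>' \<longrightarrow> cdist (G i x) (G i y) \<le> exp (la i x + eps) * cdist x y"
    by (elim exE conjE)
  define B where "B = real n * (LB + eps)"
  have B: "B > 0" using n LB_pos eps by (simp add: B_def)
  \<comment> \<open>Of the gain al * a, half is lost to \<open>eps\<close> and at most a quarter to
    the quadratic error, by the third bound on \<open>al\<close>; the second bound is the
    requirement of \<open>local_moment_bound\<close>. What remains is al * a / 4.\<close>
  define al where "al = min 1 (min (1 / B) (a / (4 * (real n * B\<^sup>2))))"
  have pos: "0 < 1 / B" "0 < real n * B\<^sup>2" "0 < a / (4 * (real n * B\<^sup>2))" using a B n by simp_all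
  have al: "al \<le> 1" "al \<le> 1 / B" "al \<le> a / (4 * (real n * B\<^sup>2))" unfolding al_def by linarith+
  have al0: "0 < al" unfolding al_def using pos by (simp only: min_less_iff_conj zero_less_one simp_thms)
  have al1: "al * B \<le> 1" using al(2) B by (simp add: pos_le_divide_eq)
  have al2: "al * (real n * B\<^sup>2) \<le> a / 4"
  proof -
    have "al * (4 * (real n * B\<^sup>2)) \<le> a" using al(3) pos(2) by (subst (asm) pos_le_divide_eq) auto
    then show ?thesis by simp
  qed
  define \<delta> where "\<delta> = min 1 (\<delta>' * exp (- LB) ^ n)"
  show ?thesis
  proof (rule that[of al \<delta> "exp (- al * a / 4)"])
    show "0 < al" "al \<le> 1" by (fact al0 al(1))+
    show "0 < \<delta>" "\<delta> \<le> 1" using \<delta>' by (simp_all add: \<delta>_def)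
    show "exp (- al * a / 4) < 1" using mult_pos_pos[OF al0 a] by simp
    fix x y assume xy: "cdist x y \<le> \<delta>"
    have "(avg2 N G p ^^ n) (cpow al) x y \<le>
        exp (al * (S n x + real n * eps) + real n * (al * (real n * (LB + eps)))\<^sup>2) * cdist x y powr al"
      by (rule local_moment_bound[OF eps(1) \<delta>' _ al0]) (use G\<delta>' al1 xy in \<open>simp_all add: B_def \<delta>_def\<close>)
    also have "\<dots> \<le> exp (- al * a / 4) * cdist x y powr al"
    proof (rule mult_right_mono)
      have "al * (S n x + real n * eps) \<le> al * (- a / 2)" using Sn[of x] eps(2) al0 by (intro mult_left_mono) linarith+
      moreover have "real n * (al * B)\<^sup>2 \<le> al * (a / 4)"
        using mult_left_mono[OF al2, of al] al0 by (simp add: power2_eq_square mult_ac)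
      ultimately show "exp (al * (S n x + real n * eps) + real n * (al * (real n * (LB + eps)))\<^sup>2) \<le> exp (- al * a / 4)"
        by (simp add: B_def)
    qed simp
    finally show "(avg2 N G p ^^ n) (cpow al) x y \<le> exp (- al * a / 4) * cdist x y powr al" .
  qed simp
qed

end

text \<open>Closed sets form a generating system stable under intersection, and their indicators are
  limits of the bounded continuous functions max 0 (1 - k * infdist).\<close>

lemma measure_circle_eqI:
  fixes M1 M2 :: "circle measure"
  assumes "prob_space M1" "prob_space M2" and s: "sets M1 = sets borel" "sets M2 = sets borel"
    and eq: "\<And>f :: circle \<Rightarrow> real. continuous_on UNIV f \<Longrightarrow> (\<And>x. \<bar>f x\<bar> \<le> 1) \<Longrightarrow> (\<integral>x. f x \<partial>M1) = (\<integral>x. f x \<partial>M2)"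
  shows "M1 = M2"
proof -
  interpret M1: prob_space M1 by fact
  interpret M2: prob_space M2 by fact
  have "measure M1 A = measure M2 A" if A: "closed A" for A
  proof (cases "A = {}")
    case False
    define f where "f k x = max 0 (1 - real k * infdist x A)" for k x
    have fc: "continuous_on UNIV (f k)" for k
      unfolding f_def by (intro continuous_intros)
    have fb: "\<bar>f k x\<bar> \<le> 1" for k x
      using infdist_nonneg[of x A] by (auto simp: f_def max_def)
    have lim: "(\<lambda>k. f k x) \<longlonglongrightarrow> indicator A x" for x
    proof (cases "x \<in> A")
      case True
      then show ?thesis by (simp add: f_def)
    next
      case x: False
      then have d: "infdist x A > 0" using A False by (metis in_closed_iff_infdist_zero infdist_nonneg order_le_less)
      have "eventually (\<lambda>k. real k \<ge> 1 / infdist x A) sequentially"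
        using filterlim_real_sequentially by (simp add: filterlim_at_top)
      then have "eventually (\<lambda>k. f k x = 0) sequentially"
        by eventually_elim (use d in \<open>simp add: f_def field_simps\<close>)
      then show ?thesis using x by (simp add: tendsto_eventually)
    qed
    have L: "(\<lambda>k. \<integral>x. f k x \<partial>M) \<longlonglongrightarrow> measure M A" if "prob_space M" "sets M = sets borel" for M
    proof -
      interpret prob_space M by fact
      note [measurable_cong] = that(2)
      have A': "A \<in> sets M" using A that(2) by simp
      have "f k \<in> borel_measurable M" for k
        using fc by (subst measurable_cong_sets[OF that(2) refl]) (rule borel_measurable_continuous_onI)
      then have "(\<lambda>k. \<integral>x. f k x \<partial>M) \<longlonglongrightarrow> (\<integral>x. indicator A x \<partial>M)"
        using lim fb A' by (intro integral_dominated_convergence[where w="\<lambda>_. 1"]) auto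
      then show ?thesis using A' sets.sets_into_space[OF A'] by (simp add: Int_absorb2)
    qed
    have "(\<integral>x. f k x \<partial>M1) = (\<integral>x. f k x \<partial>M2)" for k by (intro eq fc fb)
    then show ?thesis
      using L[OF assms(1) s(1)] L[OF assms(2) s(2)] by (simp add: LIMSEQ_unique)
  qed simp
  then have e: "emeasure M1 A = emeasure M2 A" if "closed A" for A
    using that by (simp add: M1.emeasure_eq_measure M2.emeasure_eq_measure)
  show ?thesis
  proof (rule measure_eqI_generator_eq[where E="Collect closed" and \<Omega>=UNIV and A="\<lambda>_. UNIV"])
    show "Int_stable (Collect closed :: circle set set)" by (auto simp: Int_stable_def)
    show "sets M1 = sigma_sets UNIV (Collect closed)" "sets M2 = sigma_sets UNIV (Collect closed)"
      unfolding s by (simp_all add: borel_eq_closed)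
  qed (use e in auto)
qed

section \<open>From the lifts back to the circle\<close>

locale circle_ifs = lifted_ifs N p G G' H H'
  for N p G G' H H' +
  fixes F :: "nat \<Rightarrow> circle \<Rightarrow> circle"
  assumes F_abs: "\<And>i x. i < N \<Longrightarrow> F i (abs_circle x) = abs_circle (G i x)"
begin

lemma F_Lipschitz: "i < N \<Longrightarrow> dist (F i x) (F i y) \<le> exp LB * dist x y"
  using abs_circle_surj[of x] abs_circle_surj[of y] cdist_G_Lipschitz[of i] F_abs[of i]
  by (auto simp: cdist_def)

lemma F_cont: "i < N \<Longrightarrow> continuous_on UNIV (F i)"
proof (rule lipschitz_on_continuous_on)
  show "i < N \<Longrightarrow> (exp LB)-lipschitz_on UNIV (F i)" by (rule lipschitz_onI) (auto intro: F_Lipschitz)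
qed

lemma common_invariant_of_lift:
  assumes "real_distribution \<nu>"
    and inv: "\<And>j g. j < N \<Longrightarrow> continuous_on UNIV g \<Longrightarrow> per1 (g :: real \<Rightarrow> real) \<Longrightarrow> (\<integral>x. g (G j x) \<partial>\<nu>) = (\<integral>x. g x \<partial>\<nu>)"
  shows "common_invariant_prob N F (distr \<nu> borel abs_circle)"
proof -
  interpret real_distribution \<nu> by fact
  have [measurable]: "abs_circle \<in> borel_measurable borel"
    by (rule borel_measurable_continuous_onI[OF continuous_on_abs_circle])
  let ?m = "distr \<nu> borel abs_circle"
  have ps: "prob_space ?m" by (rule prob_space_distr) simp
  have "distr ?m borel (F i) = ?m" if i: "i < N" for i
  proof (rule measure_circle_eqI)
    have [measurable]: "F i \<in> borel_measurable borel" by (rule borel_measurable_continuous_onI[OF F_cont[OF i]])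
    show "prob_space (distr ?m borel (F i))" by (rule prob_space.prob_space_distr[OF ps]) simp
    fix f :: "circle \<Rightarrow> real" assume f: "continuous_on UNIV f"
    have [measurable]: "f \<in> borel_measurable borel" by (rule borel_measurable_continuous_onI[OF f])
    have "(\<integral>x. f x \<partial>distr ?m borel (F i)) = (\<integral>x. f (F i (abs_circle x)) \<partial>\<nu>)"
      by (simp add: integral_distr)
    also have "\<dots> = (\<integral>x. f (abs_circle (G i x)) \<partial>\<nu>)" by (simp add: F_abs i)
    also have "\<dots> = (\<integral>x. f (abs_circle x) \<partial>\<nu>)"
    proof (rule inv[OF i])
      show "continuous_on UNIV (\<lambda>x. f (abs_circle x))"
        by (rule continuous_on_compose2[OF f continuous_on_abs_circle]) simp
      have "abs_circle (x + 1) = abs_circle x" for x by (simp add: abs_circle_eq_iff)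
      then show "per1 (\<lambda>x. f (abs_circle x))" by (simp add: per1_def)
    qed
    also have "\<dots> = (\<integral>x. f x \<partial>?m)" by (simp add: integral_distr)
    finally show "(\<integral>x. f x \<partial>distr ?m borel (F i)) = (\<integral>x. f x \<partial>?m)" .
  qed (use ps in auto)
  then show ?thesis using ps by (simp add: common_invariant_prob_def)
qed

lemma avg2_lift:
  "(avg2 N F p ^^ k) f (abs_circle x) (abs_circle y) = (avg2 N G p ^^ k) (\<lambda>x y. f (abs_circle x) (abs_circle y)) x y"
proof (induction k arbitrary: x y)
  case (Suc k)
  show ?case unfolding avg2_pow_Suc by (intro sum.cong refl) (simp add: F_abs Suc)
qed simp

text \<open>Stated in lifted coordinates, so that the compactness argument of
  \<open>global_contraction\<close> runs on the unit square.\<close>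

lemma avg2_continuous:
  assumes "continuous_on UNIV (\<lambda>z. f (abs_circle (fst z)) (abs_circle (snd z)) :: real)"
  shows "continuous_on UNIV (\<lambda>z. (avg2 N F p ^^ k) f (abs_circle (fst z)) (abs_circle (snd z)))"
proof (induction k)
  case (Suc k)
  have "continuous_on UNIV (\<lambda>z. (avg2 N F p ^^ k) f (F i (abs_circle (fst z))) (F i (abs_circle (snd z))))"
    if i: "i < N" for i
  proof -
    have "continuous_on UNIV (\<lambda>z :: real \<times> real. (G i (fst z), G i (snd z)))"
      by (intro continuous_on_Pair continuous_on_compose2[OF G_cont[OF i]] continuous_on_fst continuous_on_snd continuous_on_id) auto
    from continuous_on_compose2[OF Suc this] show ?thesis by (simp add: F_abs i)
  qed
  then show ?case unfolding avg2_pow_Suc by (intro continuous_on_sum continuous_on_mult_left) auto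
qed (use assms in simp)

lemma rand_iter_Lipschitz:
  assumes "\<xi> \<in> seq_space N"
  shows "dist (rand_iter F \<xi> (m + k) x) (rand_iter F \<xi> (m + k) y) \<le>
    exp LB ^ k * dist (rand_iter F \<xi> m x) (rand_iter F \<xi> m y)"
proof (induction k)
  case (Suc k)
  have "\<xi> (Suc (m + k)) < N" using assms by (auto simp: seq_space_def PiE_iff)
  then have "dist (rand_iter F \<xi> (m + Suc k) x) (rand_iter F \<xi> (m + Suc k) y) \<le>
      exp LB * dist (rand_iter F \<xi> (m + k) x) (rand_iter F \<xi> (m + k) y)"
    by (simp add: F_Lipschitz)
  also have "\<dots> \<le> exp LB * (exp LB ^ k * dist (rand_iter F \<xi> m x) (rand_iter F \<xi> m y))"
    using Suc by (intro mult_left_mono) auto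
  finally show ?case by (simp add: mult.assoc)
qed simp

lemma global_contraction:
  assumes prox: "proximal N F dist" and n: "n \<ge> 1" and al: "0 < al" and \<delta>: "0 < \<delta>" "\<delta> \<le> 1"
    and lam: "0 < lam" "lam < 1"
    and loc: "\<And>x y. dist x y \<le> \<delta> \<Longrightarrow> (avg2 N F p ^^ n) (power_dist al) x y \<le> lam * power_dist al x y"
  shows "\<exists>m\<ge>1. \<forall>x y. (avg2 N F p ^^ m) (power_dist al) x y \<le> 1/2 * power_dist al x y"
proof -
  define c0 where "c0 = \<delta> powr al"
  have c0: "0 < c0" "c0 \<le> 1" using \<delta> al by (auto simp: c0_def powr_le1)
  define V :: "circle \<Rightarrow> circle \<Rightarrow> real" where "V = power_dist al"
  define V' where "V' x y = min (V x y) c0" for x y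
  have V0: "0 \<le> V x y" "V x y \<le> 1" for x y
    using dist_circle_le_half[of x y] al by (auto simp: V_def power_dist_def intro!: powr_le1)
  have V'0: "0 \<le> V' x y" "V' x y \<le> c0" for x y using V0 c0 by (auto simp: V'_def)
  have near: "V x y \<le> c0" if "dist x y \<le> \<delta>" for x y
    using that al by (simp add: V_def power_dist_def c0_def powr_mono2)
  have less: "V' x y < c0" if "dist x y < \<delta>" for x y
    using that al by (simp add: V'_def V_def power_dist_def c0_def powr_less_mono2)
  define W where "W j = (avg2 N F p ^^ (n * j)) V'" for j
  have const: "(avg2 N F p ^^ k) (\<lambda>_ _. c) = (\<lambda>_ _. c)" for k c
    by (induction k) (simp_all add: avg2_const[OF p])
  have Vc: "(avg2 N F p ^^ k) V' x y \<le> c0" for k x y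
    using avg2_pow_mono[OF p, where f=V' and g="\<lambda>_ _. c0" and F=F and k=k and x=x and y=y] V'0 by (simp add: const)
  \<comment> \<open>Near the diagonal V' = V and the local estimate applies to the larger V; away
    from it V' = c0 is already the maximal value.\<close>
  have Qn: "(avg2 N F p ^^ n) V' x y \<le> V' x y" "dist x y \<le> \<delta> \<Longrightarrow> (avg2 N F p ^^ n) V' x y \<le> lam * V' x y" for x y
  proof -
    have le: "(avg2 N F p ^^ n) V' x y \<le> (avg2 N F p ^^ n) V x y"
      by (rule avg2_pow_mono[OF p]) (simp add: V'_def)
    show near_le: "(avg2 N F p ^^ n) V' x y \<le> lam * V' x y" if d: "dist x y \<le> \<delta>"
      using le loc[OF d] near[OF d] by (simp add: V'_def V_def)
    show "(avg2 N F p ^^ n) V' x y \<le> V' x y"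
    proof (cases "dist x y \<le> \<delta>")
      case True
      have "lam * V' x y \<le> V' x y" using lam V'0(1)[of x y] by (simp add: mult_left_le_one_le)
      then show ?thesis using near_le[OF True] by linarith
    next
      case False
      then have "c0 \<le> V x y" using al \<delta> by (simp add: V_def power_dist_def c0_def powr_mono2)
      then show ?thesis using Vc[of n x y] by (simp add: V'_def)
    qed
  qed
  have W_Suc: "W (Suc j) x y \<le> W j x y" for j x y
  proof -
    have "W (Suc j) x y = (avg2 N F p ^^ (n * j)) ((avg2 N F p ^^ n) V') x y"
      by (simp only: W_def mult_Suc_right add.commute[of n] funpow_add comp_apply)
    also have "\<dots> \<le> W j x y" unfolding W_def by (rule avg2_pow_mono[OF p Qn(1)])
    finally show ?thesis .
  qed
  have W_anti: "W j x y \<le> W i x y" if "i \<le> j" for i j x y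
    using that by (induction rule: dec_induct) (auto intro: order_trans[OF W_Suc])
  have reach: "\<exists>j. W j x y < c0" for x y
  proof -
    obtain \<xi> r where \<xi>: "\<xi> \<in> seq_space N" and lim: "(\<lambda>k. Zdist F dist (r k) x y \<xi>) \<longlonglongrightarrow> 0"
      using prox unfolding proximal_def by blast
    \<comment> \<open>The time r k is rounded up to a multiple of n; at most n further steps expand
      distances by at most exp LB ^ n, which this choice allows for.\<close>
    define eps where "eps = \<delta> / exp LB ^ n"
    have "eps > 0" using \<delta> by (simp add: eps_def)
    then obtain k where "norm (Zdist F dist (r k) x y \<xi> - 0) < eps" using LIMSEQ_D[OF lim] by blast
    then have Z: "dist (rand_iter F \<xi> (r k) x) (rand_iter F \<xi> (r k) y) < eps" by (simp add: Zdist_def)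
    \<comment> \<open>With + 1 the time n * j lies strictly after r k, even if n divides r k, and
      exceeds it by at most n.\<close>
    define j where "j = r k div n + 1"
    define d where "d = n * j - r k"
    define q where "q = n * (r k div n)"
    have nj: "n * j = q + n" by (simp only: j_def q_def distrib_left mult_1_right)
    have "r k < n + q" unfolding q_def using n by (intro dividend_less_times_div) linarith
    moreover have "q \<le> r k" unfolding q_def by (rule times_div_less_eq_dividend)
    ultimately have q: "r k < q + n" "q \<le> r k" by linarith+
    have d: "n * j = r k + d" "d \<le> n" using q unfolding d_def nj by simp_all
    have "dist (rand_iter F \<xi> (n * j) x) (rand_iter F \<xi> (n * j) y) \<le> exp LB ^ d * dist (rand_iter F \<xi> (r k) x) (rand_iter F \<xi> (r k) y)"
      unfolding d(1) by (rule rand_iter_Lipschitz[OF \<xi>])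
    also have "\<dots> \<le> exp LB ^ n * dist (rand_iter F \<xi> (r k) x) (rand_iter F \<xi> (r k) y)"
      using d(2) LB_pos by (intro mult_right_mono power_increasing) auto
    also have "\<dots> < exp LB ^ n * eps" using Z by (intro mult_strict_left_mono) auto
    also have "\<dots> = \<delta>" by (simp add: eps_def)
    finally have "V' (rand_iter F \<xi> (n * j) x) (rand_iter F \<xi> (n * j) y) < c0" by (rule less)
    then have "W j x y < c0" unfolding W_def
      using \<xi> V'0 by (intro avg2_pow_less[OF p, where \<xi>=\<xi>]) (auto simp: seq_space_def PiE_iff)
    then show ?thesis ..
  qed
  define w where "w j z = W j (abs_circle (fst z)) (abs_circle (snd z))" for j and z :: "real \<times> real"
  have w_cont: "continuous_on UNIV (w j)" for j
    unfolding w_def W_def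
  proof (rule avg2_continuous)
    have "continuous_on UNIV (\<lambda>z :: real \<times> real. cdist (fst z) (snd z) powr al)"
      using al by (intro continuous_on_powr' continuous_on_const continuous_on_cdist continuous_on_fst continuous_on_snd continuous_on_id) auto
    then show "continuous_on UNIV (\<lambda>z :: real \<times> real. V' (abs_circle (fst z)) (abs_circle (snd z)))"
      unfolding V'_def V_def power_dist_def cdist_def by (intro continuous_on_min continuous_on_const)
  qed
  let ?K = "{0..1} \<times> {0..1} :: (real \<times> real) set"
  have K: "compact ?K" by (intro compact_Times) auto
  have "\<exists>J. \<forall>z\<in>?K. w J z < c0"
  proof -
    have op: "\<And>j. j \<in> (UNIV :: nat set) \<Longrightarrow> open {z. w j z < c0}"
      by (intro open_Collect_less continuous_on_const w_cont)
    have cov: "?K \<subseteq> (\<Union>j\<in>UNIV. {z. w j z < c0})" using reach by (auto simp: w_def)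
    obtain I where "I \<subseteq> UNIV" and I: "finite I" "?K \<subseteq> (\<Union>j\<in>I. {z. w j z < c0})"
      by (rule compactE_image[OF K op cov])
    \<comment> \<open>As \<open>W j\<close> decreases in j, the sets of the cover grow, so the
      largest index of the finite subcover serves all points; the 0 keeps \<open>Max\<close>
      meaningful.\<close>
    have "w (Max (insert 0 I)) z < c0" if "z \<in> ?K" for z
    proof -
      obtain j where "j \<in> I" "w j z < c0" using I(2) \<open>z \<in> ?K\<close> by blast
      moreover have "j \<le> Max (insert 0 I)" using I(1) \<open>j \<in> I\<close> by (intro Max_ge) auto
      ultimately show ?thesis using W_anti[of j "Max (insert 0 I)"] unfolding w_def by (meson order_le_less_trans)
    qed
    then show ?thesis by blast
  qed
  then obtain J where J: "\<And>z. z \<in> ?K \<Longrightarrow> w J z < c0" by blast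
  have ne: "?K \<noteq> {}" by simp
  have "\<exists>z\<in>?K. \<forall>y\<in>?K. w J y \<le> w J z"
    by (rule continuous_attains_sup[OF K ne continuous_on_subset[OF w_cont]]) simp
  then obtain z0 where z0: "z0 \<in> ?K" "\<And>z. z \<in> ?K \<Longrightarrow> w J z \<le> w J z0" by blast
  define l2 where "l2 = max (w J z0 / c0) 0"
  have l2: "0 \<le> l2" "l2 < 1" using J[OF z0(1)] c0 by (auto simp: l2_def)
  have WJ: "W J x y \<le> l2 * c0" for x y
  proof -
    obtain s t where st: "s \<in> {0..1}" "t \<in> {0..1}" "x = abs_circle s" "y = abs_circle t"
      using abs_circle_surj_unit[of x] abs_circle_surj_unit[of y] by blast
    have "W J x y = w J (s, t)" by (simp add: w_def st)
    also have "\<dots> \<le> w J z0" using st by (intro z0) auto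
    also have "\<dots> = w J z0 / c0 * c0" using c0 by simp
    also have "\<dots> \<le> l2 * c0" using c0 by (intro mult_right_mono) (auto simp: l2_def)
    finally show ?thesis .
  qed
  \<comment> \<open>J blocks of n steps give the factor l2 far from the diagonal, one block gives
    lam near it; since \<open>W\<close> never increases, both hold after \<open>Suc J\<close>
    blocks, also when J = 0.\<close>
  define M where "M = n * Suc J"
  define l where "l = max lam l2"
  have l: "0 \<le> l" "l < 1" using lam l2 by (auto simp: l_def)
  have QM: "(avg2 N F p ^^ M) V' x y \<le> l * V' x y" for x y
  proof (cases "dist x y \<le> \<delta>")
    case True
    have "W (Suc J) x y \<le> W 1 x y" by (rule W_anti) simp
    also have "\<dots> \<le> lam * V' x y" using Qn(2)[OF True] by (simp add: W_def)
    also have "\<dots> \<le> l * V' x y" using V'0 by (intro mult_right_mono) (auto simp: l_def)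
    finally show ?thesis by (simp add: W_def M_def)
  next
    case False
    then have "c0 \<le> V x y" using al \<delta> by (simp add: V_def power_dist_def c0_def powr_mono2)
    then have v: "V' x y = c0" by (simp add: V'_def)
    have "W (Suc J) x y \<le> l2 * c0" using W_Suc[of J x y] WJ[of x y] by linarith
    also have "\<dots> \<le> l * c0" using c0 by (intro mult_right_mono) (auto simp: l_def)
    finally show ?thesis by (simp add: W_def M_def v)
  qed
  have iter: "(avg2 N F p ^^ (M * k)) V' x y \<le> l ^ k * V' x y" for k x y
  proof (induction k arbitrary: x y)
    case (Suc k)
    have "(avg2 N F p ^^ (M * Suc k)) V' x y = (avg2 N F p ^^ M) ((avg2 N F p ^^ (M * k)) V') x y"
      by (simp only: mult_Suc_right funpow_add comp_apply)
    also have "\<dots> \<le> (avg2 N F p ^^ M) (\<lambda>x y. l ^ k * V' x y) x y"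
      by (rule avg2_pow_mono[OF p Suc])
    also have "\<dots> = l ^ k * (avg2 N F p ^^ M) V' x y" by (simp add: avg2_pow_scale)
    also have "\<dots> \<le> l ^ k * (l * V' x y)" using QM l by (intro mult_left_mono) auto
    finally show ?case by (simp add: mult_ac)
  qed simp
  \<comment> \<open>Since c0 * V <= V' <= V (using V <= 1), returning from V' to V costs the factor
    1 / c0; enough repetitions make l^k < c0 / 2 and leave the factor 1/2.\<close>
  have "(\<lambda>k. l ^ k) \<longlonglongrightarrow> 0" using l by (intro LIMSEQ_power_zero) auto
  then obtain k0 where "\<forall>k\<ge>k0. norm (l ^ k - 0) < c0 / 2"
    using LIMSEQ_D[of "\<lambda>k. l ^ k" 0 "c0 / 2"] c0 by auto
  then have "norm (l ^ Suc k0 - 0) < c0 / 2" by (rule allE[of _ "Suc k0"]) simp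
  moreover have "0 \<le> l ^ Suc k0" using l by (intro zero_le_power) simp
  ultimately have lk: "l ^ Suc k0 < c0 / 2" by (simp only: real_norm_def diff_zero abs_of_nonneg)
  show ?thesis
  proof (intro exI[of _ "M * Suc k0"] conjI allI)
    show "1 \<le> M * Suc k0" using n by (simp add: M_def)
    fix x y
    have VV': "V x y \<le> 1 / c0 * V' x y" for x y
    proof -
      have "c0 * V x y \<le> V' x y"
        using V0[of x y] c0 by (auto simp: V'_def mult_left_le_one_le mult_left_le)
      then show ?thesis using c0 by (simp add: field_simps)
    qed
    have "(avg2 N F p ^^ (M * Suc k0)) V x y \<le> (avg2 N F p ^^ (M * Suc k0)) (\<lambda>x y. 1 / c0 * V' x y) x y"
      by (rule avg2_pow_mono[OF p VV'])
    also have "\<dots> = 1 / c0 * (avg2 N F p ^^ (M * Suc k0)) V' x y" by (simp only: avg2_pow_scale)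
    also have "\<dots> \<le> 1 / c0 * (l ^ Suc k0 * V' x y)" using c0 by (intro mult_left_mono iter) auto
    also have "\<dots> \<le> 1 / c0 * (c0 / 2 * V x y)"
      using lk c0 V'0 by (intro mult_left_mono mult_mono) (auto simp: V'_def)
    also have "\<dots> = 1/2 * V x y" using c0 by simp
    finally show "(avg2 N F p ^^ (M * Suc k0)) (power_dist al) x y \<le> 1/2 * power_dist al x y" by (simp add: V_def)
  qed
qed

end

section \<open>Existence of the lifts, and the conclusion\<close>

definition C1_lift :: "(circle \<Rightarrow> circle) \<Rightarrow> (real \<Rightarrow> real) \<Rightarrow> (real \<Rightarrow> real) \<Rightarrow> bool"
  where "C1_lift g G G' \<longleftrightarrow> (\<forall>x. (G has_real_derivative G' x) (at x)) \<and> continuous_on UNIV G' \<and>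
    (\<exists>k::int. \<forall>x. G (x + 1) = G x + of_int k) \<and> (\<forall>x. g (abs_circle x) = abs_circle (G x))"

lemma C1_lift_continuous: "C1_lift g G G' \<Longrightarrow> continuous_on UNIV G"
  unfolding C1_lift_def by (meson DERIV_continuous_on has_field_derivative_at_within)

lemma C1_circle_map_lift:
  assumes "C1_circle_map g"
  shows "\<exists>G G'. C1_lift g G G'"
proof -
  obtain G :: "real \<Rightarrow> real" where "G C1_differentiable_on UNIV" and g: "\<And>t. g (abs_circle t) = abs_circle (G t)"
    using assms by (auto simp: C1_circle_map_def)
  then obtain G' where G': "\<And>x. (G has_real_derivative G' x) (at x)" "continuous_on UNIV G'"
    by (auto simp: C1_differentiable_on_def has_real_derivative_iff_has_vector_derivative)
  have Gc: "continuous_on UNIV G" using G'(1) by (meson DERIV_continuous_on has_field_derivative_at_within)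
  have "continuous_on UNIV (\<lambda>x. G (x + 1))"
    by (rule continuous_on_compose2[OF Gc]) (auto intro!: continuous_intros)
  moreover have "G (x + 1) - G x \<in> \<int>" for x
  proof -
    have "abs_circle (x + 1) = abs_circle x" by (simp add: abs_circle_eq_iff)
    then have "abs_circle (G (x + 1)) = abs_circle (G x)" by (metis g)
    then show ?thesis by (simp add: abs_circle_eq_iff)
  qed
  ultimately obtain k :: int where "\<And>x. G (x + 1) - G x = of_int k"
    using continuous_int_valued_const[of "\<lambda>x. G (x + 1) - G x"] continuous_on_diff[OF _ Gc] by blast
  then have "\<forall>x. G (x + 1) = G x + of_int k" by (simp add: algebra_simps)
  then show ?thesis unfolding C1_lift_def using G' g by blast
qed

lemma C1_lift_diff_int:
  assumes "C1_lift g H H'"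
  shows "C1_lift g (\<lambda>x. H x - of_int k) H'"
proof -
  obtain k' :: int where "\<forall>x. H (x + 1) = H x + of_int k'" using assms by (auto simp: C1_lift_def)
  then have "H (x + 1) - of_int k = H x - of_int k + of_int k'" for x by simp
  moreover have "((\<lambda>x. H x - of_int k) has_real_derivative H' x) (at x)" for x
    using assms unfolding C1_lift_def by (auto intro!: derivative_eq_intros)
  moreover have "g (abs_circle x) = abs_circle (H x - of_int k)" for x
    using assms by (simp add: C1_lift_def abs_circle_eq_iff)
  ultimately show ?thesis using assms unfolding C1_lift_def by blast
qed

text \<open>Lifts of a map and of its inverse, chosen independently, compose to a translation by a
  constant integer; subtracting it from the second makes it a left inverse of the first.\<close>

lemma C1_diffeo_lifts:
  assumes "C1_diffeo f"
  shows "\<exists>G G' H H'. C1_lift f G G' \<and> C1_lift (inv f) H H' \<and> (\<forall>x. H (G x) = x)"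
proof -
  have f: "bij f" "C1_circle_map f" "C1_circle_map (inv f)" using assms by (auto simp: C1_diffeo_def)
  obtain G G' where G: "C1_lift f G G'" using C1_circle_map_lift[OF f(2)] by (elim exE)
  obtain H H' where H: "C1_lift (inv f) H H'" using C1_circle_map_lift[OF f(3)] by (elim exE)
  have "continuous_on UNIV (\<lambda>x. H (G x) - x)"
    by (intro continuous_on_diff continuous_on_id
        continuous_on_compose2[OF C1_lift_continuous[OF H] C1_lift_continuous[OF G]]) auto
  moreover have "H (G x) - x \<in> \<int>" for x
  proof -
    have "abs_circle (H (G x)) = inv f (f (abs_circle x))" using G H by (simp add: C1_lift_def)
    also have "\<dots> = abs_circle x" using f(1) by (simp add: bij_is_inj)
    finally show ?thesis by (simp add: abs_circle_eq_iff)
  qed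
  ultimately obtain k :: int where k: "\<And>x. H (G x) - x = of_int k"
    using continuous_int_valued_const[of "\<lambda>x. H (G x) - x"] by blast
  have "H (G x) - of_int k = x" for x using k[of x] by linarith
  then show ?thesis using G C1_lift_diff_int[OF H, of k] by blast
qed

text \<open>Strong equivalence is asserted between d^\<alpha> and D: as D >= d^\<alpha>, the ratio D
  / d is unbounded near the diagonal if \<alpha> < 1. The witnesses are lam = 1/2 and the number
  \<open>m\<close> of steps from \<open>global_contraction\<close>, not the \<open>n\<close> of the
  local estimate.\<close>

theorem theorem1p2:
  fixes N :: nat and F :: "nat \<Rightarrow> circle \<Rightarrow> circle"
  assumes "N \<ge> 2"
    and "\<And>i. i < N \<Longrightarrow> C1_diffeo (F i)"
    and "proximal N F dist"
    and "\<not> (\<exists>\<nu>. common_invariant_prob N F \<nu>)"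
  shows "\<forall>p. nondegenerate_prob_vector N p \<longrightarrow>
    (\<exists>\<alpha>\<in>{0<..1}. \<exists>lam\<in>{0<..<1}. \<exists>n\<ge>1.
      let D = averaged_metric N F p (power_dist \<alpha>) n lam in
        contracting_on_average N F p D \<and>
        (\<exists>C>0. \<forall>x y. dist x y \<le> D x y \<and> D x y \<le> C * power_dist \<alpha> x y) \<and>
        strongly_equivalent (power_dist \<alpha>) D)"
proof (intro allI impI)
  fix p assume p: "nondegenerate_prob_vector N p"
  have "\<forall>i. \<exists>G G' H H'. i < N \<longrightarrow> C1_lift (F i) G G' \<and> C1_lift (inv (F i)) H H' \<and> (\<forall>x. H (G x) = x)"
    using C1_diffeo_lifts assms(2) by meson
  then have "\<exists>G G' H H'. \<forall>i. i < N \<longrightarrow>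
      C1_lift (F i) (G i) (G' i) \<and> C1_lift (inv (F i)) (H i) (H' i) \<and> (\<forall>x. H i (G i x) = x)"
    unfolding choice_iff .
  then obtain G G' H H' :: "nat \<Rightarrow> real \<Rightarrow> real" where L: "\<forall>i. i < N \<longrightarrow>
      C1_lift (F i) (G i) (G' i) \<and> C1_lift (inv (F i)) (H i) (H' i) \<and> (\<forall>x. H i (G i x) = x)"
    by (elim exE)
  interpret circle_ifs N p G G' H H' F
    by unfold_locales (use p L in \<open>auto simp: C1_lift_def\<close>)
  have "\<exists>n a. n \<ge> 1 \<and> 0 < a \<and> (\<forall>x. S n x \<le> - a)"
  proof (rule ccontr)
    assume "\<nexists>n a. n \<ge> 1 \<and> 0 < a \<and> (\<forall>x. S n x \<le> - a)"
    from negative_exponent_or_invariant[OF this] show False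
      using common_invariant_of_lift assms(4) by metis
  qed
  then obtain n a where n: "n \<ge> 1" and a: "0 < a" and Sn: "\<And>x. S n x \<le> - a" by blast
  have "\<exists>al \<delta> lam. 0 < al \<and> al \<le> 1 \<and> 0 < \<delta> \<and> \<delta> \<le> 1 \<and> 0 < lam \<and> lam < 1 \<and> (\<forall>x y. cdist x y \<le> \<delta> \<longrightarrow>
      (avg2 N G p ^^ n) (cpow al) x y \<le> lam * cdist x y powr al)"
    by (rule local_contraction[OF n a Sn]) blast
  then obtain al \<delta> lam where al: "0 < al" "al \<le> 1" and \<delta>: "0 < \<delta>" "\<delta> \<le> 1" and lam: "0 < lam" "lam < 1"
    and loc: "\<forall>x y. cdist x y \<le> \<delta> \<longrightarrow> (avg2 N G p ^^ n) (cpow al) x y \<le> lam * cdist x y powr al"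
    by (elim exE conjE)
  have "(avg2 N F p ^^ n) (power_dist al) x y \<le> lam * power_dist al x y" if d: "dist x y \<le> \<delta>" for x y
  proof -
    obtain s t where "x = abs_circle s" "y = abs_circle t" using abs_circle_surj by meson
    then show ?thesis using loc[rule_format, of s t] d by (simp add: avg2_lift cdist_def power_dist_def)
  qed
  then obtain m where m: "m \<ge> 1" "\<And>x y. (avg2 N F p ^^ m) (power_dist al) x y \<le> 1/2 * power_dist al x y"
    using global_contraction[OF assms(3) n al(1) \<delta> lam] by blast
  have lip: "power_dist al (F i x) (F i y) \<le> exp LB powr al * power_dist al x y" if "i < N" for i x y
    unfolding power_dist_def using al F_Lipschitz[OF that, of x y]
    by (subst powr_mult[symmetric]) (auto intro!: powr_mono2)
  note D = averaged_metric_equivalent[OF p m(1) _ _ Metric_space_power_dist[OF al] lip m(2)]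
  \<comment> \<open>Distances are at most 1/2, and t <= t^\<alpha> on [0,1].\<close>
  have dist_le: "dist x y \<le> power_dist al x y" for x y :: circle
    using powr_mono'[of al 1 "dist x y"] dist_circle_le_half[of x y] al by (simp add: power_dist_def)
  let ?D = "averaged_metric N F p (power_dist al) m (1/2)"
  have "contracting_on_average N F p ?D" "strongly_equivalent (power_dist al) ?D" using D(1,4) by auto
  moreover have "\<exists>C>0. \<forall>x y. dist x y \<le> ?D x y \<and> ?D x y \<le> C * power_dist al x y"
  proof -
    have "dist x y \<le> ?D x y" for x y using dist_le[of x y] D(2)[of x y] by simp
    moreover have "\<exists>C>0. \<forall>x y. ?D x y \<le> C * power_dist al x y" using D(3) by simp
    ultimately show ?thesis by blast
  qed
  ultimately show "\<exists>\<alpha>\<in>{0<..1}. \<exists>lam\<in>{0<..<1}. \<exists>n\<ge>1.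
      let D = averaged_metric N F p (power_dist \<alpha>) n lam in
        contracting_on_average N F p D \<and>
        (\<exists>C>0. \<forall>x y. dist x y \<le> D x y \<and> D x y \<le> C * power_dist \<alpha> x y) \<and>
        strongly_equivalent (power_dist \<alpha>) D"
    unfolding Let_def using al m(1)
    by (intro bexI[of _ al] bexI[of _ "1/2"] exI[of _ m]) auto
qed

end
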